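(* There exist two absolute constants $\lambda_2>\lambda_1>0$ such that the following holds. Suppose that one of the following two conditions is satisfied: (i) $\eta_0=a_1\tilde e_1^{(o)}$ with $a_1\in\mathbb{R}$, $a_1\ne0$; (ii) $\eta_0=a_1\tilde e_1^{(o)}+a_k\tilde e_k^{(o)}$ with $k\ge2$ an integer, $a_1,a_k\in\mathbb{R}$, and $$0<a_k^2\le\frac{11}{18(d_{k+2}-d_k)}\,a_1^2.$$ Let $\eta$ be the unique global classical odd solution of $$\partial_t\eta+L\eta=0,\qquad \partial_\theta v=H\eta,\qquad \eta(0,\theta)=\eta_0(\theta),\qquad v(t,0)=0$$ with $\eta\in C([0,T];\mathcal{H}_{DW})$ and $\rho^{1/2}\partial_\theta\eta\in C([0,T];H^m(\mathbb{T}))\cap C^2([0,T];H^{m-2}(\mathbb{T}))$ for every $T>0$ (with $m>3$ an integer). Then for all $0<t<\infty$, $$0<J_1^{1/2}(t)<\|\eta(t)\|_{\mathcal{H}_{DW}}<J_2^{1/2}(t),$$ where, for $i=1,2$, $$J_i(t)=\frac{\langle\eta_0,\eta_0\rangle_\rho+\frac{1}{\sqrt{\lambda_i}}\langle-L\eta_0,\eta_0\rangle_\rho}{2}\,e^{2\sqrt{\lambda_i}\,t}+\frac{\langle\eta_0,\eta_0\rangle_\rho-\frac{1}{\sqrt{\lambda_i}}\langle-L\eta_0,\eta_0\rangle_\rho}{2}\,e^{-2\sqrt{\lambda_i}\,t}.$$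
   Context: $\mathbb{T}=[-\pi,\pi]$ is the torus (functions are $2\pi$-periodic); $H^m(\mathbb{T})$ is the periodic Sobolev space. $H$ is the periodic Hilbert transform, $Hf(\theta)=\frac{1}{2\pi}\,\mathrm{P.V.}\int_{-\pi}^{\pi}\cot\frac{\theta-\phi}{2}f(\phi)\,d\phi$, so $H\sin k\theta=-\cos k\theta$ and $H\cos k\theta=\sin k\theta$ for $k\ge1$. Given $\eta$, the function $v$ is determined by $\partial_\theta v=H\eta$ and $v(\cdot,0)=0$, and $$L\eta=\tfrac12\sin2\theta\,\partial_\theta\eta-\cos2\theta\,\eta+\sin2\theta\,H\eta-2\cos2\theta\,v.$$ For $k\ge1$: $\tilde e_k^{(o)}=\frac{\sin(k+2)\theta}{k+2}-\frac{\sin k\theta}{k}$ and $d_k=\frac{(k-2)^2(k+2)}{4k^2}$ (one has $d_{k+2}-d_k>0$ for $k\ge2$). The weight is $\rho=\frac{1}{4\pi\sin^2\theta}$, and $\rho^{1/2}$ denotes $\frac{1}{2\sqrt{\pi}\,\sin\theta}$. The space $\mathcal{H}_{DW}=\{\eta\in H^1(\mathbb{T}):\eta\text{ odd},\ \int_{\mathbb{T}}\frac{|\partial_\theta\eta|^2}{\sin^2\theta}\,d\theta<\infty\}$ is a Hilbert space with inner product $\langle\xi,\eta\rangle_\rho=\int_{-\pi}^{\pi}\rho\,\partial_\theta\xi\,\partial_\theta\eta\,d\theta$ and norm $\|\eta\|_{\mathcal{H}_{DW}}=\langle\eta,\eta\rangle_\rho^{1/2}$. The solution $\eta$ in the claim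 exists and is unique whenever $\eta_0\in\mathcal{H}_{DW}$ and $\rho^{1/2}\partial_\theta\eta_0\in H^m(\mathbb{T})$, which holds for the data considered. *)

theory Defs
  imports "HOL-Analysis.Analysis"
begin

text \<open>
  Functions on the torus are \<open>2\<pi>\<close>-periodic functions \<open>real \<Rightarrow> real\<close>, integrated over \<open>[-\<pi>, \<pi>]\<close>.
  Elements of \<open>L\<^sup>2\<close> and of the Sobolev spaces are represented by honest functions; all norms and
  inner products below depend only on the almost-everywhere classes.
\<close>

definition torus_periodic :: "(real \<Rightarrow> real) \<Rightarrow> bool" where
  "torus_periodic f \<longleftrightarrow> (\<forall>\<theta>. f (\<theta> + 2 * pi) = f \<theta>)"

definition odd_fun :: "(real \<Rightarrow> real) \<Rightarrow> bool" where
  "odd_fun f \<longleftrightarrow> (\<forall>\<theta>. f (- \<theta>) = - f \<theta>)"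

definition L2_torus :: "(real \<Rightarrow> real) set" where
  "L2_torus = {u. torus_periodic u \<and> u \<in> borel_measurable lebesgue \<and>
     set_integrable lebesgue {-pi..pi} (\<lambda>\<theta>. (u \<theta>)\<^sup>2)}"

definition L2_norm_torus :: "(real \<Rightarrow> real) \<Rightarrow> real" where
  "L2_norm_torus u = sqrt (LINT \<theta>:{-pi..pi}|lebesgue. (u \<theta>)\<^sup>2)"

definition torus_test_fun :: "(real \<Rightarrow> real) \<Rightarrow> bool" where
  "torus_test_fun \<phi> \<longleftrightarrow>
     torus_periodic \<phi> \<and> (\<forall>n x. (deriv ^^ n) \<phi> field_differentiable at x)"

definition has_weak_deriv :: "(real \<Rightarrow> real) \<Rightarrow> (real \<Rightarrow> real) \<Rightarrow> bool" where
  "has_weak_deriv u g \<longleftrightarrow> u \<in> L2_torus \<and> g \<in> L2_torus \<and>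
     (\<forall>\<phi>. torus_test_fun \<phi> \<longrightarrow>
        (LINT \<theta>:{-pi..pi}|lebesgue. u \<theta> * deriv \<phi> \<theta>)
          = - (LINT \<theta>:{-pi..pi}|lebesgue. g \<theta> * \<phi> \<theta>))"

text \<open>A representative of the weak derivative; it is determined up to a null set.\<close>

definition weak_deriv :: "(real \<Rightarrow> real) \<Rightarrow> real \<Rightarrow> real" where
  "weak_deriv u = (SOME g. has_weak_deriv u g)"

primrec sobolev :: "nat \<Rightarrow> (real \<Rightarrow> real) set" where
  "sobolev 0 = L2_torus"
| "sobolev (Suc m) = {u \<in> L2_torus. \<exists>g \<in> sobolev m. has_weak_deriv u g}"

definition sobolev_norm :: "nat \<Rightarrow> (real \<Rightarrow> real) \<Rightarrow> real" where
  "sobolev_norm m u = sqrt (\<Sum>j\<le>m. (L2_norm_torus ((weak_deriv ^^ j) u))\<^sup>2)"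

text \<open>
  The principal value removes an \<open>\<epsilon>\<close>-neighbourhood of \<open>\<theta>\<close> with respect to the distance on the
  torus, so that it is the correct one also at \<open>\<theta> = \<plusminus>\<pi>\<close> and for \<open>\<theta>\<close> outside \<open>[-\<pi>, \<pi>]\<close>.
\<close>

definition hilbert :: "(real \<Rightarrow> real) \<Rightarrow> real \<Rightarrow> real" where
  "hilbert f \<theta> = Lim (at_right 0) (\<lambda>\<epsilon>. 1 / (2 * pi) *
     (LINT \<phi>:{\<phi> \<in> {-pi..pi}. \<forall>n::int. \<epsilon> \<le> \<bar>\<theta> - \<phi> - 2 * pi * of_int n\<bar>}|lebesgue.
        cot ((\<theta> - \<phi>) / 2) * f \<phi>))"

definition is_velocity :: "(real \<Rightarrow> real) \<Rightarrow> (real \<Rightarrow> real) \<Rightarrow> bool" where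
  "is_velocity \<eta> v \<longleftrightarrow>
     v 0 = 0 \<and> (\<forall>\<theta>. (v has_real_derivative hilbert \<eta> \<theta>) (at \<theta>))"

definition velocity :: "(real \<Rightarrow> real) \<Rightarrow> real \<Rightarrow> real" where
  "velocity \<eta> = (THE v. is_velocity \<eta> v)"

definition L_op :: "(real \<Rightarrow> real) \<Rightarrow> real \<Rightarrow> real" where
  "L_op \<eta> \<theta> = 1 / 2 * sin (2 * \<theta>) * deriv \<eta> \<theta> - cos (2 * \<theta>) * \<eta> \<theta>
     + sin (2 * \<theta>) * hilbert \<eta> \<theta> - 2 * cos (2 * \<theta>) * velocity \<eta> \<theta>"

definition e_odd :: "nat \<Rightarrow> real \<Rightarrow> real" where
  "e_odd k \<theta> = sin (real (k + 2) * \<theta>) / real (k + 2) - sin (real k * \<theta>) / real k"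

definition d_coef :: "nat \<Rightarrow> real" where
  "d_coef k = (real k - 2)\<^sup>2 * (real k + 2) / (4 * (real k)\<^sup>2)"

definition rho :: "real \<Rightarrow> real" where
  "rho \<theta> = 1 / (4 * pi * (sin \<theta>)\<^sup>2)"

text \<open>The square root of \<open>\<rho>\<close> taken with the sign of \<open>sin \<theta>\<close>.\<close>

definition rho_half :: "real \<Rightarrow> real" where
  "rho_half \<theta> = 1 / (2 * sqrt pi * sin \<theta>)"

definition H_DW :: "(real \<Rightarrow> real) set" where
  "H_DW = {\<eta> \<in> sobolev 1. odd_fun \<eta> \<and>
     set_integrable lebesgue {-pi..pi} (\<lambda>\<theta>. (weak_deriv \<eta> \<theta>)\<^sup>2 / (sin \<theta>)\<^sup>2)}"

definition inner_rho :: "(real \<Rightarrow> real) \<Rightarrow> (real \<Rightarrow> real) \<Rightarrow> real" where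
  "inner_rho \<xi> \<eta> =
     (LINT \<theta>:{-pi..pi}|lebesgue. rho \<theta> * weak_deriv \<xi> \<theta> * weak_deriv \<eta> \<theta>)"

definition norm_DW :: "(real \<Rightarrow> real) \<Rightarrow> real" where
  "norm_DW \<eta> = sqrt (inner_rho \<eta> \<eta>)"

text \<open>
  \<open>Ck_path k X N T u\<close> says that \<open>u\<close>, restricted to \<open>[0, T]\<close>, belongs to \<open>C\<^sup>k([0, T]; X)\<close>, where the
  function space \<open>X\<close> carries the norm \<open>N\<close>; derivatives are one-sided at the end points.
\<close>

definition cont_path ::
  "(real \<Rightarrow> real) set \<Rightarrow> ((real \<Rightarrow> real) \<Rightarrow> real) \<Rightarrow> real \<Rightarrow> (real \<Rightarrow> real \<Rightarrow> real) \<Rightarrow> bool" where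
  "cont_path X N T u \<longleftrightarrow> (\<forall>t \<in> {0..T}. u t \<in> X \<and>
     ((\<lambda>s. N (\<lambda>\<theta>. u s \<theta> - u t \<theta>)) \<longlongrightarrow> 0) (at t within {0..T}))"

definition has_path_deriv ::
  "((real \<Rightarrow> real) \<Rightarrow> real) \<Rightarrow> real \<Rightarrow> (real \<Rightarrow> real \<Rightarrow> real) \<Rightarrow> (real \<Rightarrow> real \<Rightarrow> real) \<Rightarrow> bool" where
  "has_path_deriv N T u u' \<longleftrightarrow> (\<forall>t \<in> {0..T}.
     ((\<lambda>s. N (\<lambda>\<theta>. (u s \<theta> - u t \<theta>) / (s - t) - u' t \<theta>)) \<longlongrightarrow> 0) (at t within {0..T}))"

primrec Ck_path ::
  "nat \<Rightarrow> (real \<Rightarrow> real) set \<Rightarrow> ((real \<Rightarrow> real) \<Rightarrow> real) \<Rightarrow> real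
    \<Rightarrow> (real \<Rightarrow> real \<Rightarrow> real) \<Rightarrow> bool" where
  "Ck_path 0 X N T u \<longleftrightarrow> cont_path X N T u"
| "Ck_path (Suc k) X N T u \<longleftrightarrow>
     cont_path X N T u \<and> (\<exists>u'. has_path_deriv N T u u' \<and> Ck_path k X N T u')"

text \<open>
  A classical solution is \<open>C\<^sup>1\<close> jointly in \<open>(t, \<theta>)\<close> on \<open>[0, \<infinity>) \<times> \<real>\<close> (with one-sided time
  derivative at \<open>t = 0\<close>) and satisfies the equation pointwise. Values of \<open>\<eta>\<close> and \<open>v\<close> at negative
  times play no role.
\<close>

definition classical_odd_solution ::
  "(real \<Rightarrow> real) \<Rightarrow> (real \<Rightarrow> real \<Rightarrow> real) \<Rightarrow> (real \<Rightarrow> real \<Rightarrow> real) \<Rightarrow> bool" where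
  "classical_odd_solution \<eta>0 \<eta> v \<longleftrightarrow>
     \<eta> 0 = \<eta>0 \<and>
     (\<forall>t\<ge>0. torus_periodic (\<eta> t) \<and> odd_fun (\<eta> t) \<and> is_velocity (\<eta> t) (v t)) \<and>
     (\<forall>t\<ge>0. \<forall>\<theta>. \<eta> t field_differentiable at \<theta>) \<and>
     continuous_on ({0..} \<times> UNIV) (\<lambda>(t, \<theta>). \<eta> t \<theta>) \<and>
     continuous_on ({0..} \<times> UNIV) (\<lambda>(t, \<theta>). deriv (\<eta> t) \<theta>) \<and>
     (\<exists>\<eta>t. continuous_on ({0..} \<times> UNIV) (\<lambda>(t, \<theta>). \<eta>t t \<theta>) \<and>
        (\<forall>t\<ge>0. \<forall>\<theta>. ((\<lambda>s. \<eta> s \<theta>) has_real_derivative \<eta>t t \<theta>) (at t within {0..}) \<and>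
                     \<eta>t t \<theta> + L_op (\<eta> t) \<theta> = 0))"

definition solution_regularity :: "nat \<Rightarrow> (real \<Rightarrow> real \<Rightarrow> real) \<Rightarrow> bool" where
  "solution_regularity m \<eta> \<longleftrightarrow> (\<forall>T>0.
     Ck_path 0 H_DW norm_DW T \<eta> \<and>
     Ck_path 0 (sobolev m) (sobolev_norm m) T (\<lambda>t \<theta>. rho_half \<theta> * weak_deriv (\<eta> t) \<theta>) \<and>
     Ck_path 2 (sobolev (m - 2)) (sobolev_norm (m - 2)) T
       (\<lambda>t \<theta>. rho_half \<theta> * weak_deriv (\<eta> t) \<theta>))"

definition J_fun :: "real \<Rightarrow> (real \<Rightarrow> real) \<Rightarrow> real \<Rightarrow> real" where
  "J_fun lam \<eta>0 t =
     (inner_rho \<eta>0 \<eta>0 + 1 / sqrt lam * inner_rho (\<lambda>\<theta>. - L_op \<eta>0 \<theta>) \<eta>0) / 2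
       * exp (2 * sqrt lam * t)
     + (inner_rho \<eta>0 \<eta>0 - 1 / sqrt lam * inner_rho (\<lambda>\<theta>. - L_op \<eta>0 \<theta>) \<eta>0) / 2
       * exp (- 2 * sqrt lam * t)"

end

theory Submission
  imports Defs
begin

text \<open>
  The functions \<open>e_odd k\<close> are orthonormal for the weighted inner product, because
  \<open>\<rho>\<^bsup>1/2\<^esup> \<partial>e_odd k = - sin ((k+1)\<theta>) / \<surd>\<pi>\<close>, and in this basis the operator is tridiagonal in steps of two:
  \<open>L e\<^sub>k = d\<^bsub>k+2\<^esub> e\<^bsub>k+2\<^esub> + D\<^sub>k e\<^sub>k - d\<^sub>k e\<^bsub>k-2\<^esub>\<close> with \<open>D\<^sub>k = d\<^bsub>k+2\<^esub> - d\<^sub>k\<close> and \<open>e\<^bsub>-1\<^esub> = 0\<close>, \<open>d\<^sub>2 = 0\<close>. It is therefore the sum of an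
  antisymmetric part \<open>A\<close> and a diagonal part \<open>D\<close>, whose entries are \<open>-11/18\<close> for \<open>k = 1\<close> and positive
  for \<open>k \<ge> 2\<close>.

  Let \<open>a\<^sub>k(t)\<close> be the coefficients of the solution and \<open>E = \<Sum> (a\<^sub>k)\<^sup>2\<close> its squared norm. The antisymmetric part
  does not contribute to \<open>E' = - 2 \<Sum> D\<^sub>k (a\<^sub>k)\<^sup>2\<close>. Differentiating once more gives \<open>E'' = 4 Q\<close>, where the
  quadratic form \<open>Q = \<Sum> (D\<^sub>k)\<^sup>2 (a\<^sub>k)\<^sup>2 + \<Sum> (D\<^sub>k - D\<^bsub>k-2\<^esub>) d\<^sub>k a\<^bsub>k-2\<^esub> a\<^sub>k\<close> consists of \<open>D\<^sup>2\<close> and the commutator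
  of \<open>D\<close> and \<open>A\<close>. Although \<open>D\<close> is indefinite and \<open>d\<^sub>k\<close> grows linearly, \<open>Q\<close> is bounded and positive definite:
  \<open>D\<^sub>k\<close> tends to \<open>1/2\<close> so fast that the coupling stays below the diagonal (lemma \<open>Q_form_bounds\<close>:
  \<open>E / 20 \<le> Q \<le> 3 E / 4\<close>). The function \<open>J\<close> with parameter \<open>\<lambda>\<close> solves \<open>J'' = 4 \<lambda> J\<close> and has the same value and
  slope as \<open>E\<close> at time 0. The conditions on the data make this slope nonnegative, so
  \<open>E\<close>, being convex, stays positive, and comparing the second-order inequalities gives the two bounds
  (\<open>second_order_comparison\<close>, \<open>energy_between\<close>) with \<open>\<lambda>\<^sub>1 = 1/25\<close> and \<open>\<lambda>\<^sub>2 = 1\<close>.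

  Three facts connect this computation with the function spaces. The trigonometric system is complete
  (\<open>trig_orthogonal_AE_zero\<close>, by Stone--Weierstrass), which makes weak derivatives unique and
  yields the Parseval identity \<open>inner_rho_sums\<close>. The Hilbert transform of a continuously differentiable
  function has a jointly continuous kernel (\<open>hilbert_eq\<close>), hence acts as a Fourier multiplier, and the
  equation becomes the system of ordinary differential equations for the \<open>a\<^sub>k\<close> (\<open>dw_coef_L_op\<close>). Finally, continuity in
  time with values in a Sobolev space of order at least two bounds \<open>(k+1)\<^sup>2 \<bar>a\<^sub>k(t)\<bar>\<close> uniformly on compact time
  intervals (\<open>cont_path_sin_coef_decay\<close>), which justifies differentiating the series.
\<close>

section \<open>Completeness of the trigonometric system\<close>

abbreviation torus_int :: "(real \<Rightarrow> real) \<Rightarrow> real" where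
  "torus_int f \<equiv> (LINT x:{-pi..pi}|lebesgue. f x)"

abbreviation torus_integrable :: "(real \<Rightarrow> real) \<Rightarrow> bool" where
  "torus_integrable f \<equiv> set_integrable lebesgue {-pi..pi} f"

lemmas hk_integral_cmult = Henstock_Kurzweil_Integration.integral_mult_right

lemma torus_integrable_cts:
  "continuous_on {-pi..pi} f \<Longrightarrow> torus_integrable f"
  by (rule absolutely_integrable_continuous_real)

lemma torus_int_eq_integral:
  "torus_integrable f \<Longrightarrow> torus_int f = integral {-pi..pi} f"
  by (rule set_lebesgue_integral_eq_integral)

lemma torus_integrable_bounded_mult:
  fixes h c :: "real \<Rightarrow> real"
  assumes h: "torus_integrable h" and c: "c \<in> borel_measurable lebesgue"
    and B: "\<And>x. \<bar>c x\<bar> \<le> B"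
  shows "torus_integrable (\<lambda>x. h x * c x)"
proof -
  have "integrable lebesgue (\<lambda>x. (indicator {-pi..pi} x *\<^sub>R h x) * c x)"
  proof (rule Bochner_Integration.integrable_bound)
    show "integrable lebesgue (\<lambda>x. B * (indicator {-pi..pi} x *\<^sub>R h x))"
      using h unfolding set_integrable_def by simp
    show "(\<lambda>x. (indicator {-pi..pi} x *\<^sub>R h x) * c x) \<in> borel_measurable lebesgue"
      using h c unfolding set_integrable_def by auto
    have "B \<ge> 0" using B[of 0] by linarith
    then show "AE x in lebesgue. norm ((indicator {-pi..pi} x *\<^sub>R h x) * c x)
        \<le> norm (B * (indicator {-pi..pi} x *\<^sub>R h x))"
      using B by (auto simp: abs_mult mult.commute[of B] intro!: AE_I2 mult_left_mono)
  qed
  then show ?thesis unfolding set_integrable_def by (simp add: mult.assoc)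
qed

lemma borel_imp_lebesgue_measurable:
  fixes f :: "real \<Rightarrow> real"
  shows "f \<in> borel_measurable borel \<Longrightarrow> f \<in> borel_measurable lebesgue"
  by (rule measurable_completion) simp

lemma cts_lebesgue_measurable:
  fixes f :: "real \<Rightarrow> real"
  shows "continuous_on UNIV f \<Longrightarrow> f \<in> borel_measurable lebesgue"
  by (intro borel_imp_lebesgue_measurable borel_measurable_continuous_onI)

text \<open>
  Integer frequencies make this class visibly stable under multiplication by \<open>cos\<close> and \<open>sin\<close>,
  because the product formulas shift the frequency in both directions.
\<close>

definition trig_orthogonal :: "(real \<Rightarrow> real) \<Rightarrow> bool" where
  "trig_orthogonal h \<longleftrightarrow> torus_integrable h \<and>
     (\<forall>n::int. torus_int (\<lambda>\<theta>. h \<theta> * cos (of_int n * \<theta>)) = 0 \<and>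
               torus_int (\<lambda>\<theta>. h \<theta> * sin (of_int n * \<theta>)) = 0)"

lemma torus_integrable_cos: "torus_integrable h \<Longrightarrow> torus_integrable (\<lambda>x. h x * cos (a * x))"
  by (rule torus_integrable_bounded_mult[where B=1])
     (auto intro!: cts_lebesgue_measurable continuous_intros)

lemma torus_integrable_sin: "torus_integrable h \<Longrightarrow> torus_integrable (\<lambda>x. h x * sin (a * x))"
  by (rule torus_integrable_bounded_mult[where B=1])
     (auto intro!: cts_lebesgue_measurable continuous_intros)

lemma trig_orthogonal_lincomb:
  assumes "trig_orthogonal f" "trig_orthogonal g"
  shows "trig_orthogonal (\<lambda>x. a * f x + b * g x)"
  using assms unfolding trig_orthogonal_def
  by (auto simp: distrib_right mult.assoc torus_integrable_cos torus_integrable_sin)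

lemma trig_orthogonal_mult_cos:
  assumes h: "trig_orthogonal h"
  shows "trig_orthogonal (\<lambda>y. h y * cos y)"
proof -
  have i: "torus_integrable h" using h by (simp add: trig_orthogonal_def)
  have c: "h x * cos x * cos (of_int n * x)
      = (h x * cos (of_int (n + 1) * x) + h x * cos (of_int (n - 1) * x)) / 2" for n :: int and x
    by (simp add: algebra_simps cos_add cos_diff)
  have s: "h x * cos x * sin (of_int n * x)
      = (h x * sin (of_int (n + 1) * x) + h x * sin (of_int (n - 1) * x)) / 2" for n :: int and x
    by (simp add: algebra_simps sin_add sin_diff)
  show ?thesis
    using h torus_integrable_cos[OF i, of 1] unfolding trig_orthogonal_def c s
    by (auto simp: torus_integrable_cos[OF i] torus_integrable_sin[OF i] set_integral_add simp del: of_int_add of_int_diff)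
qed

lemma trig_orthogonal_mult_sin:
  assumes h: "trig_orthogonal h"
  shows "trig_orthogonal (\<lambda>y. h y * sin y)"
proof -
  have i: "torus_integrable h" using h by (simp add: trig_orthogonal_def)
  have c: "h x * sin x * cos (of_int n * x)
      = (h x * sin (of_int (n + 1) * x) - h x * sin (of_int (n - 1) * x)) / 2" for n :: int and x
    by (simp add: algebra_simps sin_add sin_diff)
  have s: "h x * sin x * sin (of_int n * x)
      = (h x * cos (of_int (n - 1) * x) - h x * cos (of_int (n + 1) * x)) / 2" for n :: int and x
    by (simp add: algebra_simps cos_add cos_diff)
  show ?thesis
    using h torus_integrable_sin[OF i, of 1] unfolding trig_orthogonal_def c s
    by (auto simp: torus_integrable_cos[OF i] torus_integrable_sin[OF i] set_integral_diff simp del: of_int_add of_int_diff)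
qed

text \<open>
  On the unit circle a linear form is a combination of \<open>cos\<close> and \<open>sin\<close>, and multiplying by a product
  of two polynomials is multiplying twice; quantifying over all \<open>h\<close> makes the product case of the
  induction a composition, so that trigonometric polynomials never have to be written out.
\<close>

lemma trig_orthogonal_mult_polynomial:
  assumes "real_polynomial_function (p :: complex \<Rightarrow> real)" and "trig_orthogonal h"
  shows "trig_orthogonal (\<lambda>x. h x * p (cis x))"
  using assms
proof (induction arbitrary: h rule: real_polynomial_function.induct)
  case (linear f)
  interpret bounded_linear f by fact
  have e: "f (cis x) = cos x * f 1 + sin x * f \<i>" for x
  proof -
    have "cis x = cos x *\<^sub>R 1 + sin x *\<^sub>R \<i>" by (simp add: complex_eq_iff)
    then have "f (cis x) = f (cos x *\<^sub>R 1 + sin x *\<^sub>R \<i>)" by simp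
    then show ?thesis by (simp only: add scaleR real_scaleR_def)
  qed
  show ?case
    using trig_orthogonal_lincomb[OF trig_orthogonal_mult_cos trig_orthogonal_mult_sin,
        OF linear.prems linear.prems, of "f 1" "f \<i>"]
    by (simp add: e algebra_simps)
next
  case (const c)
  then show ?case using trig_orthogonal_lincomb[of h h c 0] by (simp add: mult.commute)
next
  case (add f g)
  then show ?case
    using trig_orthogonal_lincomb[of "\<lambda>x. h x * f (cis x)" "\<lambda>x. h x * g (cis x)" 1 1]
    by (simp add: algebra_simps)
next
  case (mult f g)
  then show ?case
    using mult.IH(2)[OF mult.IH(1)[OF mult.prems]] by (simp add: mult.assoc)
qed

text \<open>
  Stone--Weierstrass on the circle: a continuous function of \<open>cis \<theta>\<close> is a uniform limit of
  polynomials, and the previous lemma kills each of them.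
\<close>

lemma trig_orthogonal_continuous:
  assumes h: "trig_orthogonal h" and y: "continuous_on UNIV (y :: complex \<Rightarrow> real)"
  shows "torus_int (\<lambda>x. h x * y (cis x)) = 0"
proof -
  have i: "torus_integrable h" using h by (simp add: trig_orthogonal_def)
  have cc: "continuous_on UNIV (\<lambda>x. y (cis x))"
    by (intro continuous_on_compose2[OF y] continuous_intros) auto
  have "bounded (y ` sphere 0 1)"
    by (intro compact_imp_bounded compact_continuous_image continuous_on_subset[OF y]) auto
  then obtain B where B: "\<And>x. x \<in> sphere 0 1 \<Longrightarrow> norm (y x) \<le> B"
    unfolding bounded_iff by blast
  have ip: "torus_integrable (\<lambda>x. h x * y (cis x))"
    by (rule torus_integrable_bounded_mult[OF i cts_lebesgue_measurable[OF cc], of B])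
       (use B in auto)
  define M where "M = torus_int (\<lambda>x. \<bar>h x\<bar>)"
  have M0: "M \<ge> 0" unfolding M_def set_lebesgue_integral_def by (rule integral_nonneg_AE) auto
  have "\<bar>torus_int (\<lambda>x. h x * y (cis x))\<bar> \<le> e" if "e > 0" for e
  proof -
    define \<delta> where "\<delta> = e / (M + 1)"
    have \<delta>: "\<delta> > 0" using that M0 by (simp add: \<delta>_def)
    obtain p where p: "real_polynomial_function p" "\<And>x. x \<in> sphere 0 1 \<Longrightarrow> \<bar>y x - p x\<bar> < \<delta>"
      using Stone_Weierstrass_real_polynomial_function[of "sphere (0::complex) 1" y \<delta>]
        continuous_on_subset[OF y] \<delta> by (metis compact_sphere subset_UNIV)
    have o: "trig_orthogonal (\<lambda>x. h x * p (cis x))"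
      by (rule trig_orthogonal_mult_polynomial[OF p(1) h])
    then have ipp: "torus_integrable (\<lambda>x. h x * p (cis x))" by (simp add: trig_orthogonal_def)
    have z: "torus_int (\<lambda>x. h x * p (cis x)) = 0"
    proof -
      have "torus_int (\<lambda>x. h x * p (cis x) * cos (of_int 0 * x)) = 0"
        using o unfolding trig_orthogonal_def by blast
      then show ?thesis by simp
    qed
    have "torus_int (\<lambda>x. h x * y (cis x)) = torus_int (\<lambda>x. h x * y (cis x) - h x * p (cis x))"
      using z by (simp add: set_integral_diff[OF ip ipp])
    also have "\<bar>\<dots>\<bar> \<le> torus_int (\<lambda>x. \<delta> * \<bar>h x\<bar>)"
    proof -
      have "\<bar>torus_int (\<lambda>x. h x * y (cis x) - h x * p (cis x))\<bar>
          \<le> torus_int (\<lambda>x. \<bar>h x * y (cis x) - h x * p (cis x)\<bar>)"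
        using integral_norm_bound[of lebesgue "\<lambda>x. indicator {-pi..pi} x *\<^sub>R (h x * y (cis x) - h x * p (cis x))"]
        unfolding set_lebesgue_integral_def by (simp add: abs_mult)
      also have "\<dots> \<le> torus_int (\<lambda>x. \<delta> * \<bar>h x\<bar>)"
      proof (rule set_integral_mono)
        show "torus_integrable (\<lambda>x. \<bar>h x * y (cis x) - h x * p (cis x)\<bar>)"
          using ip ipp by (intro set_integrable_abs) auto
        show "torus_integrable (\<lambda>x. \<delta> * \<bar>h x\<bar>)"
          using i by (intro set_integrable_mult_right set_integrable_abs)
        fix x
        have "\<bar>h x * y (cis x) - h x * p (cis x)\<bar> = \<bar>h x\<bar> * \<bar>y (cis x) - p (cis x)\<bar>"
          by (simp add: abs_mult[symmetric] algebra_simps)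
        also have "\<dots> \<le> \<bar>h x\<bar> * \<delta>"
          using p(2)[of "cis x"] by (intro mult_left_mono) (auto simp: less_imp_le)
        finally show "\<bar>h x * y (cis x) - h x * p (cis x)\<bar> \<le> \<delta> * \<bar>h x\<bar>" by (simp add: mult.commute)
      qed
      finally show ?thesis .
    qed
    also have "\<dots> = \<delta> * M" by (simp add: M_def)
    also have "\<dots> \<le> e" using M0 that by (simp add: \<delta>_def field_simps)
    finally show ?thesis .
  qed
  then show ?thesis by (metis abs_le_zero_iff dense_ge)
qed

text \<open>
  The indicator of a compact subset \<open>K\<close> of the circle is the limit of the continuous functions
  \<open>max 0 (1 - n * infdist z K)\<close>. The parametrisation \<open>cis\<close> identifies only the end points of
  \<open>[-\<pi>, \<pi>]\<close>, a null set.
\<close>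

lemma trig_orthogonal_closed:
  assumes h: "trig_orthogonal h" and A: "closed A"
  shows "(LINT \<theta>:A \<inter> {-pi..pi}|lebesgue. h \<theta>) = 0"
proof (cases "A \<inter> {-pi..pi} = {}")
  case True then show ?thesis by (simp add: set_lebesgue_integral_def)
next
  case False
  define K where "K = cis ` (A \<inter> {-pi..pi})"
  have K: "compact K" unfolding K_def
    by (intro compact_continuous_image continuous_intros compact_Int_closed closed_Int_compact A) auto
  have Kne: "K \<noteq> {}" using False by (auto simp: K_def)
  have i: "torus_integrable h" using h by (simp add: trig_orthogonal_def)
  define \<psi> where "\<psi> n z = max 0 (1 - real n * infdist z K)" for n z
  have \<psi>c: "continuous_on UNIV (\<psi> n)" for n
    unfolding \<psi>_def by (intro continuous_intros)
  have \<psi>lim: "(\<lambda>n. \<psi> n z) \<longlonglongrightarrow> indicator K z" for z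
  proof (cases "z \<in> K")
    case True then show ?thesis by (simp add: \<psi>_def)
  next
    case False
    then have "infdist z K > 0"
      using K Kne by (meson compact_imp_closed infdist_pos_not_in_closed)
    then obtain N :: nat where N: "1 < real N * infdist z K"
      using reals_Archimedean3 by blast
    have "\<psi> n z = 0" if "n \<ge> N" for n
    proof -
      have "real N * infdist z K \<le> real n * infdist z K"
        using that by (intro mult_right_mono) (auto simp: infdist_nonneg)
      then show ?thesis using N by (simp add: \<psi>_def)
    qed
    then have "eventually (\<lambda>n. \<psi> n z = indicator K z) sequentially"
      using False by (auto simp: eventually_sequentially)
    then show ?thesis by (rule tendsto_eventually)
  qed
  have "(\<lambda>n. torus_int (\<lambda>\<theta>. h \<theta> * \<psi> n (cis \<theta>))) \<longlonglongrightarrow> (LINT \<theta>:A \<inter> {-pi..pi}|lebesgue. h \<theta>)"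
    unfolding set_lebesgue_integral_def
  proof (rule integral_dominated_convergence)
    show "integrable lebesgue (\<lambda>\<theta>. \<bar>indicator {-pi..pi} \<theta> *\<^sub>R h \<theta>\<bar>)"
      using i unfolding set_integrable_def by (rule integrable_abs)
    have m: "set_borel_measurable lebesgue {-pi..pi} h"
      using i unfolding set_integrable_def set_borel_measurable_def by auto
    have "set_borel_measurable lebesgue (A \<inter> {-pi..pi}) h"
      using m A by (intro set_borel_measurable_subset[OF m]) auto
    then show "(\<lambda>x. indicat_real (A \<inter> {- pi..pi}) x *\<^sub>R h x) \<in> borel_measurable lebesgue"
      by (simp add: set_borel_measurable_def)
    have "continuous_on UNIV (\<lambda>x. \<psi> n (cis x))" for n
      by (intro continuous_on_compose2[OF \<psi>c] continuous_intros) auto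
    then have "(\<lambda>x. \<psi> n (cis x)) \<in> borel_measurable lebesgue" for n
      by (rule cts_lebesgue_measurable)
    then have "(\<lambda>x. (indicat_real {- pi..pi} x *\<^sub>R h x) * \<psi> n (cis x)) \<in> borel_measurable lebesgue" for n
      using m unfolding set_borel_measurable_def by (intro borel_measurable_times) auto
    then show "(\<lambda>x. indicat_real {- pi..pi} x *\<^sub>R (h x * \<psi> n (cis x))) \<in> borel_measurable lebesgue" for n
      by (simp add: mult.assoc)
    show "AE x in lebesgue. norm (indicat_real {- pi..pi} x *\<^sub>R (h x * \<psi> n (cis x)))
        \<le> \<bar>indicat_real {- pi..pi} x *\<^sub>R h x\<bar>" for n
    proof (rule AE_I2)
      fix x
      have "0 \<le> \<psi> n (cis x)" "\<psi> n (cis x) \<le> 1" by (auto simp: \<psi>_def infdist_nonneg)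
      then show "norm (indicat_real {- pi..pi} x *\<^sub>R (h x * \<psi> n (cis x)))
        \<le> \<bar>indicat_real {- pi..pi} x *\<^sub>R h x\<bar>"
        using mult_left_mono[of "\<psi> n (cis x)" 1 "\<bar>h x\<bar>"] by (auto simp: abs_mult indicator_def)
    qed
    show "AE x in lebesgue. (\<lambda>n. indicat_real {- pi..pi} x *\<^sub>R (h x * \<psi> n (cis x)))
        \<longlonglongrightarrow> indicat_real (A \<inter> {- pi..pi}) x *\<^sub>R h x"
    proof -
      have "AE x in lebesgue. x \<notin> {-pi, pi}"
        by (intro AE_not_in) (simp add: negligible_iff_null_sets[symmetric])
      then show ?thesis
      proof (rule AE_mp, intro AE_I2 impI)
        fix x :: real assume x: "x \<notin> {-pi, pi}"
        have "indicat_real {-pi..pi} x * indicat_real K (cis x) = indicat_real (A \<inter> {- pi..pi}) x"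
        proof (cases "x \<in> {-pi..pi}")
          case True
          have "cis x \<in> K \<longleftrightarrow> x \<in> A"
          proof
            assume "cis x \<in> K"
            then obtain y where y: "y \<in> A" "y \<in> {-pi..pi}" "cis x = cis y" by (auto simp: K_def)
            then have "Arg (cis x) = x" using x True by (intro Arg_cis) auto
            show "x \<in> A"
            proof (cases "y = -pi")
              case True
              have "cis y = cis pi" unfolding True by (simp add: complex_eq_iff)
              then have "Arg (cis y) = pi" using Arg_cis[of pi] by simp
              then show ?thesis using \<open>Arg (cis x) = x\<close> y x by auto
            next
              case False
              then have "Arg (cis y) = y" using y by (intro Arg_cis) auto
              then show ?thesis using \<open>Arg (cis x) = x\<close> y by auto
            qed
          qed (use True in \<open>auto simp: K_def\<close>)
          then show ?thesis using True by (auto simp: indicator_def)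
        qed auto
        then have "(\<lambda>n. indicat_real {- pi..pi} x *\<^sub>R (h x * \<psi> n (cis x)))
            \<longlonglongrightarrow> indicat_real {-pi..pi} x *\<^sub>R (h x * indicat_real K (cis x))"
          by (intro tendsto_intros \<psi>lim)
        also have "indicat_real {-pi..pi} x *\<^sub>R (h x * indicat_real K (cis x))
            = (indicat_real {-pi..pi} x * indicat_real K (cis x)) * h x" by simp
        also have "\<dots> = indicat_real (A \<inter> {- pi..pi}) x *\<^sub>R h x"
          using \<open>indicat_real {-pi..pi} x * indicat_real K (cis x) = _\<close> by simp
        finally show "(\<lambda>n. indicat_real {- pi..pi} x *\<^sub>R (h x * \<psi> n (cis x)))
            \<longlonglongrightarrow> indicat_real (A \<inter> {- pi..pi}) x *\<^sub>R h x" .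
      qed
    qed
  qed
  then show ?thesis
    using trig_orthogonal_continuous[OF h \<psi>c] by (simp add: LIMSEQ_const_iff)
qed

text \<open>
  Completeness of the trigonometric system in \<open>L\<^sup>1\<close>: the integrals over closed sets determine those
  over \<open>F\<^sub>\<sigma>\<close> sets, hence over all Lebesgue sets, up to a null set.
\<close>

theorem trig_orthogonal_AE_zero:
  assumes h: "trig_orthogonal h"
  shows "AE \<theta> in lebesgue. \<theta> \<in> {-pi..pi} \<longrightarrow> h \<theta> = 0"
proof -
  have i: "torus_integrable h" using h by (simp add: trig_orthogonal_def)
  define g where "g x = indicat_real {-pi..pi} x *\<^sub>R h x" for x
  have ig: "integrable lebesgue g" using i unfolding set_integrable_def g_def .
  have "AE x in lebesgue. g x = 0"
  proof (rule density_unique_real[OF ig integrable_zero])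
    fix A :: "real set" assume A: "A \<in> sets lebesgue"
    obtain C T where CT: "fsigma C" "negligible T" "C \<union> T = A" "disjnt C T"
      using lebesgue_set_almost_fsigma[OF A] unfolding negligible_iff_null_sets by metis
    obtain F :: "nat \<Rightarrow> real set" where F: "range F \<subseteq> Collect compact" "C = \<Union>(range F)"
      using fsigma_Union_compact CT(1) by metis
    define D where "D n = (\<Union>i\<le>n. F i)" for n
    have Dc: "closed (D n)" for n
      unfolding D_def using F(1) by (intro closed_Union) (auto intro: compact_imp_closed)
    have "(\<lambda>n. LINT x:D n|lebesgue. g x) \<longlonglongrightarrow> (LINT x:\<Union>(range D)|lebesgue. g x)"
    proof (rule set_integral_cont_up)
      show "D n \<in> sets lebesgue" for n using Dc by auto
      show "incseq D" unfolding D_def by (intro monoI UN_mono) auto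
      have "\<Union>(range D) \<in> sets lebesgue" using Dc by (intro sets.countable_UN) auto
      then show "set_integrable lebesgue (\<Union>(range D)) g"
        unfolding set_integrable_def using ig by (rule integrable_mult_indicator)
    qed
    moreover have "(LINT x:D n|lebesgue. g x) = 0" for n
    proof -
      have "(LINT x:D n|lebesgue. g x) = (LINT x:D n \<inter> {-pi..pi}|lebesgue. h x)"
        unfolding set_lebesgue_integral_def g_def
        by (intro Bochner_Integration.integral_cong) (auto simp: indicator_def)
      then show ?thesis using trig_orthogonal_closed[OF h Dc] by simp
    qed
    moreover have "\<Union>(range D) = C" unfolding F(2) D_def by auto
    ultimately have "(LINT x:C|lebesgue. g x) = 0" by (simp add: LIMSEQ_const_iff)
    moreover have "(LINT x:A|lebesgue. g x) = (LINT x:C|lebesgue. g x)"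
    proof -
      have "AE x in lebesgue. x \<notin> T"
        by (intro AE_not_in) (use CT(2) in \<open>simp add: negligible_iff_null_sets\<close>)
      then have "AE x in lebesgue. indicat_real A x *\<^sub>R g x = indicat_real C x *\<^sub>R g x"
        by (rule AE_mp) (use CT(3) in \<open>auto intro!: AE_I2 simp: indicator_def\<close>)
      moreover have "C \<in> sets lebesgue"
        using Dc \<open>\<Union>(range D) = C\<close> by (metis borel_closed lborelD rangeE sets.countable_UN sets_completionI_sets subsetI)
      ultimately show ?thesis
        unfolding set_lebesgue_integral_def using ig A
        by (intro integral_cong_AE) (auto intro: borel_measurable_integrable integrable_mult_indicator)
    qed
    ultimately show "(LINT x:A|lebesgue. g x) = (LINT x:A|lebesgue. 0)" by simp
  qed
  then show ?thesis by (rule AE_mp) (auto intro!: AE_I2 simp: g_def)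
qed

section \<open>Weak derivatives on the torus\<close>

lemma sin_cos_nat_periodic:
  "sin (real k * (x + 2 * pi)) = sin (real k * x)" "cos (real k * (x + 2 * pi)) = cos (real k * x)"
proof -
  have "real k * (x + 2 * pi) = real k * x + 2 * pi * of_int (int k)" by (simp add: algebra_simps)
  then show "sin (real k * (x + 2 * pi)) = sin (real k * x)" "cos (real k * (x + 2 * pi)) = cos (real k * x)"
    by (simp_all only: sin_add cos_add cos_int_2pin sin_int_2pin mult_1_right mult_zero_right add_0_right diff_0_right)
qed

lemma torus_test_fun_trig:
  "torus_test_fun (\<lambda>x. A * cos (of_int n * x) + B * sin (of_int n * x))"
proof -
  have d: "deriv (\<lambda>x. A * cos (of_int n * x) + B * sin (of_int n * x))
      = (\<lambda>x. (of_int n * B) * cos (of_int n * x) + (- of_int n * A) * sin (of_int n * x))" for A B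
    by (intro ext DERIV_imp_deriv) (auto intro!: derivative_eq_intros simp: algebra_simps)
  have "(deriv ^^ k) (\<lambda>x. A * cos (of_int n * x) + B * sin (of_int n * x)) field_differentiable at x" for k x
  proof (induction k arbitrary: A B)
    case 0
    show ?case unfolding funpow_0 field_differentiable_def
      by (rule exI) (auto intro!: derivative_eq_intros)
  next
    case (Suc k)
    show ?case unfolding funpow_Suc_right o_def d by (rule Suc)
  qed
  moreover have "torus_periodic (\<lambda>x. A * cos (of_int n * x) + B * sin (of_int n * x))"
  proof -
    have "of_int n * (y + 2 * pi) = of_int n * y + 2 * pi * of_int n" for y :: real
      by (simp add: algebra_simps)
    then show ?thesis unfolding torus_periodic_def
      by (simp add: sin_add cos_add cos_int_2pin sin_int_2pin)
  qed
  ultimately show ?thesis unfolding torus_test_fun_def by blast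
qed

lemma has_weak_deriv_test:
  assumes "has_weak_deriv u g" "torus_test_fun \<phi>"
  shows "torus_int (\<lambda>x. u x * deriv \<phi> x) = - torus_int (\<lambda>x. g x * \<phi> x)"
  using assms unfolding has_weak_deriv_def by blast

lemma weak_deriv_cos_coef:
  assumes "has_weak_deriv u g"
  shows "torus_int (\<lambda>y. g y * cos (of_int n * y)) = of_int n * torus_int (\<lambda>y. u y * sin (of_int n * y))"
proof -
  have d: "deriv (\<lambda>x. cos (of_int n * x)) = (\<lambda>x. - of_int n * sin (of_int n * x))"
    by (intro ext DERIV_imp_deriv) (auto intro!: derivative_eq_intros)
  have t: "torus_test_fun (\<lambda>x. cos (of_int n * x))"
    using torus_test_fun_trig[of 1 n 0] by simp
  have "torus_int (\<lambda>y. - of_int n * (u y * sin (of_int n * y)))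
      = - torus_int (\<lambda>y. g y * cos (of_int n * y))"
    using has_weak_deriv_test[OF assms t] unfolding d by (simp only: mult.left_commute)
  then show ?thesis unfolding set_integral_mult_right by simp
qed

lemma weak_deriv_sin_coef:
  assumes "has_weak_deriv u g"
  shows "torus_int (\<lambda>y. g y * sin (of_int n * y)) = - of_int n * torus_int (\<lambda>y. u y * cos (of_int n * y))"
proof -
  have d: "deriv (\<lambda>x. sin (of_int n * x)) = (\<lambda>x. of_int n * cos (of_int n * x))"
    by (intro ext DERIV_imp_deriv) (auto intro!: derivative_eq_intros)
  have t: "torus_test_fun (\<lambda>x. sin (of_int n * x))"
    using torus_test_fun_trig[of 0 n 1] by simp
  have "torus_int (\<lambda>y. of_int n * (u y * cos (of_int n * y)))
      = - torus_int (\<lambda>y. g y * sin (of_int n * y))"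
    using has_weak_deriv_test[OF assms t] unfolding d by (simp only: mult.left_commute)
  then show ?thesis unfolding set_integral_mult_right by simp
qed

lemma L2_torus_integrable_mult:
  assumes f: "f \<in> L2_torus" and g: "g \<in> L2_torus"
  shows "torus_integrable (\<lambda>y. f y * g y)"
proof -
  have m: "f \<in> borel_measurable lebesgue" "g \<in> borel_measurable lebesgue"
    using f g by (auto simp: L2_torus_def)
  show ?thesis
  proof (rule set_integrable_bound)
    show "torus_integrable (\<lambda>y. (f y)^2 + (g y)^2)" using f g by (auto simp: L2_torus_def)
    show "set_borel_measurable lebesgue {-pi..pi} (\<lambda>y. f y * g y)"
      unfolding set_borel_measurable_def real_scaleR_def
      by (intro borel_measurable_times borel_measurable_indicator m) simp
    have "\<bar>f x * g x\<bar> \<le> (f x)^2 + (g x)^2" for x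
    proof -
      have "2 * (\<bar>f x\<bar> * \<bar>g x\<bar>) \<le> \<bar>f x\<bar>^2 + \<bar>g x\<bar>^2" using sum_squares_bound[of "\<bar>f x\<bar>" "\<bar>g x\<bar>"] by simp
      moreover have "0 \<le> \<bar>f x\<bar> * \<bar>g x\<bar>" by simp
      ultimately show ?thesis unfolding abs_mult power2_abs by linarith
    qed
    then show "AE x in lebesgue. x \<in> {-pi..pi} \<longrightarrow> norm (f x * g x) \<le> norm ((f x)^2 + (g x)^2)"
      by (intro AE_I2) simp
  qed
qed

lemma L2_torus_one: "(\<lambda>_. c) \<in> L2_torus"
  by (auto simp: L2_torus_def torus_periodic_def intro!: torus_integrable_cts continuous_intros)

lemma L2_torus_integrable: "f \<in> L2_torus \<Longrightarrow> torus_integrable f"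
  using L2_torus_integrable_mult[of f "\<lambda>_. 1"] L2_torus_one by simp

lemma L2_torus_diff:
  assumes "f \<in> L2_torus" "g \<in> L2_torus"
  shows "(\<lambda>x. f x - g x) \<in> L2_torus"
proof -
  have "torus_integrable (\<lambda>x. (f x)^2 - 2 * (f x * g x) + (g x)^2)"
    using assms L2_torus_integrable_mult[OF assms] by (auto simp: L2_torus_def)
  then have "torus_integrable (\<lambda>x. (f x - g x)^2)"
    by (simp add: power2_diff algebra_simps)
  then show ?thesis using assms by (auto simp: L2_torus_def torus_periodic_def)
qed

text \<open>
  From \<open>\<bar>f\<bar> \<le> (1 + f\<^sup>2) / 2\<close>; it serves to bound coefficients locally in time.
\<close>

lemma torus_int_bounded_le:
  assumes f: "f \<in> L2_torus" and c: "continuous_on UNIV c" and b: "\<And>x. \<bar>c x\<bar> \<le> 1"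
  shows "\<bar>torus_int (\<lambda>x. f x * c x)\<bar> \<le> pi + (L2_norm_torus f)^2 / 2"
proof -
  have i: "torus_integrable (\<lambda>x. f x * c x)"
    by (rule torus_integrable_bounded_mult[OF L2_torus_integrable[OF f] cts_lebesgue_measurable[OF c] b])
  have s: "torus_integrable (\<lambda>x. (f x)^2)" using f by (simp add: L2_torus_def)
  have one: "torus_integrable (\<lambda>x. 1::real)" by (intro torus_integrable_cts continuous_intros)
  have "\<bar>torus_int (\<lambda>x. f x * c x)\<bar> \<le> torus_int (\<lambda>x. \<bar>f x * c x\<bar>)"
    using integral_norm_bound[of lebesgue "\<lambda>x. indicator {-pi..pi} x *\<^sub>R (f x * c x)"]
    unfolding set_lebesgue_integral_def by (simp add: abs_mult)
  also have "\<dots> \<le> torus_int (\<lambda>x. 1 / 2 + (f x)^2 / 2)"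
  proof (rule set_integral_mono)
    show "torus_integrable (\<lambda>x. \<bar>f x * c x\<bar>)" by (rule set_integrable_abs[OF i])
    show "torus_integrable (\<lambda>x. 1 / 2 + (f x)^2 / 2)"
      using s torus_integrable_cts[of "\<lambda>_. 1/2"] by (intro set_integral_add) auto
    fix x
    have "\<bar>f x * c x\<bar> \<le> \<bar>f x\<bar>" using b[of x] mult_left_mono[OF b[of x], of "\<bar>f x\<bar>"] by (simp add: abs_mult)
    also have "\<bar>f x\<bar> \<le> 1 / 2 + (f x)^2 / 2"
      using sum_squares_bound[of "\<bar>f x\<bar>" 1] by simp
    finally show "\<bar>f x * c x\<bar> \<le> 1 / 2 + (f x)^2 / 2" .
  qed
  also have "\<dots> = torus_int (\<lambda>x. 1 / 2) + torus_int (\<lambda>x. (f x)^2 / 2)"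
    using s torus_integrable_cts[of "\<lambda>_. 1/2"] by (intro set_integral_add) auto
  also have "torus_int (\<lambda>x. 1 / 2 :: real) = pi"
    by (subst torus_int_eq_integral) (auto intro!: torus_integrable_cts continuous_intros)
  also have "torus_int (\<lambda>x. (f x)^2 / 2) = (L2_norm_torus f)^2 / 2"
  proof -
    have "torus_int (\<lambda>x. (f x)^2) \<ge> 0" unfolding set_lebesgue_integral_def by (rule integral_nonneg_AE) auto
    then show ?thesis by (simp add: L2_norm_torus_def)
  qed
  finally show ?thesis .
qed

lemma torus_periodic_deriv:
  assumes p: "torus_periodic f" and d: "\<And>x. (f has_real_derivative f' x) (at x)"
  shows "torus_periodic f'"
  unfolding torus_periodic_def
proof
  fix y
  have "((\<lambda>x. f (x + 2 * pi)) has_real_derivative f' (y + 2 * pi)) (at y)"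
    using d[of "y + 2 * pi"] by (simp add: DERIV_shift)
  then have "(f has_real_derivative f' (y + 2 * pi)) (at y)"
    using p unfolding torus_periodic_def by simp
  then show "f' (y + 2 * pi) = f' y" using d by (rule DERIV_unique)
qed

lemma torus_test_fun_DERIV:
  assumes "torus_test_fun \<phi>" shows "(\<phi> has_real_derivative deriv \<phi> x) (at x)"
proof -
  have "(deriv ^^ 0) \<phi> field_differentiable at x"
    using assms unfolding torus_test_fun_def by blast
  then show ?thesis by (simp add: DERIV_deriv_iff_field_differentiable)
qed

lemma torus_test_fun_deriv:
  assumes t: "torus_test_fun \<phi>" shows "torus_test_fun (deriv \<phi>)"
  unfolding torus_test_fun_def
proof (intro conjI allI)
  show "torus_periodic (deriv \<phi>)"
    using t by (intro torus_periodic_deriv[OF _ torus_test_fun_DERIV]) (auto simp: torus_test_fun_def)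
  fix n x
  have "(deriv ^^ Suc n) \<phi> field_differentiable at x"
    using t unfolding torus_test_fun_def by blast
  then show "(deriv ^^ n) (deriv \<phi>) field_differentiable at x"
    by (simp only: funpow_Suc_right o_def)
qed

lemma torus_test_fun_cts: "torus_test_fun \<phi> \<Longrightarrow> continuous_on S \<phi>"
  by (intro continuous_at_imp_continuous_on ballI DERIV_isCont[OF torus_test_fun_DERIV])

lemma L2_torus_continuous: "torus_periodic f \<Longrightarrow> continuous_on UNIV f \<Longrightarrow> f \<in> L2_torus"
  by (auto simp: L2_torus_def intro!: cts_lebesgue_measurable
        torus_integrable_cts continuous_intros intro: continuous_on_subset)

lemma test_fun_integrable_mult:
  assumes "torus_test_fun \<phi>" "f \<in> L2_torus"
  shows "torus_integrable (\<lambda>x. f x * \<phi> x)"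
proof (rule L2_torus_integrable_mult[OF assms(2)])
  show "\<phi> \<in> L2_torus"
    using assms(1) torus_test_fun_cts by (intro L2_torus_continuous) (auto simp: torus_test_fun_def)
qed

lemma has_weak_deriv_diff:
  assumes u: "has_weak_deriv u g" and v: "has_weak_deriv v h"
  shows "has_weak_deriv (\<lambda>x. u x - v x) (\<lambda>x. g x - h x)"
  unfolding has_weak_deriv_def
proof (intro conjI allI impI)
  show "(\<lambda>x. u x - v x) \<in> L2_torus" "(\<lambda>x. g x - h x) \<in> L2_torus"
    using assms by (auto simp: has_weak_deriv_def intro: L2_torus_diff)
  fix \<phi> assume t: "torus_test_fun \<phi>"
  note t' = torus_test_fun_deriv[OF t]
  have L: "u \<in> L2_torus" "v \<in> L2_torus" "g \<in> L2_torus" "h \<in> L2_torus"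
    using assms by (auto simp: has_weak_deriv_def)
  have "torus_int (\<lambda>x. u x * deriv \<phi> x) = - torus_int (\<lambda>x. g x * \<phi> x)"
    "torus_int (\<lambda>x. v x * deriv \<phi> x) = - torus_int (\<lambda>x. h x * \<phi> x)"
    using u v t by (auto simp: has_weak_deriv_def)
  then show "torus_int (\<lambda>x. (u x - v x) * deriv \<phi> x) = - torus_int (\<lambda>x. (g x - h x) * \<phi> x)"
    unfolding left_diff_distrib using t t' L
    by (simp add: set_integral_diff(2)[OF test_fun_integrable_mult test_fun_integrable_mult])
qed

lemma sobolev_subset_L2: "u \<in> sobolev m \<Longrightarrow> u \<in> L2_torus"
  by (cases m) auto

lemma sobolev_diff: "u \<in> sobolev m \<Longrightarrow> v \<in> sobolev m \<Longrightarrow> (\<lambda>x. u x - v x) \<in> sobolev m"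
proof (induction m arbitrary: u v)
  case 0 then show ?case by (simp add: L2_torus_diff)
next
  case (Suc m)
  then obtain g h where "g \<in> sobolev m" "has_weak_deriv u g" "h \<in> sobolev m" "has_weak_deriv v h"
    by auto
  then have "(\<lambda>x. g x - h x) \<in> sobolev m" "has_weak_deriv (\<lambda>x. u x - v x) (\<lambda>x. g x - h x)"
    using Suc.IH has_weak_deriv_diff by blast+
  moreover have "(\<lambda>x. u x - v x) \<in> L2_torus" using Suc.prems by (intro L2_torus_diff) auto
  ultimately show ?case by auto
qed

lemma has_weak_deriv_weak_deriv: "has_weak_deriv u g \<Longrightarrow> has_weak_deriv u (weak_deriv u)"
  unfolding weak_deriv_def by (rule someI[where P="has_weak_deriv u"])

text \<open>
  The weak derivative chosen by \<^const>\<open>weak_deriv\<close> need not be the one whose own derivative is known;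
  all weak derivatives of \<open>u\<close> have the same integrals against derivatives of test functions, so they
  share their weak derivatives.
\<close>

lemma has_weak_deriv_trans:
  assumes "has_weak_deriv u g" "has_weak_deriv u h" "has_weak_deriv g k"
  shows "has_weak_deriv h k"
  unfolding has_weak_deriv_def
proof (intro conjI allI impI)
  show "h \<in> L2_torus" "k \<in> L2_torus" using assms by (auto simp: has_weak_deriv_def)
  fix \<phi> assume t: "torus_test_fun \<phi>"
  show "torus_int (\<lambda>x. h x * deriv \<phi> x) = - torus_int (\<lambda>x. k x * \<phi> x)"
    using has_weak_deriv_test[OF assms(3) t] has_weak_deriv_test[OF assms(1) torus_test_fun_deriv[OF t]]
      has_weak_deriv_test[OF assms(2) torus_test_fun_deriv[OF t]] by linarith
qed

lemma integral_by_parts_periodic: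
  fixes u \<phi> :: "real \<Rightarrow> real"
  assumes "torus_periodic u" "torus_periodic \<phi>"
    and u: "\<And>x. (u has_real_derivative u' x) (at x)" and \<phi>: "\<And>x. (\<phi> has_real_derivative \<phi>' x) (at x)"
    and c: "continuous_on UNIV u'" "continuous_on UNIV \<phi>'"
  shows "torus_int (\<lambda>y. u y * \<phi>' y) = - torus_int (\<lambda>y. u' y * \<phi> y)"
proof -
  have cu: "continuous_on {-pi..pi} u" "continuous_on {-pi..pi} \<phi>"
    using u \<phi> by (meson DERIV_isCont continuous_at_imp_continuous_on)+
  have cu': "continuous_on {-pi..pi} u'" "continuous_on {-pi..pi} \<phi>'"
    using c by (auto intro: continuous_on_subset)
  note ii = torus_integrable_cts[OF continuous_on_mult]
  have "((\<lambda>x. u x * \<phi>' x + u' x * \<phi> x) has_integral u pi * \<phi> pi - u (-pi) * \<phi> (-pi)) {-pi..pi}"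
    by (rule fundamental_theorem_of_calculus)
       (auto intro!: derivative_eq_intros DERIV_subset[OF u] DERIV_subset[OF \<phi>]
         simp: has_real_derivative_iff_has_vector_derivative[symmetric])
  moreover have "u pi = u (-pi)" "\<phi> pi = \<phi> (-pi)"
    using assms(1,2)[unfolded torus_periodic_def, rule_format, of "-pi"] by auto
  ultimately have "integral {-pi..pi} (\<lambda>x. u x * \<phi>' x + u' x * \<phi> x) = 0"
    by (simp add: integral_unique)
  then have "torus_int (\<lambda>x. u x * \<phi>' x + u' x * \<phi> x) = 0"
    by (subst torus_int_eq_integral) (auto intro!: torus_integrable_cts continuous_intros cu cu')
  then show ?thesis
    by (subst (asm) set_integral_add) (auto intro!: ii cu cu')
qed

lemma has_weak_deriv_C1:
  assumes "torus_periodic u" "\<And>x. (u has_real_derivative u' x) (at x)" "continuous_on UNIV u'"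
  shows "has_weak_deriv u u'"
  unfolding has_weak_deriv_def
proof (intro conjI allI impI)
  show "u \<in> L2_torus"
    using assms by (intro L2_torus_continuous) (meson DERIV_isCont continuous_at_imp_continuous_on)+
  show "u' \<in> L2_torus"
    by (rule L2_torus_continuous[OF torus_periodic_deriv[OF assms(1,2)] assms(3)])
  fix \<phi> assume t: "torus_test_fun \<phi>"
  note d = torus_test_fun_DERIV[OF t]
  show "torus_int (\<lambda>y. u y * deriv \<phi> y) = - torus_int (\<lambda>y. u' y * \<phi> y)"
  proof (rule integral_by_parts_periodic[OF assms(1) _ assms(2) d assms(3)])
    show "torus_periodic \<phi>" using t by (simp add: torus_test_fun_def)
    show "continuous_on UNIV (deriv \<phi>)" by (intro torus_test_fun_cts torus_test_fun_deriv t)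
  qed
qed

text \<open>
  Testing with trigonometric functions shows that the difference is orthogonal to all of them. In
  particular \<^const>\<open>weak_deriv\<close> agrees almost everywhere with the classical derivative.
\<close>

lemma has_weak_deriv_unique:
  assumes g: "has_weak_deriv u g" and h: "has_weak_deriv u h"
  shows "AE x in lebesgue. x \<in> {-pi..pi} \<longrightarrow> g x = h x"
proof -
  have i: "torus_integrable g" "torus_integrable h"
    using g h by (auto simp: has_weak_deriv_def intro: L2_torus_integrable)
  note c = torus_integrable_cos and s = torus_integrable_sin
  have "trig_orthogonal (\<lambda>x. g x - h x)"
    unfolding trig_orthogonal_def left_diff_distrib
  proof (intro conjI allI)
    show "torus_integrable (\<lambda>x. g x - h x)" by (rule set_integral_diff(1)[OF i])
    fix n
    show "torus_int (\<lambda>x. g x * cos (of_int n * x) - h x * cos (of_int n * x)) = 0"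
      unfolding set_integral_diff(2)[OF c[OF i(1)] c[OF i(2)]] weak_deriv_cos_coef[OF g] weak_deriv_cos_coef[OF h] by simp
    show "torus_int (\<lambda>x. g x * sin (of_int n * x) - h x * sin (of_int n * x)) = 0"
      unfolding set_integral_diff(2)[OF s[OF i(1)] s[OF i(2)]] weak_deriv_sin_coef[OF g] weak_deriv_sin_coef[OF h] by simp
  qed
  from trig_orthogonal_AE_zero[OF this] show ?thesis by simp
qed

section \<open>Coefficients in the weighted orthonormal basis\<close>

definition sin_coef :: "(real \<Rightarrow> real) \<Rightarrow> nat \<Rightarrow> real" where
  "sin_coef f j = torus_int (\<lambda>\<theta>. f \<theta> * sin (real j * \<theta>))"

text \<open>
  The coefficient of \<^term>\<open>e_odd k\<close> in the expansion of an odd function. Since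
  \<open>e_odd k = sin (k+2)\<theta> / (k+2) - sin k\<theta> / k\<close>, an expansion \<open>f = \<Sum> a\<^sub>k e_odd k\<close> has the sine coefficients
  \<open>sin_coef f j = \<pi> (a\<^bsub>j-2\<^esub> - a\<^sub>j) / j\<close>, which is solved here for \<open>a\<^sub>j\<close>, starting from
  \<open>a\<^bsub>-1\<^esub> = a\<^sub>0 = 0\<close>. The value \<open>0\<close> at index \<open>0\<close> also serves as \<open>a\<^bsub>-1\<^esub>\<close>, because \<open>1 - 2 = 0\<close> in \<^typ>\<open>nat\<close>.
\<close>

fun dw_coef :: "(real \<Rightarrow> real) \<Rightarrow> nat \<Rightarrow> real" where
  "dw_coef f 0 = 0"
| "dw_coef f (Suc 0) = - sin_coef f 1 / pi"
| "dw_coef f (Suc (Suc k)) = dw_coef f k - real (k + 2) * sin_coef f (k + 2) / pi"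

text \<open>
  The Chebyshev polynomial of the second kind at \<open>cos \<theta>\<close>, that is \<open>sin ((k+1)\<theta>) / sin \<theta>\<close> without its
  removable singularities. It is what remains of \<open>\<rho> \<partial>e_odd k\<close> after cancelling the weight.
\<close>

fun cheb_U :: "nat \<Rightarrow> real \<Rightarrow> real" where
  "cheb_U 0 \<theta> = 1"
| "cheb_U (Suc 0) \<theta> = 2 * cos \<theta>"
| "cheb_U (Suc (Suc k)) \<theta> = cheb_U k \<theta> + 2 * cos (real (k + 2) * \<theta>)"

lemma cheb_U_mult_sin: "cheb_U k x * sin x = sin (real (k + 1) * x)"
proof (induction k x rule: cheb_U.induct)
  case (3 k x)
  have "sin (real (k + 1) * x) = sin (real (k + 2) * x - x)"
    and e: "sin (real (Suc (Suc k) + 1) * x) = sin (real (k + 2) * x + x)"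
    by (simp_all add: algebra_simps)
  with 3 have "cheb_U k x * sin x = sin (real (k + 2) * x - x)" by simp
  then show ?case unfolding e cheb_U.simps distrib_right sin_add sin_diff by simp
qed (simp_all add: sin_double)

text \<open>
  The link between the weighted inner product and the coefficients: as a cosine polynomial,
  \<^const>\<open>cheb_U\<close> may be integrated by parts against a weak derivative.
\<close>

lemma weak_deriv_cheb_U:
  assumes g: "has_weak_deriv u g"
  shows "torus_integrable (\<lambda>x. g x * cheb_U k x)"
    and "torus_int (\<lambda>x. g x * cheb_U k x) = - 2 * pi * dw_coef u k"
proof -
  have i: "torus_integrable g" using g by (auto simp: has_weak_deriv_def intro: L2_torus_integrable)
  have c: "torus_int (\<lambda>x. g x * cos (real n * x)) = real n * sin_coef u n" for n
    using weak_deriv_cos_coef[OF g, of "int n"] by (simp add: sin_coef_def)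
  note ic = torus_integrable_cos[OF i]
  have "torus_integrable (\<lambda>x. g x * cheb_U k x)
    \<and> torus_int (\<lambda>x. g x * cheb_U k x) = - 2 * pi * dw_coef u k"
  proof (induction k rule: dw_coef.induct[of "\<lambda>_ k. torus_integrable (\<lambda>x. g x * cheb_U k x)
    \<and> torus_int (\<lambda>x. g x * cheb_U k x) = - 2 * pi * dw_coef u k" u])
    case 1 show ?case using c[of 0] i by simp
  next
    case 2
    have "torus_int (\<lambda>x. 2 * (g x * cos x)) = 2 * sin_coef u 1"
      using c[of 1] by simp
    moreover have "g x * cheb_U (Suc 0) x = 2 * (g x * cos x)" for x by simp
    moreover have "torus_integrable (\<lambda>x. 2 * (g x * cos x))"
      using ic[of 1] by (intro set_integrable_mult_right) simp
    ultimately show ?case by (simp only: dw_coef.simps) simp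
  next
    case (3 _ k)
    have e: "g x * cheb_U (Suc (Suc k)) x
        = g x * cheb_U k x + 2 * (g x * cos (real (k + 2) * x))" for x
      by (simp add: algebra_simps)
    have IH: "torus_integrable (\<lambda>x. g x * cheb_U k x)"
      "torus_int (\<lambda>x. g x * cheb_U k x) = - 2 * pi * dw_coef u k" using 3 by auto
    have i2: "torus_integrable (\<lambda>x. 2 * (g x * cos (real (k + 2) * x)))"
      using ic by (rule set_integrable_mult_right)
    show ?case unfolding e
    proof
      show "torus_integrable (\<lambda>x. g x * cheb_U k x + 2 * (g x * cos (real (k + 2) * x)))"
        by (rule set_integral_add(1)[OF IH(1) i2])
      show "torus_int (\<lambda>x. g x * cheb_U k x + 2 * (g x * cos (real (k + 2) * x)))
          = - 2 * pi * dw_coef u (Suc (Suc k))"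
        unfolding set_integral_add(2)[OF IH(1) i2] set_integral_mult_right c IH(2) by (simp add: field_simps)
    qed
  qed
  then show "torus_integrable (\<lambda>x. g x * cheb_U k x)"
    "torus_int (\<lambda>x. g x * cheb_U k x) = - 2 * pi * dw_coef u k" by auto
qed

lemma AE_sin_nonzero: "AE x in lebesgue. sin x \<noteq> (0::real)"
proof -
  have "countable (range (\<lambda>n::int. of_int n * pi))" by simp
  then have "range (\<lambda>n::int. of_int n * pi) \<in> null_sets lebesgue"
    using countable_imp_null_set_lborel null_sets_completionI by blast
  then have "AE x in lebesgue. x \<notin> range (\<lambda>n::int. of_int n * pi)" by (rule AE_not_in)
  then show ?thesis by (rule AE_mp) (auto intro!: AE_I2 simp: sin_zero_iff_int2)
qed

lemma torus_int_cong_AE: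
  assumes "AE x in lebesgue. x \<in> {-pi..pi} \<longrightarrow> f x = g x"
    "f \<in> borel_measurable lebesgue" "g \<in> borel_measurable lebesgue"
  shows "torus_int f = torus_int g" "torus_integrable f = torus_integrable g"
proof -
  show "torus_int f = torus_int g"
    using assms by (intro set_lebesgue_integral_cong_AE) auto
  show "torus_integrable f = torus_integrable g"
    using assms by (intro set_integrable_cong_AE) auto
qed

section \<open>Parseval identity for the weighted norm\<close>

lemma torus_int_cos: "torus_int (\<lambda>x. cos (of_int n * x)) = (if n = 0 then 2 * pi else 0)"
proof (cases "n = 0")
  case True
  have "torus_int (\<lambda>x. 1 :: real) = 2 * pi"
    by (subst torus_int_eq_integral) (auto intro!: torus_integrable_cts)
  with True show ?thesis by simp
next
  case False
  have "((\<lambda>x. cos (of_int n * x)) has_integral sin (of_int n * pi) / of_int n - sin (of_int n * (-pi)) / of_int n) {-pi..pi}"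
    by (rule fundamental_theorem_of_calculus)
       (use False in \<open>auto intro!: derivative_eq_intros simp: has_real_derivative_iff_has_vector_derivative[symmetric]\<close>)
  then have "integral {-pi..pi} (\<lambda>x. cos (of_int n * x)) = 0"
    by (simp add: integral_unique sin_int_times_real mult.commute)
  with False show ?thesis
    by (subst torus_int_eq_integral) (auto intro!: torus_integrable_cts continuous_intros)
qed

lemma torus_int_sin: "torus_int (\<lambda>x. sin (of_int n * x)) = 0"
proof (cases "n = 0")
  case False
  have "((\<lambda>x. sin (of_int n * x)) has_integral (- cos (of_int n * pi) / of_int n) - (- cos (of_int n * (-pi)) / of_int n)) {-pi..pi}"
    by (rule fundamental_theorem_of_calculus)
       (use False in \<open>auto intro!: derivative_eq_intros simp: has_real_derivative_iff_has_vector_derivative[symmetric]\<close>)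
  then have "integral {-pi..pi} (\<lambda>x. sin (of_int n * x)) = 0"
    by (simp add: integral_unique)
  then show ?thesis
    by (subst torus_int_eq_integral) (auto intro!: torus_integrable_cts continuous_intros)
qed simp

lemma torus_int_sin_cos: "torus_int (\<lambda>x. sin (of_int m * x) * cos (of_int n * x)) = 0"
proof -
  have e: "sin (of_int m * x) * cos (of_int n * x) = (sin (of_int (m + n) * x) + sin (of_int (m - n) * x)) / 2" for x :: real
    by (simp add: distrib_right left_diff_distrib sin_add sin_diff)
  have "torus_integrable (\<lambda>x. sin (of_int k * x))" for k
    by (auto intro!: torus_integrable_cts continuous_intros)
  then show ?thesis unfolding e
    by (simp add: set_integral_add(2) torus_int_sin del: of_int_add of_int_diff)
qed

lemma torus_int_sin_sin:
  "torus_int (\<lambda>x. sin (of_int m * x) * sin (of_int n * x)) =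
     (if m = n then pi else 0) - (if m = - n then pi else 0)"
proof -
  have e: "sin (of_int m * x) * sin (of_int n * x) = (cos (of_int (m - n) * x) - cos (of_int (m + n) * x)) / 2" for x :: real
    by (simp add: distrib_right left_diff_distrib cos_add cos_diff)
  have "torus_integrable (\<lambda>x. cos (of_int k * x))" for k
    by (auto intro!: torus_integrable_cts continuous_intros)
  then have "torus_int (\<lambda>x. sin (of_int m * x) * sin (of_int n * x))
      = (torus_int (\<lambda>x. cos (of_int (m - n) * x)) - torus_int (\<lambda>x. cos (of_int (m + n) * x))) / 2"
    unfolding e by (simp add: set_integral_diff(2) del: of_int_add of_int_diff)
  then show ?thesis unfolding torus_int_cos by auto
qed

lemma torus_int_series:
  assumes h: "torus_integrable h" and M: "summable M" "\<And>k. \<bar>c k\<bar> \<le> M k"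
    and f: "\<And>k. continuous_on UNIV (f k)" "\<And>k x. \<bar>f k x\<bar> \<le> 1"
  shows "(\<lambda>k. c k * torus_int (\<lambda>x. h x * f k x)) sums torus_int (\<lambda>x. h x * (\<Sum>k. c k * f k x))"
proof -
  define F where "F k x = c k * (indicat_real {-pi..pi} x *\<^sub>R (h x * f k x))" for k x
  have i: "torus_integrable (\<lambda>x. h x * f k x)" for k
    by (rule torus_integrable_bounded_mult[OF h cts_lebesgue_measurable[OF f(1)] f(2)])
  have iF: "integrable lebesgue (F k)" for k
    unfolding F_def using i[of k] unfolding set_integrable_def by simp
  have ih: "integrable lebesgue (\<lambda>x. \<bar>indicat_real {-pi..pi} x *\<^sub>R h x\<bar>)"
    using h unfolding set_integrable_def by (rule integrable_abs)
  have b: "norm (F k x) \<le> M k * \<bar>indicat_real {-pi..pi} x *\<^sub>R h x\<bar>" for k x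
  proof -
    have "\<bar>c k\<bar> * (\<bar>indicat_real {-pi..pi} x *\<^sub>R h x\<bar> * \<bar>f k x\<bar>) \<le> M k * (\<bar>indicat_real {-pi..pi} x *\<^sub>R h x\<bar> * 1)"
      using M(2)[of k] f(2)[of k x] by (intro mult_mono) auto
    then show ?thesis by (simp add: F_def abs_mult mult.assoc)
  qed
  have sF: "summable (\<lambda>k. norm (F k x))" for x
    by (rule summable_comparison_test'[OF summable_mult2[OF M(1)]]) (use b in auto)
  have s2: "summable (\<lambda>k. \<integral>x. norm (F k x) \<partial>lebesgue)"
  proof (rule summable_comparison_test'[OF summable_mult2[OF M(1)], of 0])
    fix k
    have "(\<integral>x. norm (F k x) \<partial>lebesgue) \<le> (\<integral>x. M k * \<bar>indicat_real {-pi..pi} x *\<^sub>R h x\<bar> \<partial>lebesgue)"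
      by (intro integral_mono integrable_norm iF integrable_mult_right ih b)
    then show "norm (\<integral>x. norm (F k x) \<partial>lebesgue) \<le> M k * (\<integral>x. \<bar>indicat_real {-pi..pi} x *\<^sub>R h x\<bar> \<partial>lebesgue)"
      by (simp add: integral_nonneg_AE)
  qed
  have "(\<lambda>k. integral\<^sup>L lebesgue (F k)) sums (\<integral>x. (\<Sum>k. F k x) \<partial>lebesgue)"
    by (rule sums_integral[OF iF _ s2]) (use sF in auto)
  moreover have "integral\<^sup>L lebesgue (F k) = c k * torus_int (\<lambda>x. h x * f k x)" for k
    unfolding F_def set_lebesgue_integral_def by simp
  moreover have "(\<Sum>k. F k x) = indicat_real {-pi..pi} x *\<^sub>R (h x * (\<Sum>k. c k * f k x))" for x
  proof -
    have "summable (\<lambda>k. c k * f k x)"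
    proof (rule summable_comparison_test'[OF M(1), of 0])
      fix k show "norm (c k * f k x) \<le> M k"
        using mult_mono[OF M(2)[of k] f(2)[of k x]] M(2)[of k] by (simp add: abs_mult)
    qed
    then have "(\<Sum>k. (indicat_real {-pi..pi} x * h x) * (c k * f k x)) = (indicat_real {-pi..pi} x * h x) * (\<Sum>k. c k * f k x)"
      by (rule suminf_mult)
    then show ?thesis by (simp add: F_def mult_ac)
  qed
  ultimately show ?thesis unfolding set_lebesgue_integral_def by simp
qed

text \<open>
  The summable bound makes the sine series of \<open>w\<close> converge uniformly to a continuous function \<open>W\<close>. By
  completeness \<open>w = W\<close> almost everywhere, and the series may be integrated against \<open>w\<close> term by term.
\<close>

lemma sine_series_parseval:
  fixes w :: "real \<Rightarrow> real"
  defines "s \<equiv> \<lambda>k. torus_int (\<lambda>x. w x * sin (real (Suc k) * x))"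
  assumes w: "torus_integrable w" "w \<in> borel_measurable lebesgue"
    and cz: "\<And>n::int. torus_int (\<lambda>x. w x * cos (of_int n * x)) = 0"
    and M: "summable M" "\<And>k. \<bar>s k\<bar> \<le> M k"
  shows "(\<lambda>k. (s k)^2 / pi) sums torus_int (\<lambda>x. (w x)^2)"
proof -
  define f where "f k x = sin (real (Suc k) * x)" for k x
  have f: "continuous_on UNIV (f k)" "\<bar>f k x\<bar> \<le> 1" for k x
    unfolding f_def by (auto intro!: continuous_intros simp del: of_nat_Suc)
  have fi: "f k x = sin (of_int (int (Suc k)) * x)" for k x by (simp add: f_def)
  define c where "c k = s k / pi" for k
  have M': "summable (\<lambda>k. M k / pi)" "\<bar>c k\<bar> \<le> M k / pi" for k
    using M by (auto simp: c_def divide_right_mono intro: summable_divide)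
  define W where "W x = (\<Sum>k. c k * f k x)" for x
  have Wc: "continuous_on UNIV W"
  proof -
    have "uniform_limit UNIV (\<lambda>n x. \<Sum>k<n. c k * f k x) W sequentially"
      unfolding W_def
    proof (rule Weierstrass_m_test[OF _ M'(1)])
      fix k x show "norm (c k * f k x) \<le> M k / pi"
        using mult_mono[OF M'(2)[of k] f(2)[of k x]] M'(2)[of k] by (simp add: abs_mult)
    qed
    then show ?thesis
      by (rule uniform_limit_theorem[rotated]) (auto intro!: always_eventually continuous_intros f)
  qed
  have Wi: "torus_integrable W" by (intro torus_integrable_cts continuous_on_subset[OF Wc]) auto
  have ser: "(\<lambda>k. c k * torus_int (\<lambda>x. h x * f k x)) sums torus_int (\<lambda>x. h x * W x)"
    if "torus_integrable h" for h
    unfolding W_def by (rule torus_int_series[OF that M' f])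
  have sz: "torus_int (\<lambda>x. W x * sin (of_int n * x)) = torus_int (\<lambda>x. w x * sin (of_int n * x))"
    if n: "n > 0" for n :: int
  proof -
    define j where "j = nat n - 1"
    have j: "n = int (Suc j)" using n by (simp add: j_def)
    have "(\<lambda>k. c k * torus_int (\<lambda>x. sin (of_int n * x) * f k x)) sums torus_int (\<lambda>x. sin (of_int n * x) * W x)"
      by (rule ser) (auto intro!: torus_integrable_cts continuous_intros)
    moreover have "c k * torus_int (\<lambda>x. sin (of_int n * x) * f k x) = (if k = j then s j else 0)" for k
      unfolding fi torus_int_sin_sin j by (auto simp: c_def)
    ultimately have "(\<lambda>k. if k = j then s j else 0) sums torus_int (\<lambda>x. sin (of_int n * x) * W x)" by simp
    then have "torus_int (\<lambda>x. sin (of_int n * x) * W x) = s j"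
      using sums_single[of j "\<lambda>_. s j"] sums_unique2 by (metis (no_types, lifting) sums_cong)
    then show ?thesis by (simp add: s_def j mult.commute)
  qed
  have "trig_orthogonal (\<lambda>x. w x - W x)"
    unfolding trig_orthogonal_def left_diff_distrib
  proof (intro conjI allI)
    show "torus_integrable (\<lambda>x. w x - W x)" by (rule set_integral_diff(1)[OF w(1) Wi])
    fix n :: int
    have "(\<lambda>k. c k * torus_int (\<lambda>x. cos (of_int n * x) * f k x)) sums torus_int (\<lambda>x. cos (of_int n * x) * W x)"
      by (rule ser) (auto intro!: torus_integrable_cts continuous_intros)
    moreover have "torus_int (\<lambda>x. cos (of_int n * x) * f k x) = 0" for k
      unfolding fi using torus_int_sin_cos[of "int (Suc k)" n] by (simp add: mult.commute)
    ultimately have "torus_int (\<lambda>x. W x * cos (of_int n * x)) = 0"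
      by (simp add: sums_0 sums_unique2[OF _ sums_zero] mult.commute)
    then show "torus_int (\<lambda>x. w x * cos (of_int n * x) - W x * cos (of_int n * x)) = 0"
      by (simp only: set_integral_diff(2)[OF torus_integrable_cos[OF w(1)] torus_integrable_cos[OF Wi]] cz diff_self)
    have "torus_int (\<lambda>x. W x * sin (of_int n * x)) = torus_int (\<lambda>x. w x * sin (of_int n * x))"
    proof (cases n "0 :: int" rule: linorder_cases)
      case less
      have e: "g x * sin (of_int n * x) = - (g x * sin (of_int (- n) * x))" for g :: "real \<Rightarrow> real" and x
        by simp
      show ?thesis unfolding e
        using sz[of "-n"] less by (simp only: set_integral_uminus[OF torus_integrable_sin[OF w(1)]] set_integral_uminus[OF torus_integrable_sin[OF Wi]])
    qed (use sz in auto)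
    then show "torus_int (\<lambda>x. w x * sin (of_int n * x) - W x * sin (of_int n * x)) = 0"
      by (simp only: set_integral_diff(2)[OF torus_integrable_sin[OF w(1)] torus_integrable_sin[OF Wi]] diff_self)
  qed
  from trig_orthogonal_AE_zero[OF this]
  have ae: "AE x in lebesgue. x \<in> {-pi..pi} \<longrightarrow> (w x)^2 = w x * W x"
    by (rule AE_mp) (auto intro!: AE_I2 simp: power2_eq_square)
  have "torus_int (\<lambda>x. (w x)^2) = torus_int (\<lambda>x. w x * W x)"
    by (rule torus_int_cong_AE(1)[OF ae])
       (intro borel_measurable_power borel_measurable_times w cts_lebesgue_measurable Wc)+
  moreover have "c k * torus_int (\<lambda>x. w x * f k x) = (s k)^2 / pi" for k
    by (simp add: c_def s_def f_def power2_eq_square)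
  ultimately show ?thesis using ser[OF w(1)] by simp
qed

lemma torus_int_odd:
  assumes "\<And>x. f (- x) = - f (x::real)"
  shows "torus_int f = 0"
proof -
  have "torus_int f = (\<integral>x. indicat_real {-pi..pi} x *\<^sub>R f x \<partial>lebesgue)"
    by (simp add: set_lebesgue_integral_def)
  also have "\<dots> = (\<integral>x. indicat_real {-pi..pi} (0 + (-1) * x) *\<^sub>R f (0 + (-1) * x) \<partial>lebesgue)"
    using lebesgue_integral_real_affine[of "-1" "\<lambda>x. indicat_real {-pi..pi} x *\<^sub>R f x" 0] by simp
  also have "\<dots> = (\<integral>x. - (indicat_real {-pi..pi} x *\<^sub>R f x) \<partial>lebesgue)"
    by (intro Bochner_Integration.integral_cong) (auto simp: assms indicator_def)
  also have "\<dots> = - torus_int f" by (simp add: set_lebesgue_integral_def)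
  finally show ?thesis by simp
qed

lemma borel_measurable_rho_half: "rho_half \<in> borel_measurable lebesgue"
  unfolding rho_half_def by (intro borel_imp_lebesgue_measurable) measurable

lemma weak_deriv_measurable:
  assumes "has_weak_deriv u g"
  shows "g \<in> borel_measurable lebesgue" "u \<in> borel_measurable lebesgue"
  using assms by (auto simp: has_weak_deriv_def L2_torus_def)

lemma rho_half_cheb_U:
  assumes "sin x \<noteq> 0"
  shows "rho_half x * sin (real (Suc k) * x) = cheb_U k x / (2 * sqrt pi)"
  using assms cheb_U_mult_sin[of k x] unfolding rho_half_def by (simp add: field_simps)

lemma continuous_cheb_U: "continuous_on S (cheb_U k)"
proof -
  have "continuous_on S (cheb_U k) \<and> continuous_on S (cheb_U (Suc k))"
  proof (induction k)
    case 0
    have "cheb_U 0 = (\<lambda>x. 1)" "cheb_U (Suc 0) = (\<lambda>x. 2 * cos x)" by auto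
    then show ?case by (simp add: continuous_intros)
  next
    case (Suc k)
    have "cheb_U (Suc (Suc k)) = (\<lambda>x. cheb_U k x + 2 * cos (real (k + 2) * x))" by auto
    moreover have "continuous_on S (\<lambda>x. cheb_U k x + 2 * cos (real (k + 2) * x))"
      using Suc by (intro continuous_intros) auto
    ultimately show ?case using Suc by simp
  qed
  then show ?thesis by blast
qed

lemma borel_measurable_cheb_U: "cheb_U k \<in> borel_measurable lebesgue"
  by (intro cts_lebesgue_measurable continuous_cheb_U)

lemma weighted_sin_coef:
  assumes g: "has_weak_deriv \<eta> g"
  shows "torus_int (\<lambda>x. rho_half x * g x * sin (real (Suc k) * x)) = - sqrt pi * dw_coef \<eta> k"
proof -
  have "torus_int (\<lambda>x. rho_half x * g x * sin (real (Suc k) * x))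
      = torus_int (\<lambda>x. g x * cheb_U k x / (2 * sqrt pi))"
  proof (rule torus_int_cong_AE(1))
    show "AE x in lebesgue. x \<in> {-pi..pi} \<longrightarrow>
        rho_half x * g x * sin (real (Suc k) * x) = g x * cheb_U k x / (2 * sqrt pi)"
    proof (rule AE_mp[OF AE_sin_nonzero], intro AE_I2 impI)
      fix x :: real assume "sin x \<noteq> 0"
      from rho_half_cheb_U[OF this, of k]
      have "g x * (rho_half x * sin (real (Suc k) * x)) = g x * (cheb_U k x / (2 * sqrt pi))" by simp
      then show "rho_half x * g x * sin (real (Suc k) * x) = g x * cheb_U k x / (2 * sqrt pi)"
        by (simp only: mult_ac times_divide_eq_right)
    qed
    have "(\<lambda>x. sin (real (Suc k) * x)) \<in> borel_measurable lebesgue"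
      by (intro cts_lebesgue_measurable continuous_intros)
    then show "(\<lambda>x. rho_half x * g x * sin (real (Suc k) * x)) \<in> borel_measurable lebesgue"
      by (intro borel_measurable_times borel_measurable_rho_half weak_deriv_measurable[OF g])
    show "(\<lambda>x. g x * cheb_U k x / (2 * sqrt pi)) \<in> borel_measurable lebesgue"
      by (intro borel_measurable_times borel_measurable_divide borel_measurable_const
          weak_deriv_measurable[OF g] borel_measurable_cheb_U)
  qed
  also have "\<dots> = - 2 * pi * dw_coef \<eta> k / (2 * sqrt pi)"
    unfolding set_integral_divide_zero weak_deriv_cheb_U(2)[OF g] ..
  also have "\<dots> = - sqrt pi * dw_coef \<eta> k"
  proof -
    have "pi / sqrt pi = sqrt pi" by (simp add: real_div_sqrt)
    then show ?thesis by (simp add: field_simps)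
  qed
  finally show ?thesis .
qed

lemma deriv_odd_even:
  assumes o: "odd_fun \<eta>" and d: "\<And>x. (\<eta> has_real_derivative \<eta>' x) (at x)"
  shows "\<eta>' (- x) = \<eta>' x"
proof -
  have "((\<lambda>x. \<eta> (- x)) has_real_derivative \<eta>' (- x) * (- 1)) (at x)"
    by (rule DERIV_chain2[OF d]) (auto intro!: derivative_eq_intros)
  then have "((\<lambda>x. - \<eta> x) has_real_derivative \<eta>' (- x) * (- 1)) (at x)"
    using o by (simp add: odd_fun_def)
  moreover have "((\<lambda>x. - \<eta> x) has_real_derivative - \<eta>' x) (at x)"
    by (intro derivative_intros d)
  ultimately have "\<eta>' (- x) * (- 1) = - \<eta>' x" by (rule DERIV_unique)
  then show ?thesis by simp
qed

text \<open>
  Parseval's identity for the weighted norm. The function \<open>\<rho>\<^bsup>1/2\<^esup> \<partial>\<eta>\<close> is odd, and its coefficient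
  at \<open>sin ((k+1)\<theta>)\<close> is \<open>- \<surd>\<pi> a\<^sub>k\<close>; the one at \<open>sin \<theta>\<close> vanishes because \<open>\<partial>\<eta>\<close> has mean zero.
\<close>

lemma inner_rho_sums:
  assumes p: "torus_periodic \<eta>" and o: "odd_fun \<eta>"
    and d: "\<And>x. (\<eta> has_real_derivative \<eta>' x) (at x)" and c: "continuous_on UNIV \<eta>'"
    and wi: "torus_integrable (\<lambda>x. rho_half x * weak_deriv \<eta> x)"
    and M: "summable M" "\<And>k. \<bar>dw_coef \<eta> k\<bar> \<le> M k"
  shows "(\<lambda>k. (dw_coef \<eta> k)^2) sums inner_rho \<eta> \<eta>"
proof -
  define w where "w x = rho_half x * weak_deriv \<eta> x" for x
  have h: "has_weak_deriv \<eta> \<eta>'" by (rule has_weak_deriv_C1[OF p d c])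
  note g = has_weak_deriv_weak_deriv[OF h]
  have wm: "w \<in> borel_measurable lebesgue"
    unfolding w_def by (intro borel_measurable_times borel_measurable_rho_half weak_deriv_measurable[OF g])
  have sq: "(w x)^2 = rho x * weak_deriv \<eta> x * weak_deriv \<eta> x" for x
    by (simp add: w_def rho_half_def rho_def power_mult_distrib power_divide) (simp add: power2_eq_square)
  have coef: "torus_int (\<lambda>x. w x * sin (real (Suc k) * x)) = - sqrt pi * dw_coef \<eta> k" for k
    unfolding w_def by (rule weighted_sin_coef[OF g])
  have cz: "torus_int (\<lambda>x. w x * cos (of_int n * x)) = 0" for n :: int
  proof -
    have "torus_int (\<lambda>x. w x * cos (of_int n * x)) = torus_int (\<lambda>x. rho_half x * \<eta>' x * cos (of_int n * x))"
    proof (rule torus_int_cong_AE(1))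
      show "AE x in lebesgue. x \<in> {-pi..pi} \<longrightarrow> w x * cos (of_int n * x) = rho_half x * \<eta>' x * cos (of_int n * x)"
        by (rule AE_mp[OF has_weak_deriv_unique[OF g h]]) (auto simp: w_def)
      have m: "(\<lambda>x::real. cos (of_int n * x)) \<in> borel_measurable lebesgue"
        by (intro cts_lebesgue_measurable continuous_intros)
      show "(\<lambda>x. w x * cos (of_int n * x)) \<in> borel_measurable lebesgue"
        by (intro borel_measurable_times wm m)
      show "(\<lambda>x. rho_half x * \<eta>' x * cos (of_int n * x)) \<in> borel_measurable lebesgue"
        by (intro borel_measurable_times m borel_measurable_rho_half weak_deriv_measurable(1)[OF h])
    qed
    also have "\<dots> = 0"
      by (rule torus_int_odd) (simp add: rho_half_def deriv_odd_even[OF o d])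
    finally show ?thesis .
  qed
  have "(\<lambda>k. (torus_int (\<lambda>x. w x * sin (real (Suc k) * x)))^2 / pi) sums torus_int (\<lambda>x. (w x)^2)"
  proof (rule sine_series_parseval)
    show "torus_integrable w" using wi by (simp add: w_def[abs_def])
    show "summable (\<lambda>k. sqrt pi * M k)" by (intro summable_mult M)
    show "\<bar>torus_int (\<lambda>x. w x * sin (real (Suc k) * x))\<bar> \<le> sqrt pi * M k" for k
      unfolding coef using M(2)[of k] by (simp add: abs_mult)
  qed (use wm cz in auto)
  then show ?thesis
    unfolding coef sq inner_rho_def by (simp add: power_mult_distrib)
qed

text \<open>
  Here \<open>\<rho> \<partial>e_odd k = - cheb_U k / (2\<pi>)\<close>, so pairing with \<open>e_odd k\<close> reads off a coefficient.
\<close>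

lemma inner_rho_two_modes:
  assumes g: "has_weak_deriv \<xi> g" and k: "k \<ge> 1"
  shows "inner_rho \<xi> (\<lambda>x. a1 * e_odd 1 x + ak * e_odd k x) = a1 * dw_coef \<xi> 1 + ak * dw_coef \<xi> k"
proof -
  define \<eta> where "\<eta> x = a1 * e_odd 1 x + ak * e_odd k x" for x
  define \<eta>' where "\<eta>' x = - 2 * (sin x)^2 * (a1 * cheb_U 1 x + ak * cheb_U k x)" for x
  have e: "(e_odd k has_real_derivative - 2 * (sin x)^2 * cheb_U k x) (at x)" if "k \<ge> 1" for k x
  proof -
    have "cos (real (k + 2) * x) = cos (real (k + 1) * x + x)" "cos (real k * x) = cos (real (k + 1) * x - x)"
      by (simp_all add: algebra_simps)
    then have "cos (real (k + 2) * x) - cos (real k * x) = - 2 * sin x * sin (real (k + 1) * x)"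
      by (simp only: cos_add cos_diff) simp
    also have "\<dots> = - 2 * (sin x)^2 * cheb_U k x"
      unfolding cheb_U_mult_sin[symmetric] by (simp add: power2_eq_square)
    finally have "cos (real (k + 2) * x) - cos (real k * x) = - 2 * (sin x)^2 * cheb_U k x" .
    moreover have "(e_odd k has_real_derivative cos (real (k + 2) * x) - cos (real k * x)) (at x)"
      unfolding e_odd_def using that by (auto intro!: derivative_eq_intros simp del: of_nat_add)
    ultimately show ?thesis by simp
  qed
  have "(\<eta> has_real_derivative \<eta>' x) (at x)" for x
    unfolding \<eta>_def \<eta>'_def by (auto intro!: derivative_eq_intros e k simp: algebra_simps)
  moreover have "torus_periodic \<eta>"
    unfolding torus_periodic_def \<eta>_def e_odd_def by (simp only: sin_cos_nat_periodic simp_thms)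
  moreover have c: "continuous_on UNIV \<eta>'"
    unfolding \<eta>'_def by (intro continuous_intros continuous_cheb_U)
  ultimately have h: "has_weak_deriv \<eta> \<eta>'" using has_weak_deriv_C1 by blast
  note u = has_weak_deriv_unique[OF has_weak_deriv_weak_deriv[OF h] h]
  note gx = has_weak_deriv_weak_deriv[OF g]
  note gU = weak_deriv_cheb_U[OF gx]
  have "inner_rho \<xi> \<eta> = torus_int (\<lambda>x. (- a1 / (2 * pi)) * (weak_deriv \<xi> x * cheb_U 1 x)
      + (- ak / (2 * pi)) * (weak_deriv \<xi> x * cheb_U k x))"
    unfolding inner_rho_def
  proof (rule torus_int_cong_AE(1))
    have pt: "rho x * y * \<eta>' x = (- a1 / (2 * pi)) * (y * cheb_U 1 x) + (- ak / (2 * pi)) * (y * cheb_U k x)"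
      if "sin x \<noteq> 0" for x y
    proof -
      have "rho x * (- 2 * (sin x)^2) = - 1 / (2 * pi)" using that by (simp add: rho_def)
      moreover have "rho x * y * \<eta>' x = (rho x * (- 2 * (sin x)^2)) * (y * (a1 * cheb_U 1 x + ak * cheb_U k x))"
        by (simp only: \<eta>'_def mult_ac)
      ultimately have "rho x * y * \<eta>' x = (- 1 / (2 * pi)) * (y * (a1 * cheb_U 1 x + ak * cheb_U k x))"
        by (simp only:)
      also have "\<dots> = (- a1 / (2 * pi)) * (y * cheb_U 1 x) + (- ak / (2 * pi)) * (y * cheb_U k x)"
        by (simp add: divide_simps) (simp add: algebra_simps)
      finally show ?thesis .
    qed
    show "AE x in lebesgue. x \<in> {-pi..pi} \<longrightarrow> rho x * weak_deriv \<xi> x * weak_deriv \<eta> x =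
       (- a1 / (2 * pi)) * (weak_deriv \<xi> x * cheb_U 1 x) + (- ak / (2 * pi)) * (weak_deriv \<xi> x * cheb_U k x)"
      using u AE_sin_nonzero
    proof eventually_elim
      case (elim x)
      show ?case
      proof
        assume "x \<in> {-pi..pi}"
        with elim(1) have e: "weak_deriv \<eta> x = \<eta>' x" by blast
        show "rho x * weak_deriv \<xi> x * weak_deriv \<eta> x =
          (- a1 / (2 * pi)) * (weak_deriv \<xi> x * cheb_U 1 x) + (- ak / (2 * pi)) * (weak_deriv \<xi> x * cheb_U k x)"
          unfolding e by (rule pt[OF elim(2)])
      qed
    qed
    have r: "rho \<in> borel_measurable lebesgue"
      unfolding rho_def by (intro borel_imp_lebesgue_measurable) measurable
    note m = weak_deriv_measurable(1)[OF gx] weak_deriv_measurable(1)[OF has_weak_deriv_weak_deriv[OF h]]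
    show "(\<lambda>x. rho x * weak_deriv \<xi> x * weak_deriv \<eta> x) \<in> borel_measurable lebesgue"
      by (intro borel_measurable_times r m)
    show "(\<lambda>x. (- a1 / (2 * pi)) * (weak_deriv \<xi> x * cheb_U 1 x)
        + (- ak / (2 * pi)) * (weak_deriv \<xi> x * cheb_U k x)) \<in> borel_measurable lebesgue"
      by (intro borel_measurable_times borel_measurable_add borel_measurable_const m borel_measurable_cheb_U)
  qed
  also have "\<dots> = (- a1 / (2 * pi)) * (- 2 * pi * dw_coef \<xi> 1) + (- ak / (2 * pi)) * (- 2 * pi * dw_coef \<xi> k)"
    by (simp only: set_integral_add(2)[OF set_integrable_mult_right[OF gU(1)] set_integrable_mult_right[OF gU(1)]]
        set_integral_mult_right gU(2))
  also have "\<dots> = a1 * dw_coef \<xi> 1 + ak * dw_coef \<xi> k" by simp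
  finally show ?thesis unfolding \<eta>_def .
qed

section \<open>The periodic Hilbert transform\<close>

lemma torus_periodic_int:
  assumes "torus_periodic f" shows "f (x + 2 * pi * of_int n) = f x"
proof -
  have nat: "f (x + 2 * pi * real n) = f x" for n x
  proof (induction n)
    case (Suc n)
    have "x + 2 * pi * real (Suc n) = (x + 2 * pi * real n) + 2 * pi" by (simp add: algebra_simps)
    then have "f (x + 2 * pi * real (Suc n)) = f ((x + 2 * pi * real n) + 2 * pi)" by (simp only:)
    then show ?case using assms Suc unfolding torus_periodic_def by (simp del: of_nat_Suc)
  qed simp
  show ?thesis
  proof (cases "n \<ge> 0")
    case True then show ?thesis using nat[of x "nat n"] by simp
  next
    case False
    then have "(x + 2 * pi * of_int n) + 2 * pi * real (nat (- n)) = x" by simp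
    then show ?thesis using nat[of "x + 2 * pi * of_int n" "nat (- n)"] by metis
  qed
qed

lemma has_integral_periodic_shift:
  assumes p: "torus_periodic g" and g: "(g has_integral I) {-pi..pi}"
  shows "(g has_integral I) {a - pi..a + pi}"
proof -
  \<comment> \<open>the period containing \<open>a\<close>; the part of the interval beyond its end is moved back by \<open>2\<pi>\<close>\<close>
  define n where "n = \<lfloor>a / (2 * pi)\<rfloor>"
  have n: "2 * pi * of_int n \<le> a" "a < 2 * pi * of_int n + 2 * pi"
  proof -
    have "of_int n \<le> a / (2 * pi)" "a / (2 * pi) < of_int n + 1" unfolding n_def by linarith+
    then show "2 * pi * of_int n \<le> a" "a < 2 * pi * of_int n + 2 * pi"
      by (simp_all add: field_simps)
  qed
  define b where "b = 2 * pi * of_int n"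
  define c where "c = a - pi"
  have gn: "g (x + - b) = g x" for x
    using torus_periodic_int[OF p, of x "-n"] by (simp add: b_def)
  have g0: "(g has_integral I) {b - pi..b + pi}"
    using has_integral_shift_real_ivl[OF g, of "-b"] by (simp only: gn) (simp add: add.commute)
  have gp: "g (x + - (2 * pi)) = g x" for x
    using torus_periodic_int[OF p, of x "-1"] by simp
  have gc: "b - pi \<le> c" "c \<le> b + pi" using n by (auto simp: b_def c_def)
  have i1: "(g has_integral integral {b-pi..c} g) {b-pi..c}"
    using g0 gc by (intro integrable_integral) (auto intro: integrable_on_subinterval)
  have i2: "(g has_integral integral {c..b+pi} g) {c..b+pi}"
    using g0 gc by (intro integrable_integral) (auto intro: integrable_on_subinterval)
  have "(g has_integral integral {b-pi..c} g + integral {c..b+pi} g) {b - pi..b + pi}"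
    by (rule has_integral_combine[OF gc i1 i2])
  then have I: "I = integral {b-pi..c} g + integral {c..b+pi} g"
    using g0 has_integral_unique by blast
  have "(g has_integral integral {b-pi..c} g) {b + pi..c + 2 * pi}"
    using has_integral_shift_real_ivl[OF i1, of "- (2 * pi)"] by (simp only: gp) (simp add: algebra_simps)
  from has_integral_combine[OF _ _ i2 this] gc
  have "(g has_integral I) {c..c + 2 * pi}" unfolding I by (simp add: add.commute)
  moreover have "c = a - pi" "c + 2 * pi = a + pi" by (simp_all add: c_def)
  ultimately show ?thesis by (simp only:)
qed

lemma has_integral_periodic_reflect:
  assumes p: "torus_periodic h" and h: "(h has_integral I) {-pi..pi}"
  shows "((\<lambda>x. h (a - x)) has_integral I) {-pi..pi}"
proof -
  have "(h has_integral I) {a - pi..a + pi}" by (rule has_integral_periodic_shift[OF p h])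
  then have "((\<lambda>x. h (x + a)) has_integral I) {-pi..pi}"
    using has_integral_shift_real_ivl[of h I "a - pi" "a + pi" a] by simp
  then have "((\<lambda>x. h (- x + a)) has_integral I) {-pi..pi}"
    using has_integral_reflect_lemma_real[of "\<lambda>x. h (x + a)" I "-pi" pi] by simp
  then show ?thesis by simp
qed

text \<open>
  The region kept by the truncated principal value, in the variable \<open>\<psi> = \<theta> - \<phi>\<close>. In this variable the
  truncated integrand is periodic, so its integral may be moved to \<open>[-\<pi>, \<pi>]\<close>, where the region is
  \<open>\<epsilon> \<le> \<bar>\<psi>\<bar>\<close>.
\<close>

definition pv_region :: "real \<Rightarrow> real set" where
  "pv_region \<epsilon> = {\<psi>. \<forall>n::int. \<epsilon> \<le> \<bar>\<psi> - 2 * pi * of_int n\<bar>}"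

lemma pv_region_iff:
  assumes "\<epsilon> \<le> pi" "y \<in> {-pi..pi}"
  shows "y \<in> pv_region \<epsilon> \<longleftrightarrow> \<epsilon> \<le> \<bar>y\<bar>"
proof
  assume "y \<in> pv_region \<epsilon>"
  then show "\<epsilon> \<le> \<bar>y\<bar>" unfolding pv_region_def by (auto dest: spec[of _ 0])
next
  assume e: "\<epsilon> \<le> \<bar>y\<bar>"
  have "\<epsilon> \<le> \<bar>y - 2 * pi * of_int n\<bar>" for n :: int
  proof (cases n "0::int" rule: linorder_cases)
    case less
    then have "real_of_int n \<le> -1" by linarith
    then have "2 * pi * real_of_int n \<le> 2 * pi * (-1)" by (intro mult_left_mono) auto
    moreover have "-pi \<le> y" "y \<le> pi" using assms by auto
    ultimately show ?thesis using assms(1) by linarith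
  next
    case greater
    then have "real_of_int n \<ge> 1" by linarith
    then have "2 * pi * 1 \<le> 2 * pi * real_of_int n" by (intro mult_left_mono) auto
    moreover have "-pi \<le> y" "y \<le> pi" using assms by auto
    ultimately show ?thesis using assms(1) by linarith
  qed (use e in auto)
  then show "y \<in> pv_region \<epsilon>" by (simp add: pv_region_def)
qed

lemma pv_region_periodic: "y + 2 * pi \<in> pv_region \<epsilon> \<longleftrightarrow> y \<in> pv_region \<epsilon>"
proof -
  have "(y + 2 * pi) - 2 * pi * of_int (n + 1) = y - 2 * pi * of_int n" for n :: int
    by (simp add: algebra_simps)
  then show ?thesis unfolding pv_region_def mem_Collect_eq
    by (metis diff_add_cancel)
qed

lemma has_integral_outside_hole:
  fixes k :: "real \<Rightarrow> real"
  assumes e: "0 < \<epsilon>" "\<epsilon> \<le> pi" and k: "continuous_on {-pi..-\<epsilon>} k" "continuous_on {\<epsilon>..pi} k"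
  shows "((\<lambda>y. indicator (pv_region \<epsilon>) y * k y) has_integral
           integral {-pi..-\<epsilon>} k + integral {\<epsilon>..pi} k) {-pi..pi}"
proof -
  define h where "h y = (if \<epsilon> \<le> \<bar>y\<bar> then k y else 0)" for y
  have 1: "(h has_integral integral {-pi..-\<epsilon>} k) {-pi..-\<epsilon>}"
    by (rule has_integral_eq[OF _ integrable_integral[OF integrable_continuous_real[OF k(1)]]])
       (use e in \<open>auto simp: h_def\<close>)
  have 3: "(h has_integral integral {\<epsilon>..pi} k) {\<epsilon>..pi}"
    by (rule has_integral_eq[OF _ integrable_integral[OF integrable_continuous_real[OF k(2)]]])
       (use e in \<open>auto simp: h_def\<close>)
  have 2: "(h has_integral 0) {-\<epsilon>..\<epsilon>}"
    by (rule has_integral_spike_finite[of "{-\<epsilon>, \<epsilon>}" _ _ "\<lambda>_. 0"]) (auto simp: h_def)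
  have "(h has_integral integral {-pi..-\<epsilon>} k + 0) {-pi..\<epsilon>}"
    by (rule has_integral_combine[OF _ _ 1 2]) (use e in auto)
  then have "(h has_integral integral {-pi..-\<epsilon>} k + 0 + integral {\<epsilon>..pi} k) {-pi..pi}"
    by (rule has_integral_combine[OF _ _ _ 3, rotated 2]) (use e in auto)
  then have "(h has_integral integral {-pi..-\<epsilon>} k + integral {\<epsilon>..pi} k) {-pi..pi}" by simp
  then show ?thesis
    by (rule has_integral_eq[rotated]) (use pv_region_iff[OF e(2)] in \<open>auto simp: h_def indicator_def\<close>)
qed

lemma cot_half_periodic: "cot ((y + 2 * pi) / 2) = cot (y / 2 :: real)"
  by (simp add: add_divide_distrib cot_def)

abbreviation truncated_hilbert :: "(real \<Rightarrow> real) \<Rightarrow> real \<Rightarrow> real \<Rightarrow> real" where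
  "truncated_hilbert f \<theta> \<epsilon> \<equiv> (LINT \<phi>:{\<phi> \<in> {-pi..pi}. \<forall>n::int. \<epsilon> \<le> \<bar>\<theta> - \<phi> - 2 * pi * of_int n\<bar>}|lebesgue.
            cot ((\<theta> - \<phi>) / 2) * f \<phi>)"

lemma hilbert_truncated:
  fixes f :: "real \<Rightarrow> real"
  assumes p: "torus_periodic f" and c: "continuous_on UNIV f" and e: "0 < \<epsilon>" "\<epsilon> \<le> pi"
  shows "truncated_hilbert f \<theta> \<epsilon>
       = - integral {\<epsilon>..pi} (\<lambda>\<phi>. cot (\<phi> / 2) * (f (\<theta> + \<phi>) - f (\<theta> - \<phi>)))"
proof -
  define k where "k y = cot (y / 2) * f (\<theta> - y)" for y
  define h where "h y = indicat_real (pv_region \<epsilon>) y * k y" for y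
  have cf: "continuous_on S (\<lambda>x. f (g x))" if "continuous_on S g" for S and g :: "real \<Rightarrow> real"
    by (rule continuous_on_compose2[OF c that]) auto
  have s: "sin (x / 2) \<noteq> 0" if x: "x \<in> {-pi..-\<epsilon>} \<union> {\<epsilon>..pi}" for x
  proof (cases "x > 0")
    case True
    then have "x \<le> pi" using x e by auto
    then have "x / 2 < pi" using pi_gt_zero by linarith
    with True have "0 < sin (x / 2)" by (intro sin_gt_zero) auto
    then show ?thesis by simp
  next
    case False
    then have "- pi \<le> x" "x \<le> - \<epsilon>" using x e by auto
    then have "0 < - x / 2" "- x / 2 < pi" using e pi_gt_zero by linarith+
    then have "0 < sin (- x / 2)" by (rule sin_gt_zero)
    then show ?thesis by simp
  qed
  have kc: "continuous_on {-pi..-\<epsilon>} k" "continuous_on {\<epsilon>..pi} k"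
    unfolding k_def cot_def using s by (auto intro!: continuous_intros cf)
  have fp: "f (\<theta> - (y + 2 * pi)) = f (\<theta> - y)" for y
    using torus_periodic_int[OF p, of "\<theta> - y" "-1"] by (simp add: algebra_simps)
  have hp: "torus_periodic h" "torus_periodic (\<lambda>y. \<bar>h y\<bar>)"
    unfolding torus_periodic_def h_def k_def indicator_def pv_region_periodic cot_half_periodic fp by auto
  define X where "X = integral {-pi..-\<epsilon>} k + integral {\<epsilon>..pi} k"
  have hX: "(h has_integral X) {-pi..pi}"
    unfolding h_def X_def by (rule has_integral_outside_hole[OF e kc])
  have ha: "(\<lambda>y. \<bar>h y\<bar>) integrable_on {-pi..pi}"
  proof -
    have "\<bar>h y\<bar> = indicat_real (pv_region \<epsilon>) y * \<bar>k y\<bar>" for y by (simp add: h_def abs_mult)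
    then show ?thesis using has_integral_outside_hole[OF e, of "\<lambda>y. \<bar>k y\<bar>"] kc
      by (auto simp: integrable_on_def intro!: continuous_intros)
  qed
  define g where "g \<phi> = h (\<theta> - \<phi>)" for \<phi>
  have gX: "(g has_integral X) {-pi..pi}"
    unfolding g_def by (rule has_integral_periodic_reflect[OF hp(1) hX])
  have "(\<lambda>\<phi>. \<bar>g \<phi>\<bar>) integrable_on {-pi..pi}"
    using has_integral_periodic_reflect[OF hp(2) integrable_integral[OF ha]]
    unfolding g_def integrable_on_def by blast
  then have ai: "torus_integrable g"
    using gX by (intro absolutely_integrable_onI) (auto simp: integrable_on_def)
  have "truncated_hilbert f \<theta> \<epsilon> = torus_int g"
    unfolding set_lebesgue_integral_def
    by (intro Bochner_Integration.integral_cong) (auto simp: g_def h_def k_def pv_region_def indicator_def)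
  also have "\<dots> = X" using torus_int_eq_integral[OF ai] gX by (simp add: integral_unique)
  finally have "truncated_hilbert f \<theta> \<epsilon> = integral {-pi..-\<epsilon>} k + integral {\<epsilon>..pi} k"
    by (simp add: X_def)
  also have "integral {-pi..-\<epsilon>} k = integral {\<epsilon>..pi} (\<lambda>y. k (- y))"
    using Henstock_Kurzweil_Integration.integral_reflect_real[of pi \<epsilon> "\<lambda>y. k (- y)"] by simp
  also have "\<dots> + integral {\<epsilon>..pi} k = integral {\<epsilon>..pi} (\<lambda>y. k (- y) + k y)"
  proof (rule Henstock_Kurzweil_Integration.integral_add[symmetric])
    have "continuous_on {\<epsilon>..pi} (\<lambda>y. k (- y))"
      by (rule continuous_on_compose2[OF kc(1)]) (auto intro!: continuous_intros)
    then show "(\<lambda>y. k (- y)) integrable_on {\<epsilon>..pi}" by (rule integrable_continuous_real)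
    show "k integrable_on {\<epsilon>..pi}" by (rule integrable_continuous_real[OF kc(2)])
  qed
  also have "\<dots> = integral {\<epsilon>..pi} (\<lambda>\<phi>. - (cot (\<phi> / 2) * (f (\<theta> + \<phi>) - f (\<theta> - \<phi>))))"
  proof -
    have "k (- y) + k y = - (cot (y / 2) * (f (\<theta> + y) - f (\<theta> - y)))" for y
      by (simp add: k_def cot_def algebra_simps diff_divide_distrib)
    then show ?thesis by simp
  qed
  finally show ?thesis by simp
qed

text \<open>
  The continuous extension of \<open>\<phi> cot (\<phi> / 2)\<close>. Together with the mean value of \<open>f'\<close> below it turns
  \<open>cot (\<phi> / 2) (f (\<theta> + \<phi>) - f (\<theta> - \<phi>))\<close> into a kernel that is jointly continuous in \<open>(\<theta>, \<phi>)\<close>; this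
  gives the existence of the principal value, the continuity of the Hilbert transform and the exchange
  of integrals.
\<close>

definition cot_weight :: "real \<Rightarrow> real" where
  "cot_weight \<phi> = (if \<phi> = 0 then 2 else \<phi> * cot (\<phi> / 2))"

lemma continuous_cot_weight: "continuous_on {0..pi} cot_weight"
proof -
  define s :: "real \<Rightarrow> real" where "s x = (if x = 0 then 1 else sin x / x)" for x
  have "isCont s x" for x
  proof (cases "x = 0")
    case True
    have "((\<lambda>y. (sin y - sin 0) / (y - 0)) \<longlongrightarrow> cos (0::real)) (at 0)"
      using DERIV_sin[of 0] unfolding has_field_derivative_iff by simp
    then have "((\<lambda>y. sin y / y) \<longlongrightarrow> (1::real)) (at 0)" by simp
    moreover have "eventually (\<lambda>y. sin y / y = s y) (at 0)"
      by (simp add: s_def eventually_at_filter)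
    ultimately have "(s \<longlongrightarrow> 1) (at 0)" by (rule Lim_transform_eventually)
    then show ?thesis using True by (simp add: isCont_def s_def)
  next
    case False
    have "eventually (\<lambda>y. s y = sin y / y) (nhds x)"
      using t1_space_nhds[OF False] by eventually_elim (simp add: s_def)
    then show ?thesis using False by (subst isCont_cong) (auto intro!: continuous_intros)
  qed
  then have sc: "continuous_on UNIV s" by (simp add: continuous_at_imp_continuous_on)
  have "continuous_on {0..pi} (\<lambda>\<phi>. 2 * cos (\<phi> / 2) / s (\<phi> / 2))"
  proof (intro continuous_intros continuous_on_compose2[OF sc] ballI)
    fix x :: real assume "x \<in> {0..pi}"
    then show "s (x / 2) \<noteq> 0" using sin_gt_zero[of "x / 2"] pi_gt_zero by (auto simp: s_def)
  qed auto
  moreover have "2 * cos (\<phi> / 2) / s (\<phi> / 2) = cot_weight \<phi>" for \<phi>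
    by (simp add: cot_weight_def s_def cot_def)
  ultimately show ?thesis by simp
qed

definition sym_mean :: "(real \<Rightarrow> real) \<Rightarrow> real \<Rightarrow> real \<Rightarrow> real" where
  "sym_mean f' \<theta> \<phi> = integral {-1..1} (\<lambda>s. f' (\<theta> + s * \<phi>))"

lemma continuous_sym_mean:
  assumes "continuous_on UNIV f'"
  shows "continuous_on S (\<lambda>(x, \<phi>). sym_mean f' x \<phi>)"
proof -
  have "continuous_on (UNIV \<times> cbox (-1) 1) (\<lambda>(p, s). f' (fst p + s * snd p))"
    unfolding split_beta by (rule continuous_on_compose2[OF assms]) (auto intro!: continuous_intros)
  from integral_continuous_on_param[OF this]
  show ?thesis unfolding sym_mean_def by (auto simp: split_beta intro: continuous_on_subset)
qed

lemma sym_mean_eq: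
  assumes d: "\<And>x. (f has_real_derivative f' x) (at x)"
  shows "\<phi> * sym_mean f' \<theta> \<phi> = f (\<theta> + \<phi>) - f (\<theta> - \<phi>)"
proof -
  have "((\<lambda>s. \<phi> * f' (\<theta> + s * \<phi>)) has_integral f (\<theta> + 1 * \<phi>) - f (\<theta> + (-1) * \<phi>)) {-1..1}"
  proof (rule fundamental_theorem_of_calculus)
    fix x :: real
    have "((\<lambda>s. f (\<theta> + s * \<phi>)) has_real_derivative f' (\<theta> + x * \<phi>) * \<phi>) (at x)"
      by (rule DERIV_chain2[OF d]) (auto intro!: derivative_eq_intros)
    then show "((\<lambda>s. f (\<theta> + s * \<phi>)) has_vector_derivative \<phi> * f' (\<theta> + x * \<phi>)) (at x within {-1..1})"
      unfolding has_real_derivative_iff_has_vector_derivative[symmetric] mult.commute[of \<phi>]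
      by (rule DERIV_subset) simp
  qed simp
  from integral_unique[OF this] show ?thesis
    unfolding sym_mean_def by (simp add: hk_integral_cmult)
qed

lemma hilbert_eq:
  assumes p: "torus_periodic f" and d: "\<And>x. (f has_real_derivative f' x) (at x)"
    and c: "continuous_on UNIV f'"
  shows "hilbert f \<theta> = - (1 / (2 * pi)) * integral {0..pi} (\<lambda>\<phi>. cot_weight \<phi> * sym_mean f' \<theta> \<phi>)"
proof -
  define K where "K \<phi> = cot_weight \<phi> * sym_mean f' \<theta> \<phi>" for \<phi>
  have fc: "continuous_on UNIV f" using d by (meson DERIV_isCont continuous_at_imp_continuous_on)
  have "continuous_on {0..pi} (\<lambda>\<phi>. sym_mean f' \<theta> \<phi>)"
    using continuous_on_compose2[OF continuous_sym_mean[OF c, of UNIV], of "{0..pi}" "\<lambda>\<phi>. (\<theta>, \<phi>)"]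
      continuous_on_Pair[OF continuous_on_const[of "{0..pi}" \<theta>] continuous_on_id[of "{0..pi}"]]
    by (simp add: id_def)
  then have Kc: "continuous_on {0..pi} K"
    unfolding K_def by (intro continuous_intros continuous_cot_weight)
  have Ki: "K integrable_on {0..pi}" by (rule integrable_continuous_real[OF Kc])
  have ev: "1 / (2 * pi) * truncated_hilbert f \<theta> \<epsilon> = - (1 / (2 * pi)) * (integral {0..pi} K - integral {0..\<epsilon>} K)"
    if e: "0 < \<epsilon>" "\<epsilon> < pi" for \<epsilon>
  proof -
    have "integral {\<epsilon>..pi} (\<lambda>\<phi>. cot (\<phi> / 2) * (f (\<theta> + \<phi>) - f (\<theta> - \<phi>))) = integral {\<epsilon>..pi} K"
      by (rule Henstock_Kurzweil_Integration.integral_cong)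
         (use e in \<open>auto simp: K_def cot_weight_def sym_mean_eq[OF d, symmetric]\<close>)
    also have "\<dots> = integral {0..pi} K - integral {0..\<epsilon>} K"
      using Henstock_Kurzweil_Integration.integral_combine[of 0 \<epsilon> pi K] e Ki by simp
    finally show ?thesis using hilbert_truncated[OF p fc, of \<epsilon> \<theta>] e by (simp add: diff_divide_distrib)
  qed
  have "((\<lambda>\<epsilon>. integral {0..\<epsilon>} K) \<longlongrightarrow> integral {0..0} K) (at_right 0)"
  proof -
    have "continuous_on {0..pi} (\<lambda>\<epsilon>. integral {0..\<epsilon>} K)" by (rule indefinite_integral_continuous_1[OF Ki])
    then have "((\<lambda>\<epsilon>. integral {0..\<epsilon>} K) \<longlongrightarrow> integral {0..0} K) (at 0 within {0..pi})"
      unfolding continuous_on_def by (rule bspec) simp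
    then have "((\<lambda>\<epsilon>. integral {0..\<epsilon>} K) \<longlongrightarrow> integral {0..0} K) (at 0 within {0<..<pi})"
      by (rule tendsto_within_subset) auto
    moreover have "at (0::real) within {0<..<pi} = at_right 0"
      by (rule at_within_nhd[of _ "{-1<..<pi}"]) auto
    ultimately show ?thesis by simp
  qed
  then have "((\<lambda>\<epsilon>. - (1 / (2 * pi)) * (integral {0..pi} K - integral {0..\<epsilon>} K))
      \<longlongrightarrow> - (1 / (2 * pi)) * (integral {0..pi} K - integral {0..0} K)) (at_right 0)"
    by (intro tendsto_intros)
  moreover have "eventually (\<lambda>\<epsilon>. - (1 / (2 * pi)) * (integral {0..pi} K - integral {0..\<epsilon>} K)
     = 1 / (2 * pi) * truncated_hilbert f \<theta> \<epsilon>) (at_right 0)"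
    using eventually_at_right_real[OF pi_gt_zero] by eventually_elim (simp only: ev greaterThanLessThan_iff)
  ultimately have "((\<lambda>\<epsilon>. 1 / (2 * pi) * truncated_hilbert f \<theta> \<epsilon>) \<longlongrightarrow> - (1 / (2 * pi)) * (integral {0..pi} K - integral {0..0} K)) (at_right 0)"
    by (rule Lim_transform_eventually)
  then show ?thesis unfolding hilbert_def K_def
    by (intro tendsto_Lim) auto
qed

lemma continuous_hilbert:
  assumes "torus_periodic f" "\<And>x. (f has_real_derivative f' x) (at x)" and c: "continuous_on UNIV f'"
  shows "continuous_on UNIV (hilbert f)"
proof -
  have "continuous_on (UNIV \<times> cbox 0 pi) (\<lambda>(\<theta>, \<phi>). cot_weight \<phi> * sym_mean f' \<theta> \<phi>)"
    using continuous_sym_mean[OF c] unfolding split_beta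
    by (intro continuous_intros continuous_on_compose2[OF continuous_cot_weight]) auto
  from integral_continuous_on_param[OF this]
  show ?thesis unfolding hilbert_eq[OF assms, abs_def] by (auto intro!: continuous_intros)
qed

text \<open>
  The difference of the integrands for \<open>k + 1\<close> and \<open>k\<close> is \<open>cos k\<phi> + cos (k+1)\<phi>\<close>.
\<close>

lemma integral_cot_sin:
  "((\<lambda>\<phi>. cot (\<phi> / 2) * sin (real k * \<phi>)) has_integral (if k = 0 then 0 else pi)) {0..pi}"
proof (induction k)
  case (Suc k)
  have c: "((\<lambda>\<phi>. cos (real j * \<phi>)) has_integral (if j = 0 then pi else 0)) {0..pi}" for j
  proof (cases "j = 0")
    case True
    then show ?thesis using has_integral_const_real[of "1::real" 0 pi] by simp
  next
    case False
    have "((\<lambda>x. cos (real j * x)) has_integral sin (real j * pi) / real j - sin (real j * 0) / real j) {0..pi}"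
      by (rule fundamental_theorem_of_calculus)
         (use False in \<open>auto intro!: derivative_eq_intros simp: has_real_derivative_iff_has_vector_derivative[symmetric]\<close>)
    then show ?thesis using False by simp
  qed
  have e: "cot (\<phi> / 2) * sin (real (Suc k) * \<phi>) =
      cot (\<phi> / 2) * sin (real k * \<phi>) + (cos (real k * \<phi>) + cos (real (Suc k) * \<phi>))"
    if "\<phi> \<in> {0..pi} - {0}" for \<phi>
  proof -
    have nz: "sin (\<phi> / 2) \<noteq> 0"
      using sin_gt_zero[of "\<phi> / 2"] that pi_gt_zero by auto
    define y where "y = \<phi> / 2"
    \<comment> \<open>the midpoint of the two arguments\<close>
  define x where "x = real k * \<phi> + y"
    have a: "real (Suc k) * \<phi> = x + y" "real k * \<phi> = x - y" by (simp_all add: x_def y_def algebra_simps)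
    show ?thesis unfolding a sin_add sin_diff cos_add cos_diff cot_def y_def[symmetric]
      using nz unfolding y_def[symmetric] by (simp add: field_simps)
  qed
  have "((\<lambda>\<phi>. cot (\<phi> / 2) * sin (real k * \<phi>) + (cos (real k * \<phi>) + cos (real (Suc k) * \<phi>)))
      has_integral (if k = 0 then 0 else pi) + ((if k = 0 then pi else 0) + (if Suc k = 0 then pi else 0))) {0..pi}"
    by (intro has_integral_add Suc c)
  then have "((\<lambda>\<phi>. cot (\<phi> / 2) * sin (real (Suc k) * \<phi>)) has_integral
      (if k = 0 then 0 else pi) + ((if k = 0 then pi else 0) + (if Suc k = 0 then pi else 0))) {0..pi}"
    by (rule has_integral_spike_finite[of "{0}", rotated 2]) (use e in auto)
  then show ?case by (auto split: if_splits)
qed simp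

lemma integral_periodic_translate:
  assumes p: "torus_periodic g" and g: "g integrable_on {-pi..pi}"
  shows "integral {-pi..pi} (\<lambda>x. g (x + a)) = integral {-pi..pi} g"
proof -
  have "(g has_integral integral {-pi..pi} g) {a - pi..a + pi}"
    by (rule has_integral_periodic_shift[OF p integrable_integral[OF g]])
  from has_integral_shift_real_ivl[OF this, of a] show ?thesis by (simp add: integral_unique)
qed

lemma torus_periodic_cos_shift:
  assumes "torus_periodic f"
  shows "torus_periodic (\<lambda>x. f x * cos (real k * (x - a)))"
proof -
  have "real k * (x + 2 * pi - a) = real k * (x - a) + 2 * pi * of_int (int k)" for x
    by (simp add: algebra_simps)
  then have "cos (real k * (x + 2 * pi - a)) = cos (real k * (x - a))" for x
    by (simp only: cos_add cos_int_2pin sin_int_2pin mult_1_right mult_zero_right diff_0_right)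
  with assms show ?thesis by (simp add: torus_periodic_def)
qed

lemma integral_symmetric_difference_cos:
  assumes p: "torus_periodic f" and c: "continuous_on UNIV f"
  shows "integral {-pi..pi} (\<lambda>y. (f (y + a) - f (y - a)) * cos (real k * y))
       = 2 * sin (real k * a) * sin_coef f k"
proof -
  have cf: "continuous_on S (\<lambda>x. f (g x))" if "continuous_on S g" for S and g :: "real \<Rightarrow> real"
    by (rule continuous_on_compose2[OF c that]) auto
  have sh: "integral {-pi..pi} (\<lambda>y. f (y + b) * cos (real k * y))
      = integral {-pi..pi} (\<lambda>x. f x * cos (real k * (x - b)))" for b
    using integral_periodic_translate[OF torus_periodic_cos_shift[OF p, of k b], of b]
    by (simp add: integrable_continuous_real continuous_intros cf)
  have "integral {-pi..pi} (\<lambda>y. (f (y + a) - f (y - a)) * cos (real k * y))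
      = integral {-pi..pi} (\<lambda>y. f (y + a) * cos (real k * y)) - integral {-pi..pi} (\<lambda>y. f (y + - a) * cos (real k * y))"
    unfolding left_diff_distrib
    by (subst Henstock_Kurzweil_Integration.integral_diff[symmetric])
       (auto intro!: integrable_continuous_real continuous_intros cf)
  also have "\<dots> = integral {-pi..pi} (\<lambda>x. f x * cos (real k * (x - a)) - f x * cos (real k * (x - - a)))"
    unfolding sh
    by (subst Henstock_Kurzweil_Integration.integral_diff)
       (auto intro!: integrable_continuous_real continuous_intros cf)
  also have "(\<lambda>x. f x * cos (real k * (x - a)) - f x * cos (real k * (x - - a)))
      = (\<lambda>x. 2 * sin (real k * a) * (f x * sin (real k * x)))"
    by (auto simp: fun_eq_iff algebra_simps cos_add cos_diff)
  also have "integral {-pi..pi} \<dots> = 2 * sin (real k * a) * integral {-pi..pi} (\<lambda>x. f x * sin (real k * x))"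
    by (rule hk_integral_cmult)
  also have "integral {-pi..pi} (\<lambda>x. f x * sin (real k * x)) = sin_coef f k"
    unfolding sin_coef_def
    by (subst torus_int_eq_integral) (auto intro!: torus_integrable_cts continuous_intros cf)
  finally show ?thesis .
qed

text \<open>
  The Hilbert transform as a Fourier multiplier, after exchanging the two integrals.
\<close>

lemma hilbert_cos_coef:
  assumes p: "torus_periodic f" and d: "\<And>x. (f has_real_derivative f' x) (at x)"
    and c: "continuous_on UNIV f'"
  shows "torus_int (\<lambda>y. hilbert f y * cos (real k * y)) = - sin_coef f k"
proof -
  have fc: "continuous_on UNIV f" using d by (meson DERIV_isCont continuous_at_imp_continuous_on)
  define K where "K y \<phi> = cot_weight \<phi> * sym_mean f' y \<phi> * cos (real k * y)" for y \<phi>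
  have Kc: "continuous_on (cbox (-pi, 0) (pi, pi)) (\<lambda>(y, \<phi>). K y \<phi>)"
    using continuous_sym_mean[OF c] unfolding split_beta K_def
    by (intro continuous_intros continuous_on_compose2[OF continuous_cot_weight]) auto
  have "torus_int (\<lambda>y. hilbert f y * cos (real k * y)) = integral {-pi..pi} (\<lambda>y. hilbert f y * cos (real k * y))"
    by (intro torus_int_eq_integral torus_integrable_cts continuous_intros
        continuous_on_subset[OF continuous_hilbert[OF p d c]]) auto
  also have "\<dots> = integral (cbox (-pi) pi) (\<lambda>y. - (1 / (2 * pi)) * integral (cbox 0 pi) (K y))"
  proof -
    have "hilbert f y * cos (real k * y) = - (1 / (2 * pi)) * integral (cbox 0 pi) (K y)" for y
      unfolding hilbert_eq[OF p d c] K_def by (simp add: Henstock_Kurzweil_Integration.integral_mult_left)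
    then show ?thesis by simp
  qed
  also have "\<dots> = - (1 / (2 * pi)) * integral (cbox (-pi) pi) (\<lambda>y. integral (cbox 0 pi) (K y))"
    by (rule hk_integral_cmult)
  also have "integral (cbox (-pi) pi) (\<lambda>y. integral (cbox 0 pi) (K y))
      = integral (cbox 0 pi) (\<lambda>\<phi>. integral (cbox (-pi) pi) (\<lambda>y. K y \<phi>))"
    by (rule integral_swap_continuous[OF Kc])
  also have "\<dots> = integral {0..pi} (\<lambda>\<phi>. 2 * sin_coef f k * (cot (\<phi> / 2) * sin (real k * \<phi>)))"
  proof -
    have "integral (cbox (-pi) pi) (\<lambda>y. K y \<phi>) = 2 * sin_coef f k * (cot (\<phi> / 2) * sin (real k * \<phi>))"
      if "\<phi> \<noteq> 0" for \<phi>
    proof -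
      have "K y \<phi> = cot (\<phi> / 2) * ((f (y + \<phi>) - f (y - \<phi>)) * cos (real k * y))" for y
        unfolding K_def cot_weight_def sym_mean_eq[OF d, symmetric] using that by simp
      then have "integral (cbox (-pi) pi) (\<lambda>y. K y \<phi>)
          = cot (\<phi> / 2) * integral {-pi..pi} (\<lambda>y. (f (y + \<phi>) - f (y - \<phi>)) * cos (real k * y))"
        by (simp add: hk_integral_cmult)
      then show ?thesis unfolding integral_symmetric_difference_cos[OF p fc] by simp
    qed
    then show ?thesis unfolding cbox_interval
      by (intro integral_spike[of "{0}"]) auto
  qed
  also have "\<dots> = 2 * sin_coef f k * (if k = 0 then 0 else pi)"
    using integral_unique[OF integral_cot_sin[of k]]
    by (simp add: hk_integral_cmult)
  finally show ?thesis by (auto simp: sin_coef_def)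
qed

section \<open>The operator in coefficients\<close>

lemma is_velocity_unique:
  assumes "is_velocity f v" "is_velocity f u"
  shows "v = u"
proof
  fix x
  have "((\<lambda>x. v x - u x) has_real_derivative 0) (at x)" for x
    using assms unfolding is_velocity_def by (auto intro!: derivative_eq_intros)
  then have "v x - u x = v 0 - u 0" using DERIV_isconst_all[of "\<lambda>x. v x - u x" x 0] by blast
  then show "v x = u x" using assms by (simp add: is_velocity_def)
qed

lemma velocity_eq: "is_velocity f v \<Longrightarrow> velocity f = v"
  unfolding velocity_def using is_velocity_unique by blast

text \<open>
  The Hilbert transform has mean zero, so \<open>v\<close> takes equal values at \<open>\<plusminus>\<pi>\<close> and the boundary
  terms cancel. At \<open>k = 0\<close> both sides are \<open>0\<close> because division by zero gives zero.
\<close>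

lemma velocity_sin_coef:
  assumes p: "torus_periodic f" and d: "\<And>x. (f has_real_derivative f' x) (at x)"
    and c: "continuous_on UNIV f'" and v: "is_velocity f v"
  shows "sin_coef v k = - sin_coef f k / real k"
proof (cases "k = 0")
  case True then show ?thesis by (simp add: sin_coef_def)
next
  case False
  have dv: "(v has_real_derivative hilbert f x) (at x)" for x using v by (simp add: is_velocity_def)
  have vc: "continuous_on S v" for S using dv by (meson DERIV_isCont continuous_at_imp_continuous_on)
  have Hc: "continuous_on S (hilbert f)" for S
    using continuous_on_subset[OF continuous_hilbert[OF p d c]] by auto
  have H0: "integral {-pi..pi} (hilbert f) = 0"
    using hilbert_cos_coef[OF p d c, of 0] by (simp add: sin_coef_def torus_int_eq_integral torus_integrable_cts Hc)
  have "(hilbert f has_integral v pi - v (-pi)) {-pi..pi}"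
    by (rule fundamental_theorem_of_calculus)
       (auto simp: has_real_derivative_iff_has_vector_derivative[symmetric] intro: DERIV_subset[OF dv])
  then have vpi: "v pi = v (-pi)" using H0 by (simp add: integral_unique)
  have "((\<lambda>x. hilbert f x * cos (real k * x) - real k * (v x * sin (real k * x))) has_integral
      v pi * cos (real k * pi) - v (-pi) * cos (real k * (-pi))) {-pi..pi}"
    by (rule fundamental_theorem_of_calculus)
       (auto intro!: derivative_eq_intros DERIV_subset[OF dv]
        simp: has_real_derivative_iff_has_vector_derivative[symmetric])
  then have "integral {-pi..pi} (\<lambda>x. hilbert f x * cos (real k * x) - real k * (v x * sin (real k * x))) = 0"
    using vpi by (simp add: integral_unique)
  then have "torus_int (\<lambda>x. hilbert f x * cos (real k * x) - real k * (v x * sin (real k * x))) = 0"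
    by (subst torus_int_eq_integral) (auto intro!: torus_integrable_cts continuous_intros vc Hc)
  then have "torus_int (\<lambda>x. hilbert f x * cos (real k * x)) - torus_int (\<lambda>x. real k * (v x * sin (real k * x))) = 0"
    by (subst (asm) set_integral_diff(2)) (auto intro!: torus_integrable_cts continuous_intros vc Hc)
  then have "- sin_coef f k = real k * sin_coef v k"
    unfolding hilbert_cos_coef[OF p d c] set_integral_mult_right sin_coef_def by simp
  then show ?thesis using False by (simp add: field_simps)
qed

text \<open>
  Integration by parts removes the derivative of \<open>f\<close>, and the product formulas turn every term into a
  Fourier coefficient at the frequencies \<open>j \<plusminus> 2\<close>. For \<open>j = 1\<close> the frequency \<open>-1\<close> occurs, which is why
  the formula is stated with real frequencies.
\<close>

lemma L_op_sin_transform: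
  assumes p: "torus_periodic f" and d: "\<And>x. (f has_real_derivative f' x) (at x)"
    and c: "continuous_on UNIV f'" and v: "is_velocity f v"
  shows "sin_coef (L_op f) j =
     - ((torus_int (\<lambda>x. f x * sin ((real j + 2) * x)) + torus_int (\<lambda>x. f x * sin ((real j - 2) * x)))
        + real j / 4 * (torus_int (\<lambda>x. f x * sin ((real j + 2) * x)) - torus_int (\<lambda>x. f x * sin ((real j - 2) * x))))
     + 1 / 2 * (torus_int (\<lambda>x. hilbert f x * cos ((real j - 2) * x)) - torus_int (\<lambda>x. hilbert f x * cos ((real j + 2) * x)))
     - (torus_int (\<lambda>x. v x * sin ((real j + 2) * x)) + torus_int (\<lambda>x. v x * sin ((real j - 2) * x)))"
proof -
  have dv: "(v has_real_derivative hilbert f x) (at x)" for x using v by (simp add: is_velocity_def)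
  have vc: "continuous_on S v" for S using dv by (meson DERIV_isCont continuous_at_imp_continuous_on)
  have Hc: "continuous_on S (hilbert f)" for S
    using continuous_on_subset[OF continuous_hilbert[OF p d c]] by auto
  have fc: "continuous_on S f" for S using d by (meson DERIV_isCont continuous_at_imp_continuous_on)
  have fc': "continuous_on S f'" for S by (rule continuous_on_subset[OF c]) auto
  note ti = torus_integrable_cts
  define p1 where "p1 x = 1 / 2 * sin (2 * x) * sin (real j * x)" for x :: real
  define p2 where "p2 x = cos (2 * x) * sin (real j * x) + real j / 2 * (sin (2 * x) * cos (real j * x))" for x :: real
  have dp: "(p1 has_real_derivative p2 x) (at x)" for x
    unfolding p1_def p2_def by (auto intro!: derivative_eq_intros simp: algebra_simps)
  have pp: "torus_periodic p1"
    using sin_cos_nat_periodic(1)[of 2] sin_cos_nat_periodic(1)[of j] by (simp add: torus_periodic_def p1_def)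
  have I1: "torus_int (\<lambda>x. f' x * p1 x) = - torus_int (\<lambda>x. f x * p2 x)"
    using integral_by_parts_periodic[OF p pp d dp c] by (simp add: p2_def continuous_intros)
  define FS where "FS a = torus_int (\<lambda>x. f x * sin (a * x))" for a
  define VS where "VS a = torus_int (\<lambda>x. v x * sin (a * x))" for a
  define HC where "HC a = torus_int (\<lambda>x. hilbert f x * cos (a * x))" for a
  have t1: "cos (2 * x) * sin (real j * x) = (sin ((real j + 2) * x) + sin ((real j - 2) * x)) / 2" for x :: real
    by (simp add: distrib_right left_diff_distrib sin_add sin_diff)
  have t2: "sin (2 * x) * cos (real j * x) = (sin ((real j + 2) * x) - sin ((real j - 2) * x)) / 2" for x :: real
    by (simp add: distrib_right left_diff_distrib sin_add sin_diff)
  have t3: "sin (2 * x) * sin (real j * x) = (cos ((real j - 2) * x) - cos ((real j + 2) * x)) / 2" for x :: real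
    by (simp add: distrib_right left_diff_distrib cos_add cos_diff)
  have i: "torus_integrable (\<lambda>x. g x * sin (a * x))" "torus_integrable (\<lambda>x. g x * cos (a * x))"
    if "continuous_on {-pi..pi} g" for g :: "real \<Rightarrow> real" and a
    using that by (auto intro!: ti continuous_intros)
  have g1: "torus_int (\<lambda>x. a * (g x * sin (b * x)) + a' * (g x * sin (b' * x)))
      = a * torus_int (\<lambda>x. g x * sin (b * x)) + a' * torus_int (\<lambda>x. g x * sin (b' * x))"
    if "continuous_on {-pi..pi} g" for g :: "real \<Rightarrow> real" and a b a' b'
    by (subst set_integral_add(2)) (use i[OF that] in auto)
  have g2: "torus_int (\<lambda>x. a * (g x * cos (b * x)) + a' * (g x * cos (b' * x)))
      = a * torus_int (\<lambda>x. g x * cos (b * x)) + a' * torus_int (\<lambda>x. g x * cos (b' * x))"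
    if "continuous_on {-pi..pi} g" for g :: "real \<Rightarrow> real" and a b a' b'
    by (subst set_integral_add(2)) (use i[OF that] in auto)
  have J1: "torus_int (\<lambda>x. f x * p2 x) = (1/2 + real j / 4) * FS (real j + 2) + (1/2 - real j / 4) * FS (real j - 2)"
  proof -
    have "f x * p2 x = (1/2 + real j / 4) * (f x * sin ((real j + 2) * x)) + (1/2 - real j / 4) * (f x * sin ((real j - 2) * x))" for x
      unfolding p2_def t1 t2 by (simp add: algebra_simps add_divide_distrib diff_divide_distrib)
    then show ?thesis unfolding FS_def g1[OF fc, symmetric] by simp
  qed
  have J2: "torus_int (\<lambda>x. f x * (cos (2 * x) * sin (real j * x))) = 1/2 * FS (real j + 2) + 1/2 * FS (real j - 2)"
    unfolding FS_def g1[OF fc, symmetric] t1 by (simp add: algebra_simps add_divide_distrib)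
  have J3: "torus_int (\<lambda>x. hilbert f x * (sin (2 * x) * sin (real j * x))) = 1/2 * HC (real j - 2) + (-1/2) * HC (real j + 2)"
    unfolding HC_def g2[OF Hc, symmetric] t3 by (simp add: algebra_simps diff_divide_distrib)
  have J4: "torus_int (\<lambda>x. v x * (cos (2 * x) * sin (real j * x))) = 1/2 * VS (real j + 2) + 1/2 * VS (real j - 2)"
    unfolding VS_def g1[OF vc, symmetric] t1 by (simp add: algebra_simps add_divide_distrib)
  have df: "deriv f x = f' x" for x using d by (rule DERIV_imp_deriv)
  have "L_op f x * sin (real j * x) = f' x * p1 x + (- (f x * (cos (2 * x) * sin (real j * x)))
      + (hilbert f x * (sin (2 * x) * sin (real j * x)) + (-2) * (v x * (cos (2 * x) * sin (real j * x)))))" for x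
    unfolding L_op_def df velocity_eq[OF v] p1_def by (simp add: algebra_simps)
  then have "sin_coef (L_op f) j = torus_int (\<lambda>x. f' x * p1 x + (- (f x * (cos (2 * x) * sin (real j * x)))
      + (hilbert f x * (sin (2 * x) * sin (real j * x)) + (-2) * (v x * (cos (2 * x) * sin (real j * x))))))"
    by (simp add: sin_coef_def)
  also have "\<dots> = torus_int (\<lambda>x. f' x * p1 x) + (- torus_int (\<lambda>x. f x * (cos (2 * x) * sin (real j * x)))
      + (torus_int (\<lambda>x. hilbert f x * (sin (2 * x) * sin (real j * x)))
         + (-2) * torus_int (\<lambda>x. v x * (cos (2 * x) * sin (real j * x)))))"
  proof -
    have a: "torus_integrable (\<lambda>x. f' x * p1 x)" "torus_integrable (\<lambda>x. f x * (cos (2 * x) * sin (real j * x)))"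
      "torus_integrable (\<lambda>x. hilbert f x * (sin (2 * x) * sin (real j * x)))"
      "torus_integrable (\<lambda>x. (-2) * (v x * (cos (2 * x) * sin (real j * x))))"
      unfolding p1_def by (auto intro!: ti continuous_intros fc fc' Hc vc)
    have b: "torus_integrable (\<lambda>x. - (f x * (cos (2 * x) * sin (real j * x))))"
      by (auto intro!: ti continuous_intros fc)
    show ?thesis
      unfolding set_integral_add(2)[OF a(1) set_integral_add(1)[OF b set_integral_add(1)[OF a(3,4)]]]
        set_integral_add(2)[OF b set_integral_add(1)[OF a(3,4)]] set_integral_add(2)[OF a(3,4)]
        set_integral_uminus[OF a(2)] set_integral_mult_right ..
  qed
  also have "\<dots> = - ((FS (real j + 2) + FS (real j - 2)) + real j / 4 * (FS (real j + 2) - FS (real j - 2)))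
     + 1 / 2 * (HC (real j - 2) - HC (real j + 2)) - (VS (real j + 2) + VS (real j - 2))"
    unfolding I1 J1 J2 J3 J4 by (simp add: algebra_simps)
  finally show ?thesis unfolding FS_def HC_def VS_def .
qed

text \<open>
  In the orthonormal basis \<open>e_odd k\<close> the operator is \<open>L = A + D\<close> with \<open>A\<close> antisymmetric, built from \<open>d_coef\<close>,
  and \<open>D\<close> diagonal; this is the \<open>k\<close>-th entry of \<open>D\<close>. Only the entry for \<open>k = 1\<close> is negative.
\<close>

definition sym_coef :: "nat \<Rightarrow> real" where
  "sym_coef k = d_coef (k + 2) - d_coef k"

lemma sin_coef_L_op_1:
  assumes p: "torus_periodic f" and d: "\<And>x. (f has_real_derivative f' x) (at x)"
    and c: "continuous_on UNIV f'" and v: "is_velocity f v"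
  shows "sin_coef (L_op f) 1 = - 3 / 4 * sin_coef f 1 - 5 / 12 * sin_coef f 3"
proof -
  have neg: "torus_int (\<lambda>x. g x * sin ((-1) * x)) = - torus_int (\<lambda>x. g x * sin (1 * x))" if "torus_integrable g" for g
    using set_integral_uminus[OF torus_integrable_sin[OF that, of 1]] by simp
  have dv: "(v has_real_derivative hilbert f x) (at x)" for x using v by (simp add: is_velocity_def)
  have vc: "torus_integrable v" "torus_integrable f"
    using d dv by (intro torus_integrable_cts; meson DERIV_isCont continuous_at_imp_continuous_on)+
  have S: "torus_int (\<lambda>x. f x * sin ((real 1 + 2) * x)) = sin_coef f 3"
    "torus_int (\<lambda>x. f x * sin ((real 1 - 2) * x)) = - sin_coef f 1"
    "torus_int (\<lambda>x. v x * sin ((real 1 + 2) * x)) = - sin_coef f 3 / 3"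
    "torus_int (\<lambda>x. v x * sin ((real 1 - 2) * x)) = sin_coef f 1"
    using neg[OF vc(1)] neg[OF vc(2)] velocity_sin_coef[OF assms, of 1] velocity_sin_coef[OF assms, of 3]
    by (simp_all add: sin_coef_def)
  have C: "torus_int (\<lambda>x. hilbert f x * cos ((real 1 + 2) * x)) = - sin_coef f 3"
    "torus_int (\<lambda>x. hilbert f x * cos ((real 1 - 2) * x)) = - sin_coef f 1"
    using hilbert_cos_coef[OF p d c, of 3] hilbert_cos_coef[OF p d c, of 1] by simp_all
  show ?thesis unfolding L_op_sin_transform[OF assms] S C
    by (simp add: add_divide_distrib diff_divide_distrib)
qed

lemma sin_coef_L_op:
  assumes p: "torus_periodic f" and d: "\<And>x. (f has_real_derivative f' x) (at x)"
    and c: "continuous_on UNIV f'" and v: "is_velocity f v"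
  shows "sin_coef (L_op f) (k + 2) =
    (real k - 2)^2 / (4 * real k) * sin_coef f k
      - (real k + 2) * (real k + 6) / (4 * (real k + 4)) * sin_coef f (k + 4)"
proof -
  have e: "real (k + 2) + 2 = real (k + 4)" "real (k + 2) - 2 = real k" by simp_all
  have V: "torus_int (\<lambda>x. v x * sin (real n * x)) = - sin_coef f n / real n" for n
    using velocity_sin_coef[OF assms, of n] by (simp add: sin_coef_def)
  have F: "torus_int (\<lambda>x. f x * sin (real n * x)) = sin_coef f n" for n by (simp add: sin_coef_def)
  have main: "sin_coef (L_op f) (k + 2) =
      - ((sin_coef f (k+4) + sin_coef f k) + real (k + 2) / 4 * (sin_coef f (k+4) - sin_coef f k))
      + 1 / 2 * (- sin_coef f k - - sin_coef f (k+4))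
      - (- sin_coef f (k+4) / real (k+4) + - sin_coef f k / real k)"
    unfolding L_op_sin_transform[OF assms] e V F hilbert_cos_coef[OF p d c] ..
  show ?thesis
  proof (cases "k = 0")
    case True
    have "sin_coef f 0 = 0" by (simp add: sin_coef_def)
    with main True show ?thesis by simp
  next
    case False
    have 1: "(real k - 2)^2 / (4 * real k) = -1 + real (k + 2) / 4 - 1/2 + 1 / real k"
      using False by (simp add: field_simps power2_eq_square)
    have 2: "(real k + 2) * (real k + 6) / (4 * (real k + 4)) = 1 + real (k + 2) / 4 - 1/2 - 1 / real (k+4)"
      by (simp add: field_simps)
    show ?thesis unfolding main 1 2 by (simp add: algebra_simps diff_divide_distrib)
  qed
qed

lemma sin_coef_eq_dw_coef: "sin_coef f (k + 2) = pi * (dw_coef f k - dw_coef f (k + 2)) / real (k + 2)"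
proof -
  have e: "dw_coef f k - dw_coef f (k + 2) = real (k + 2) * sin_coef f (k + 2) / pi"
    by (simp add: numeral_2_eq_2)
  show ?thesis unfolding e by simp
qed

text \<open>
  Induction in steps of two along the recursion for \<^const>\<open>dw_coef\<close>: the increment of the left-hand side is
  a sine coefficient of \<open>L f\<close>, and the sine coefficients of \<open>f\<close> are differences of the \<open>a\<^sub>k\<close>, so that the
  sum telescopes. Division by zero makes \<open>d_coef 0 = 0\<close>, which together with \<open>d_coef 2 = 0\<close> starts the
  even indices.
\<close>

lemma dw_coef_L_op:
  assumes p: "torus_periodic f" and d: "\<And>x. (f has_real_derivative f' x) (at x)"
    and c: "continuous_on UNIV f'" and v: "is_velocity f v"
  shows "dw_coef (L_op f) k = d_coef k * dw_coef f (k - 2) + sym_coef k * dw_coef f k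
            - d_coef (k + 2) * dw_coef f (k + 2)"
proof (induction k rule: dw_coef.induct[of "\<lambda>_ k. dw_coef (L_op f) k = d_coef k * dw_coef f (k - 2) + sym_coef k * dw_coef f k
            - d_coef (k + 2) * dw_coef f (k + 2)" f])
  case 1
  show ?case by (simp add: d_coef_def)
next
  case 2
  have "dw_coef f 3 = dw_coef f 1 - 3 * sin_coef f 3 / pi"
    using dw_coef.simps(3)[of f 1] by (simp add: numeral_3_eq_3)
  moreover have "dw_coef f 1 = - sin_coef f 1 / pi" by simp
  moreover have "dw_coef (L_op f) 1 = (3 / 4 * sin_coef f 1 + 5 / 12 * sin_coef f 3) / pi"
    using sin_coef_L_op_1[OF assms] by simp
  moreover have "d_coef 3 = 5 / 36" "d_coef 1 = 3 / 4" by (simp_all add: d_coef_def power2_eq_square)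
  moreover have "sym_coef 1 = 5 / 36 - 3 / 4" by (simp add: sym_coef_def d_coef_def power2_eq_square)
  ultimately have "dw_coef (L_op f) 1 = d_coef 1 * dw_coef f 0 + sym_coef 1 * dw_coef f 1 - d_coef 3 * dw_coef f 3"
    by (simp only: dw_coef.simps(1)) (simp add: add_divide_distrib diff_divide_distrib)
  then show ?case by (simp add: numeral_3_eq_3)
next
  case (3 _ k)
  have d4: "d_coef (k + 4) = (real k + 2)^2 * (real k + 6) / (4 * (real k + 4)^2)"
    by (simp add: d_coef_def algebra_simps)
  have s1: "(real k - 2)^2 / (4 * real k) * sin_coef f k * real (k + 2) / pi = d_coef k * (dw_coef f (k - 2) - dw_coef f k)"
  proof -
    consider "k = 0" | "k = 1" | j where "k = j + 2" by (metis One_nat_def add_2_eq_Suc' not0_implies_Suc)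
    then show ?thesis
    proof cases
      case 1 then show ?thesis by (simp add: d_coef_def)
    next
      case 2 then show ?thesis by (simp add: d_coef_def)
    next
      case 3
      define x where "x = dw_coef f (k - 2) - dw_coef f k"
      have x: "sin_coef f k = pi * x / real k" and "k > 0"
        using sin_coef_eq_dw_coef[of f j] 3 by (auto simp: x_def)
      have "(real k - 2)^2 / (4 * real k) * (pi * x / real k) * real (k + 2) / pi = d_coef k * x"
        using \<open>k > 0\<close> by (simp add: d_coef_def power2_eq_square)
      then show ?thesis unfolding x x_def .
    qed
  qed
  have s2: "(real k + 2) * (real k + 6) / (4 * (real k + 4)) * sin_coef f (k + 4) * real (k + 2) / pi
      = d_coef (k + 4) * (dw_coef f (k + 2) - dw_coef f (k + 4))"
  proof -
    have "k + 2 + 2 = k + 4" by simp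
    have "sin_coef f (k + 4) = pi * (dw_coef f (k + 2) - dw_coef f (k + 4)) / (real k + 4)"
      using sin_coef_eq_dw_coef[of f "k + 2", unfolded \<open>k + 2 + 2 = k + 4\<close>]
      by (simp only: of_nat_add of_nat_numeral)
    moreover have "(real k + 2) * (real k + 6) / (4 * (real k + 4)) * (1 / (real k + 4)) * (real k + 2) = d_coef (k + 4)"
      unfolding d4 by (simp add: power2_eq_square mult_ac)
    moreover define x where "x = dw_coef f (k + 2) - dw_coef f (k + 4)"
    ultimately have e: "sin_coef f (k + 4) = pi * x / (real k + 4)"
      "(real k + 2) * (real k + 6) / (4 * (real k + 4)) * (1 / (real k + 4)) * (real k + 2) = d_coef (k + 4)"
      by simp_all
    have "(real k + 2) * (real k + 6) / (4 * (real k + 4)) * (pi * x / (real k + 4)) * real (k + 2) / pi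
       = ((real k + 2) * (real k + 6) / (4 * (real k + 4)) * (1 / (real k + 4)) * (real k + 2)) * x"
      by simp
    then show ?thesis unfolding e(1) e(2) x_def .
  qed
  have D2: "sym_coef (k + 2) = d_coef (k + 4) - d_coef (k + 2)"
    by (simp add: sym_coef_def numeral_eq_Suc)
  have "dw_coef (L_op f) (Suc (Suc k)) = dw_coef (L_op f) k - real (k + 2) * sin_coef (L_op f) (k + 2) / pi"
    by simp
  also have "real (k + 2) * sin_coef (L_op f) (k + 2) / pi
     = (real k - 2)^2 / (4 * real k) * sin_coef f k * real (k + 2) / pi
      - (real k + 2) * (real k + 6) / (4 * (real k + 4)) * sin_coef f (k + 4) * real (k + 2) / pi"
    unfolding sin_coef_L_op[OF assms] by (simp only: right_diff_distrib diff_divide_distrib mult_ac)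
  also have "\<dots> = d_coef k * (dw_coef f (k - 2) - dw_coef f k) - d_coef (k + 4) * (dw_coef f (k + 2) - dw_coef f (k + 4))"
    unfolding s1 s2 ..
  finally have "dw_coef (L_op f) (k + 2) = d_coef (k + 2) * dw_coef f k + sym_coef (k + 2) * dw_coef f (k + 2)
      - d_coef (k + 4) * dw_coef f (k + 4)"
    unfolding 3 D2 sym_coef_def[of k]
    by (simp add: algebra_simps del: dw_coef.simps)
  then show ?case by (simp add: numeral_eq_Suc del: dw_coef.simps)
qed

section \<open>Finite sine sums\<close>

lemma hilbert_sine_sum:
  assumes J: "finite J" "0 \<notin> J"
  shows "hilbert (\<lambda>x. \<Sum>j\<in>J. c j * sin (real j * x)) \<theta> = - (\<Sum>j\<in>J. c j * cos (real j * \<theta>))"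
proof -
  define f where "f x = (\<Sum>j\<in>J. c j * sin (real j * x))" for x
  define f' where "f' x = (\<Sum>j\<in>J. c j * (real j * cos (real j * x)))" for x
  have d: "(f has_real_derivative f' x) (at x)" for x
    unfolding f_def f'_def by (auto intro!: derivative_eq_intros sum.cong simp: algebra_simps)
  have c': "continuous_on UNIV f'" unfolding f'_def by (intro continuous_intros)
  have p: "torus_periodic f" by (simp add: torus_periodic_def f_def sin_cos_nat_periodic)
  have "((\<lambda>\<phi>. \<Sum>j\<in>J. 2 * c j * cos (real j * \<theta>) * (cot (\<phi> / 2) * sin (real j * \<phi>)))
      has_integral (\<Sum>j\<in>J. 2 * c j * cos (real j * \<theta>) * (if j = 0 then 0 else pi))) {0..pi}"
    by (intro has_integral_sum has_integral_mult_right integral_cot_sin J)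
  then have "((\<lambda>\<phi>. cot_weight \<phi> * sym_mean f' \<theta> \<phi>)
      has_integral (\<Sum>j\<in>J. 2 * c j * cos (real j * \<theta>) * (if j = 0 then 0 else pi))) {0..pi}"
  proof (rule has_integral_spike_finite[of "{0}", rotated 2])
    fix \<phi> assume "\<phi> \<in> {0..pi} - {0}"
    then have "cot_weight \<phi> * sym_mean f' \<theta> \<phi> = cot (\<phi> / 2) * (f (\<theta> + \<phi>) - f (\<theta> - \<phi>))"
      unfolding sym_mean_eq[OF d, symmetric] by (simp add: cot_weight_def)
    also have "f (\<theta> + \<phi>) - f (\<theta> - \<phi>) = (\<Sum>j\<in>J. 2 * c j * cos (real j * \<theta>) * sin (real j * \<phi>))"
      unfolding f_def sum_subtractf[symmetric]
      by (intro sum.cong) (auto simp: distrib_left right_diff_distrib sin_add sin_diff algebra_simps)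
    finally show "cot_weight \<phi> * sym_mean f' \<theta> \<phi> = (\<Sum>j\<in>J. 2 * c j * cos (real j * \<theta>) * (cot (\<phi> / 2) * sin (real j * \<phi>)))"
      by (simp add: sum_distrib_left mult_ac)
  qed auto
  then have "hilbert f \<theta> = - (1 / (2 * pi)) * (\<Sum>j\<in>J. 2 * c j * cos (real j * \<theta>) * (if j = 0 then 0 else pi))"
    unfolding hilbert_eq[OF p d c'] by (simp add: integral_unique)
  also have "(\<Sum>j\<in>J. 2 * c j * cos (real j * \<theta>) * (if j = 0 then 0 else pi)) = 2 * pi * (\<Sum>j\<in>J. c j * cos (real j * \<theta>))"
    unfolding sum_distrib_left using J by (intro sum.cong) auto
  finally show ?thesis unfolding f_def by simp
qed

text \<open>
  For a finite sine sum the Hilbert transform and the velocity are again finite trigonometric sums, so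
  \<open>L f\<close> is continuously differentiable.
\<close>

lemma L_op_sine_sum_weak_deriv:
  assumes J: "finite J" "0 \<notin> J" and f: "f = (\<lambda>x. \<Sum>j\<in>J. c j * sin (real j * x))"
  shows "\<exists>g. has_weak_deriv (\<lambda>y. - L_op f y) g"
proof -
  define f1 where "f1 x = (\<Sum>j\<in>J. c j * (real j * cos (real j * x)))" for x
  define f2 where "f2 x = (\<Sum>j\<in>J. c j * (real j * - (real j * sin (real j * x))))" for x
  define V where "V x = (\<Sum>j\<in>J. - c j / real j * sin (real j * x))" for x
  define H where "H x = (\<Sum>j\<in>J. - c j * cos (real j * x))" for x
  have d: "(f has_real_derivative f1 x) (at x)" for x
    unfolding f f1_def by (auto intro!: derivative_eq_intros sum.cong simp: algebra_simps)
  have d1: "(f1 has_real_derivative f2 x) (at x)" for x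
    unfolding f1_def f2_def by (auto intro!: derivative_eq_intros sum.cong simp: algebra_simps)
  define H1 where "H1 x = (\<Sum>j\<in>J. c j * (real j * sin (real j * x)))" for x
  have dH: "(H has_real_derivative H1 x) (at x)" for x
    unfolding H_def H1_def by (auto intro!: derivative_eq_intros sum.cong simp: algebra_simps)
  have hil: "hilbert f x = H x" for x
    unfolding f hilbert_sine_sum[OF J] H_def by (simp add: sum_negf)
  have dV: "(V has_real_derivative H x) (at x)" for x
    unfolding V_def H_def using J
    by (auto intro!: derivative_eq_intros sum.cong simp: algebra_simps)
  have "is_velocity f V" unfolding is_velocity_def hil using dV by (simp add: V_def)
  then have vel: "velocity f = V" by (rule velocity_eq)
  have L: "L_op f x = 1 / 2 * sin (2 * x) * f1 x - cos (2 * x) * f x + sin (2 * x) * H x - 2 * cos (2 * x) * V x" for x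
    unfolding L_op_def hil vel DERIV_imp_deriv[OF d] ..
  define g where "g x = - (cos (2 * x) * f1 x + 1 / 2 * sin (2 * x) * f2 x + 2 * sin (2 * x) * f x - cos (2 * x) * f1 x
     + 2 * cos (2 * x) * H x + sin (2 * x) * H1 x + 4 * sin (2 * x) * V x - 2 * cos (2 * x) * H x)" for x
  have "has_weak_deriv (\<lambda>y. - L_op f y) g"
  proof (rule has_weak_deriv_C1)
    show "torus_periodic (\<lambda>y. - L_op f y)"
    proof -
      have "f (x + 2 * pi) = f x" "f1 (x + 2 * pi) = f1 x" "V (x + 2 * pi) = V x" "H (x + 2 * pi) = H x" for x
        unfolding f f1_def V_def H_def sin_cos_nat_periodic by (rule refl)+
      moreover have "sin (2 * (x + 2 * pi)) = sin (2 * x)" "cos (2 * (x + 2 * pi)) = cos (2 * x)" for x :: real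
        using sin_cos_nat_periodic[of 2 x] by simp_all
      ultimately show ?thesis unfolding torus_periodic_def L by (simp only: simp_thms)
    qed
    show "((\<lambda>y. - L_op f y) has_real_derivative g x) (at x)" for x
      unfolding L g_def by (auto intro!: derivative_eq_intros d d1 dH dV simp: algebra_simps)
    have "continuous_on UNIV f" "continuous_on UNIV f1" "continuous_on UNIV V" "continuous_on UNIV H"
      using d d1 dV dH by (meson DERIV_isCont continuous_at_imp_continuous_on)+
    then show "continuous_on UNIV g" unfolding g_def f2_def H1_def
      by (intro continuous_intros) auto
  qed
  then show ?thesis by blast
qed

lemma sin_coef_e_odd:
  assumes "k \<ge> 1"
  shows "sin_coef (e_odd k) j = (if j = k + 2 then pi / real (k + 2) else 0) - (if j = k then pi / real k else 0)"
proof -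
  have i: "torus_integrable (\<lambda>x. sin (real a * x) * sin (real b * x))" for a b
    by (auto intro!: torus_integrable_cts continuous_intros)
  have s: "torus_int (\<lambda>x. sin (real a * x) * sin (real j * x)) = (if a = j then pi else 0)" if "a \<ge> 1" for a
    using torus_int_sin_sin[of "int a" "int j"] that by auto
  have "sin_coef (e_odd k) j = torus_int (\<lambda>x. (1 / real (k + 2)) * (sin (real (k + 2) * x) * sin (real j * x))
      - (1 / real k) * (sin (real k * x) * sin (real j * x)))"
    unfolding sin_coef_def e_odd_def by (simp add: left_diff_distrib del: of_nat_add)
  also have "\<dots> = (1 / real (k + 2)) * torus_int (\<lambda>x. sin (real (k + 2) * x) * sin (real j * x))
      - (1 / real k) * torus_int (\<lambda>x. sin (real k * x) * sin (real j * x))"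
    unfolding set_integral_diff(2)[OF set_integrable_mult_right[OF i] set_integrable_mult_right[OF i]] set_integral_mult_right ..
  also have "\<dots> = (if j = k + 2 then pi / real (k + 2) else 0) - (if j = k then pi / real k else 0)"
    using assms s[of "k + 2"] s[of k] by auto
  finally show ?thesis .
qed

lemma dw_coef_e_odd:
  assumes "k \<ge> 1"
  shows "dw_coef (e_odd k) j = (if j = k then 1 else 0)"
proof (induction j rule: dw_coef.induct[of "\<lambda>_ j. dw_coef (e_odd k) j = (if j = k then 1 else 0)" "e_odd k"])
  case (3 _ j)
  then show ?case using assms by (auto simp: sin_coef_e_odd)
qed (use assms in \<open>auto simp: sin_coef_e_odd\<close>)

lemma dw_coef_lincomb:
  assumes "torus_integrable f" "torus_integrable g"
  shows "dw_coef (\<lambda>x. a * f x + b * g x) j = a * dw_coef f j + b * dw_coef g j"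
proof -
  have s: "sin_coef (\<lambda>x. a * f x + b * g x) j = a * sin_coef f j + b * sin_coef g j" for j
  proof -
    note i = torus_integrable_sin[OF assms(1), of "real j"] torus_integrable_sin[OF assms(2), of "real j"]
    have "sin_coef (\<lambda>x. a * f x + b * g x) j = torus_int (\<lambda>x. a * (f x * sin (real j * x)) + b * (g x * sin (real j * x)))"
      unfolding sin_coef_def by (simp add: algebra_simps)
    then show ?thesis
      unfolding set_integral_add(2)[OF set_integrable_mult_right[OF i(1)] set_integrable_mult_right[OF i(2)]]
        set_integral_mult_right sin_coef_def .
  qed
  show ?thesis
    by (induction j rule: dw_coef.induct[of "\<lambda>_ j. dw_coef (\<lambda>x. a * f x + b * g x) j = a * dw_coef f j + b * dw_coef g j" f])
       (simp_all add: s algebra_simps add_divide_distrib diff_divide_distrib)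
qed

lemma dw_coef_two_modes:
  assumes "k \<ge> 1"
  shows "dw_coef (\<lambda>x. a1 * e_odd 1 x + ak * e_odd k x) j = (if j = 1 then a1 else 0) + (if j = k then ak else 0)"
proof -
  have "torus_integrable (e_odd n)" for n
    unfolding e_odd_def divide_inverse by (auto intro!: torus_integrable_cts continuous_intros)
  then show ?thesis using assms by (simp add: dw_coef_lincomb dw_coef_e_odd)
qed

section \<open>Decay and evolution of the coefficients of a solution\<close>

lemma L2_norm_le_sobolev_norm:
  assumes "j \<le> m"
  shows "(L2_norm_torus ((weak_deriv ^^ j) u))^2 \<le> (sobolev_norm m u)^2"
proof -
  have "(L2_norm_torus ((weak_deriv ^^ j) u))^2 \<le> (\<Sum>j\<le>m. (L2_norm_torus ((weak_deriv ^^ j) u))^2)"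
    using assms by (intro member_le_sum) auto
  also have "\<dots> = (sobolev_norm m u)^2"
    unfolding sobolev_norm_def by (intro real_sqrt_pow2[symmetric] sum_nonneg) auto
  finally show ?thesis .
qed

text \<open>
  Two integrations by parts gain two powers of the frequency.
\<close>

lemma sobolev_sin_coef_decay:
  assumes u: "u \<in> sobolev m" and m: "m \<ge> 2"
  shows "(real (Suc k))^2 * \<bar>torus_int (\<lambda>x. u x * sin (real (Suc k) * x))\<bar> \<le> pi + (sobolev_norm m u)^2 / 2"
proof -
  obtain n where n: "m = Suc (Suc n)" using m by (metis add_2_eq_Suc le_Suc_ex)
  obtain g where g: "g \<in> sobolev (Suc n)" "has_weak_deriv u g" using u unfolding n by auto
  then obtain h where h: "has_weak_deriv g h" by auto
  note wu = has_weak_deriv_weak_deriv[OF g(2)]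
  have "has_weak_deriv (weak_deriv u) h" by (rule has_weak_deriv_trans[OF g(2) wu h])
  note wwu = has_weak_deriv_weak_deriv[OF this]
  have L2: "weak_deriv (weak_deriv u) \<in> L2_torus" using wwu by (simp add: has_weak_deriv_def)
  define j where "j = int (Suc k)"
  have "torus_int (\<lambda>x. weak_deriv (weak_deriv u) x * sin (of_int j * x))
      = - ((of_int j)^2) * torus_int (\<lambda>x. u x * sin (of_int j * x))"
    unfolding weak_deriv_sin_coef[OF wwu] weak_deriv_cos_coef[OF wu] by (simp add: power2_eq_square)
  then have "(of_int j)^2 * \<bar>torus_int (\<lambda>x. u x * sin (of_int j * x))\<bar>
      = \<bar>torus_int (\<lambda>x. weak_deriv (weak_deriv u) x * sin (of_int j * x))\<bar>"
    by (simp add: abs_mult)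
  also have "\<dots> \<le> pi + (L2_norm_torus (weak_deriv (weak_deriv u)))^2 / 2"
    by (rule torus_int_bounded_le[OF L2]) (auto intro!: continuous_intros)
  also have "\<dots> \<le> pi + (sobolev_norm m u)^2 / 2"
    using L2_norm_le_sobolev_norm[OF m, of u] by (simp add: numeral_2_eq_2)
  finally show ?thesis by (simp add: j_def)
qed

text \<open>
  The decay is uniform on a compact time interval: near each time \<open>x\<close> the difference \<open>w s - w x\<close> has small
  norm, and Bolzano's bisection principle passes from local to global bounds.
\<close>

lemma cont_path_sin_coef_decay:
  assumes w: "cont_path (sobolev m) (sobolev_norm m) T w" and m: "m \<ge> 2" and T: "T \<ge> 0"
  shows "\<exists>C. \<forall>t\<in>{0..T}. \<forall>k. (real (Suc k))^2 * \<bar>torus_int (\<lambda>y. w t y * sin (real (Suc k) * y))\<bar> \<le> C"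
proof -
  define B where "B t k = (real (Suc k))^2 * \<bar>torus_int (\<lambda>y. w t y * sin (real (Suc k) * y))\<bar>" for t k
  \<comment> \<open>additive over adjacent intervals, as bisection requires\<close>
  define P where "P a b \<longleftrightarrow> (\<exists>C. \<forall>t\<in>{a..b} \<inter> {0..T}. \<forall>k. B t k \<le> C)" for a b
  have "P 0 T"
  proof (rule Bolzano[OF T])
    fix a b c assume "P a b" "P b c"
    then obtain C C' where C: "\<And>t k. t \<in> {a..b} \<inter> {0..T} \<Longrightarrow> B t k \<le> C"
      "\<And>t k. t \<in> {b..c} \<inter> {0..T} \<Longrightarrow> B t k \<le> C'" unfolding P_def by meson
    have "B t k \<le> max C C'" if "t \<in> {a..c} \<inter> {0..T}" for t k
      using C(1)[of t k] C(2)[of t k] that by (cases "t \<le> b") (auto simp: le_max_iff_disj)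
    then show "P a c" unfolding P_def by blast
  next
    fix x assume x: "0 \<le> x" "x \<le> T"
    have wx: "w x \<in> sobolev m" "((\<lambda>s. sobolev_norm m (\<lambda>y. w s y - w x y)) \<longlongrightarrow> 0) (at x within {0..T})"
      using w x unfolding cont_path_def by auto
    have ws: "w s \<in> sobolev m" if "s \<in> {0..T}" for s using w that unfolding cont_path_def by auto
    have "eventually (\<lambda>s. dist (sobolev_norm m (\<lambda>y. w s y - w x y)) 0 < 1) (at x within {0..T})"
      using wx(2) by (rule tendstoD) simp
    then obtain d where d: "d > 0" "\<And>s. s \<in> {0..T} \<Longrightarrow> s \<noteq> x \<Longrightarrow> dist s x < d \<Longrightarrow>
        dist (sobolev_norm m (\<lambda>y. w s y - w x y)) 0 < 1"
      unfolding eventually_at by blast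
    define C0 where "C0 = pi + (sobolev_norm m (w x))^2 / 2"
    have C0: "B x k \<le> C0" for k
      unfolding B_def C0_def by (rule sobolev_sin_coef_decay[OF wx(1) m])
    have bd: "B s k \<le> C0 + (pi + 1 / 2)" if s: "s \<in> {0..T}" "dist s x < d" for s k
    proof (cases "s = x")
      case True
      have "0 \<le> pi + 1 / 2" using pi_ge_zero by linarith
      then show ?thesis using C0[of k] unfolding True by linarith
    next
      case False
      have di: "(\<lambda>y. w s y - w x y) \<in> sobolev m" by (rule sobolev_diff[OF ws[OF s(1)] wx(1)])
      have "\<bar>sobolev_norm m (\<lambda>y. w s y - w x y)\<bar> \<le> 1" using d(2)[OF s(1) False s(2)] by simp
      then have n1: "(sobolev_norm m (\<lambda>y. w s y - w x y))^2 \<le> 1" by (simp add: abs_square_le_1)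
      have i: "torus_integrable (\<lambda>y. w r y * sin (real (Suc k) * y))" if "r \<in> {0..T}" for r
        by (rule torus_integrable_sin[OF L2_torus_integrable[OF sobolev_subset_L2[OF ws[OF that]]]])
      have "torus_int (\<lambda>y. (w s y - w x y) * sin (real (Suc k) * y))
          = torus_int (\<lambda>y. w s y * sin (real (Suc k) * y)) - torus_int (\<lambda>y. w x y * sin (real (Suc k) * y))"
        unfolding left_diff_distrib by (rule set_integral_diff(2)) (use i s x in auto)
      then have "\<bar>torus_int (\<lambda>y. w s y * sin (real (Suc k) * y))\<bar>
          \<le> \<bar>torus_int (\<lambda>y. (w s y - w x y) * sin (real (Suc k) * y))\<bar> + \<bar>torus_int (\<lambda>y. w x y * sin (real (Suc k) * y))\<bar>"
        by linarith
      then have "B s k \<le> (real (Suc k))^2 * (\<bar>torus_int (\<lambda>y. (w s y - w x y) * sin (real (Suc k) * y))\<bar>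
          + \<bar>torus_int (\<lambda>y. w x y * sin (real (Suc k) * y))\<bar>)"
        unfolding B_def by (intro mult_left_mono) auto
      also have "\<dots> = (real (Suc k))^2 * \<bar>torus_int (\<lambda>y. (w s y - w x y) * sin (real (Suc k) * y))\<bar> + B x k"
        unfolding B_def by (rule distrib_left)
      also have "\<dots> \<le> (pi + 1 / 2) + C0"
        using sobolev_sin_coef_decay[OF di m, of k] n1 C0[of k] by linarith
      finally show ?thesis by linarith
    qed
    show "\<exists>d>0. \<forall>a b. a \<le> x \<and> x \<le> b \<and> b - a < d \<longrightarrow> P a b"
    proof (intro exI[of _ d] conjI allI impI)
      fix a b assume ab: "a \<le> x \<and> x \<le> b \<and> b - a < d"
      have "B s k \<le> C0 + (pi + 1 / 2)" if "s \<in> {a..b} \<inter> {0..T}" for s k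
        by (rule bd) (use that ab in \<open>auto simp: dist_real_def\<close>)
      then show "P a b" unfolding P_def by blast
    qed (rule d(1))
  qed
  then show ?thesis unfolding P_def B_def by simp
qed

lemma continuous_on_section:
  assumes c: "continuous_on ({0..} \<times> UNIV) (\<lambda>(t, x). f t x)" and s: "(s::real) \<ge> 0"
  shows "continuous_on UNIV (f s)"
proof -
  have "continuous_on UNIV (\<lambda>x. (s, x))" by (intro continuous_on_Pair continuous_on_const continuous_on_id)
  from continuous_on_compose2[OF c this] s show ?thesis by auto
qed

lemma sin_coef_has_derivative:
  assumes c: "continuous_on ({0..} \<times> UNIV) (\<lambda>(t, y). \<eta>t t y)"
    and d: "\<And>t y. t \<ge> 0 \<Longrightarrow> ((\<lambda>s. \<eta> s y) has_real_derivative \<eta>t t y) (at t within {0..})"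
    and c0: "\<And>t. t \<ge> 0 \<Longrightarrow> continuous_on UNIV (\<eta> t)" and t: "t \<ge> 0"
  shows "((\<lambda>s. sin_coef (\<eta> s) j) has_real_derivative sin_coef (\<eta>t t) j) (at t within {0..})"
proof -
  have ct: "continuous_on UNIV (\<eta>t s)" if "s \<ge> 0" for s
    by (rule continuous_on_section[OF c that])
  have "((\<lambda>s. integral (cbox (-pi) pi) (\<lambda>y. \<eta> s y * sin (real j * y))) has_real_derivative
      integral (cbox (-pi) pi) (\<lambda>y. \<eta>t t y * sin (real j * y))) (at t within {0..})"
  proof (rule leibniz_rule_field_derivative)
    show "((\<lambda>x. \<eta> x y * sin (real j * y)) has_field_derivative \<eta>t x y * sin (real j * y)) (at x within {0..})"
      if "x \<in> {0..}" for x y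
      using d[of x y] that by (auto intro!: derivative_eq_intros)
    show "(\<lambda>y. \<eta> x y * sin (real j * y)) integrable_on cbox (-pi) pi" if "x \<in> {0..}" for x
      using that by (auto intro!: integrable_continuous_real continuous_intros continuous_on_subset[OF c0])
    show "continuous_on ({0..} \<times> cbox (-pi) pi) (\<lambda>(x, y). \<eta>t x y * sin (real j * y))"
      using continuous_on_subset[OF c, of "{0..} \<times> cbox (-pi) pi"] unfolding split_beta
      by (auto intro!: continuous_intros)
  qed (use t in auto)
  moreover have "sin_coef (\<eta> s) j = integral {-pi..pi} (\<lambda>y. \<eta> s y * sin (real j * y))" if "s \<ge> 0" for s
    unfolding sin_coef_def using that
    by (intro torus_int_eq_integral torus_integrable_cts continuous_intros continuous_on_subset[OF c0]) auto
  moreover have "sin_coef (\<eta>t t) j = integral {-pi..pi} (\<lambda>y. \<eta>t t y * sin (real j * y))"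
    unfolding sin_coef_def using t
    by (intro torus_int_eq_integral torus_integrable_cts continuous_intros continuous_on_subset[OF ct]) auto
  ultimately show ?thesis
    using t has_field_derivative_transform_within[OF _ zero_less_one, of _ _ t "{0..}" "\<lambda>s. sin_coef (\<eta> s) j"]
    by simp
qed

text \<open>
  A coefficient is a fixed finite combination of sine coefficients.
\<close>

lemma dw_coef_has_derivative:
  assumes "\<And>j. ((\<lambda>s. sin_coef (\<eta> s) j) has_real_derivative sin_coef \<zeta> j) (at t within S)"
  shows "((\<lambda>s. dw_coef (\<eta> s) k) has_real_derivative dw_coef \<zeta> k) (at t within S)"
proof (induction k rule: dw_coef.induct[of "\<lambda>_ k. ((\<lambda>s. dw_coef (\<eta> s) k) has_real_derivative dw_coef \<zeta> k) (at t within S)" \<zeta>])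
  case (3 _ k)
  then show ?case by (auto intro!: derivative_eq_intros assms simp del: of_nat_Suc)
qed (auto intro!: derivative_eq_intros assms)

section \<open>The diagonal part and the commutator form\<close>

lemma sym_coef_eq:
  assumes "k \<ge> 1"
  shows "sym_coef k = 1 / 2 + (2 * (real k)^2 - 4 * real k - 8) / ((real k)^2 * (real k + 2)^2)"
proof -
  have k: "real k > 0" using assms by simp
  have a: "d_coef (k + 2) = (real k)^2 * (real k + 4) / (4 * (real k + 2)^2)"
    by (simp add: d_coef_def algebra_simps)
  show ?thesis unfolding sym_coef_def a d_coef_def using k
    by (simp add: divide_simps) (simp add: algebra_simps power2_eq_square)
qed

lemma d_coef_nonneg: "d_coef k \<ge> 0"
  by (simp add: d_coef_def)

lemma d_coef_le: "k \<ge> 2 \<Longrightarrow> d_coef k \<le> (real k + 2) / 4"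
proof -
  assume k: "k \<ge> 2"
  have "(real k - 2)^2 \<le> (real k)^2" using k by (intro power_mono) auto
  then have "(real k - 2)^2 * (real k + 2) \<le> (real k)^2 * (real k + 2)" by (intro mult_right_mono) auto
  then show ?thesis using k by (simp add: d_coef_def field_simps)
qed

lemma d_coef_le_Suc: "d_coef k \<le> real (Suc k)"
proof -
  consider "k = 0" | "k = 1" | "k \<ge> 2" by linarith
  then show ?thesis
  proof cases
    case 3 then show ?thesis using d_coef_le[OF 3] by simp
  qed (simp_all add: d_coef_def)
qed

lemma sym_coef_small: "sym_coef 1 = - 11 / 18" "sym_coef 2 = 3 / 8" "sym_coef 3 = 221 / 450"
  by (simp_all add: sym_coef_eq power2_eq_square)

lemma sym_coef_bounds:
  assumes "k \<ge> 4"
  shows "1 / 2 \<le> sym_coef k" "sym_coef k \<le> 1 / 2 + 2 / (real k + 2)^2"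
proof -
  have k: "real k \<ge> 4" using assms by simp
  have "4 * real k \<le> (real k) * real k" using k by (intro mult_right_mono) auto
  then have p: "0 \<le> 2 * (real k)^2 - 4 * real k - 8" using k unfolding power2_eq_square by linarith
  have "0 \<le> (2 * (real k)^2 - 4 * real k - 8) / ((real k)^2 * (real k + 2)^2)"
    by (intro divide_nonneg_nonneg p) auto
  moreover have "(2 * (real k)^2 - 4 * real k - 8) / ((real k)^2 * (real k + 2)^2) \<le> 2 * (real k)^2 / ((real k)^2 * (real k + 2)^2)"
    using k by (intro divide_right_mono) auto
  moreover have "2 * (real k)^2 / ((real k)^2 * (real k + 2)^2) = 2 / (real k + 2)^2" using k by simp
  ultimately show "1 / 2 \<le> sym_coef k" "sym_coef k \<le> 1 / 2 + 2 / (real k + 2)^2"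
    using sym_coef_eq[of k] assms by linarith+
qed

lemma sym_coef_le_3_5: "k \<ge> 4 \<Longrightarrow> sym_coef k \<le> 3 / 5"
proof -
  assume k: "k \<ge> 4"
  have "(6::real)^2 \<le> (real k + 2)^2" using k by (intro power_mono) auto
  then have "2 / (real k + 2)^2 \<le> 2 / 36" by (intro divide_left_mono) auto
  then show ?thesis using sym_coef_bounds(2)[OF k] by linarith
qed

lemma nat_ge_1_cases:
  fixes k :: nat
  assumes "k \<ge> 1"
  obtains "k = 1" | "k = 2" | "k = 3" | "k \<ge> 4"
  using assms by linarith

lemma abs_sym_coef_le_1: "k \<ge> 1 \<Longrightarrow> \<bar>sym_coef k\<bar> \<le> 1"
  by (cases rule: nat_ge_1_cases[of k])
     (use sym_coef_bounds(1)[of k] sym_coef_le_3_5[of k] in \<open>auto simp: sym_coef_small sym_coef_small(1)[unfolded One_nat_def]\<close>)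

lemma abs_sym_coef_le: "\<bar>sym_coef k\<bar> \<le> 1"
proof (cases "k = 0")
  case True then show ?thesis by (simp add: sym_coef_def d_coef_def)
next
  case False then show ?thesis by (intro abs_sym_coef_le_1) auto
qed

lemma sym_coef_pos: "k \<ge> 2 \<Longrightarrow> sym_coef k > 0"
  by (cases rule: nat_ge_1_cases[of k]) (use sym_coef_bounds(1)[of k] in \<open>auto simp: sym_coef_small\<close>)

text \<open>
  The absolute values of the entries of the commutator \<open>[D, A]\<close>; the second derivative of the energy is
  governed by \<open>D\<^sup>2 + [D, A] / 2\<close>. For \<open>k < 3\<close> there is no mode \<open>k - 2\<close> to couple to.
\<close>

definition coupling :: "nat \<Rightarrow> real" where
  "coupling k = (if k < 3 then 0 else d_coef k * \<bar>sym_coef k - sym_coef (k - 2)\<bar>)"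

lemma coupling_nonneg: "coupling k \<ge> 0"
  by (simp add: coupling_def d_coef_nonneg)

text \<open>
  For \<open>k \<ge> 6\<close> both diagonal entries lie in \<open>[1/2, 1/2 + 2 / k\<^sup>2]\<close>, which beats the linear growth of
  \<open>d_coef k\<close>. The largest coupling is that of the modes 1 and 3, about \<open>0.153\<close>.
\<close>

lemma coupling_le: "coupling k \<le> 1 / 6"
proof -
  consider "k < 3" | "k = 3" | "k = 4" | "k = 5" | "k \<ge> 6" by linarith
  then show ?thesis
  proof cases
    case 5
    have "\<bar>sym_coef k - sym_coef (k - 2)\<bar> \<le> 2 / (real k)^2"
    proof -
      have "real (k - 2) + 2 = real k" using 5 by (simp add: of_nat_diff)
      moreover have "2 / (real k + 2)^2 \<le> 2 / (real k)^2"
        using 5 by (intro divide_left_mono power_mono mult_pos_pos) auto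
      moreover have k4: "4 \<le> k" "4 \<le> k - 2" using 5 by auto
      ultimately have "1 / 2 \<le> sym_coef k" "sym_coef k \<le> 1 / 2 + 2 / (real k)^2"
        "1 / 2 \<le> sym_coef (k - 2)" "sym_coef (k - 2) \<le> 1 / 2 + 2 / (real k)^2"
        using sym_coef_bounds[OF k4(1)] sym_coef_bounds[OF k4(2)] by auto
      then show ?thesis by linarith
    qed
    moreover have "d_coef k \<le> (real k + 2) / 4" using 5 by (intro d_coef_le) auto
    ultimately have "d_coef k * \<bar>sym_coef k - sym_coef (k - 2)\<bar> \<le> (real k + 2) / 4 * (2 / (real k)^2)"
      by (intro mult_mono) auto
    then have "coupling k \<le> (real k + 2) / 4 * (2 / (real k)^2)"
      using 5 by (simp only: coupling_def) simp
    also have "\<dots> \<le> 1 / 6"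
    proof -
      have k: "real k \<ge> 6" using 5 by simp
      have "6 * real k \<le> real k * real k" using k by (intro mult_right_mono) auto
      moreover have "3 * (real k + 2) \<le> 6 * real k" using k by simp
      ultimately have "3 * (real k + 2) \<le> (real k)^2" unfolding power2_eq_square by (rule order_trans[rotated])
      then show ?thesis using k by (simp add: field_simps)
    qed
    finally show ?thesis .
  qed (simp_all add: coupling_def sym_coef_eq d_coef_def power2_eq_square)
qed

lemma Q_coef_arith:
  fixes x c c' :: real
  assumes "13 / 60 \<le> x" "x \<le> 7 / 12" "0 \<le> c" "c \<le> 1 / 6" "0 \<le> c'" "c' \<le> 1 / 6"
  shows "1 / 20 \<le> x - (c + c') / 2 \<and> x + (c + c') / 2 \<le> 3 / 4"
proof
  have "(c + c') / 2 \<le> 1 / 6" using assms by simp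
  then show "1 / 20 \<le> x - (c + c') / 2" "x + (c + c') / 2 \<le> 3 / 4" using assms(1,2) by linarith+
qed

text \<open>
  Diagonal dominance. The tightest case of the lower bound is \<open>k = 2\<close>, where \<open>(3/8)\<^sup>2 - 1/12 > 1/20\<close>.
\<close>

lemma Q_coef_bounds:
  assumes "k \<ge> 1"
  shows "1 / 20 \<le> (sym_coef k)^2 - (coupling k + coupling (k + 2)) / 2"
    and "(sym_coef k)^2 + (coupling k + coupling (k + 2)) / 2 \<le> 3 / 4"
proof -
  have "1 / 20 \<le> (sym_coef k)^2 - (coupling k + coupling (k + 2)) / 2
     \<and> (sym_coef k)^2 + (coupling k + coupling (k + 2)) / 2 \<le> 3 / 4"
  proof (rule nat_ge_1_cases[OF assms])
    assume k: "k = 1"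
    have v: "coupling k = 0" "(sym_coef k)^2 = 121 / 324" unfolding k by (simp_all add: coupling_def sym_coef_small(1) power2_eq_square del: One_nat_def)
    show ?thesis unfolding v using coupling_le[of "k + 2"] coupling_nonneg[of "k + 2"] by simp
  next
    assume k: "k = 2"
    have v: "coupling k = 0" "(sym_coef k)^2 = 9 / 64" unfolding k by (simp_all add: coupling_def sym_coef_small(2) power2_eq_square)
    show ?thesis unfolding v using coupling_le[of "k + 2"] coupling_nonneg[of "k + 2"] by simp
  next
    assume k: "k = 3"
    have "(sym_coef k)^2 = (221 / 450)^2" unfolding k by (simp only: sym_coef_small)
    then show ?thesis
      by (intro Q_coef_arith coupling_nonneg coupling_le) (simp_all add: power2_eq_square)
  next
    assume k: "k \<ge> 4"
    have "(1/2)^2 \<le> (sym_coef k)^2" "(sym_coef k)^2 \<le> (3/5)^2"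
      using sym_coef_bounds(1)[OF k] sym_coef_le_3_5[OF k] by (auto intro!: power_mono)
    then have "1/4 \<le> (sym_coef k)^2" "(sym_coef k)^2 \<le> 9/25" by (simp_all add: power2_eq_square)
    then show ?thesis
      by (intro Q_coef_arith coupling_nonneg coupling_le) simp_all
  qed
  then show "1 / 20 \<le> (sym_coef k)^2 - (coupling k + coupling (k + 2)) / 2"
    "(sym_coef k)^2 + (coupling k + coupling (k + 2)) / 2 \<le> 3 / 4" by auto
qed

section \<open>Energy identities\<close>

lemma summable_inverse_Suc_square: "summable (\<lambda>k. c / (real (Suc k))^2)"
proof -
  have "summable (\<lambda>k. inverse ((real k)^2))" using inverse_power_summable[of 2, where ?'a = real] by simp
  then have "summable (\<lambda>k. inverse ((real (Suc k))^2))" by (subst summable_Suc_iff)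
  then have "summable (\<lambda>k. c * inverse ((real (Suc k))^2))" by (rule summable_mult)
  then show ?thesis by (simp only: divide_inverse)
qed

text \<open>
  The coefficients of a solution on \<open>[0, T]\<close>. Quadratic decay makes all series below, including the one
  with the linearly growing \<open>d_coef\<close>, converge uniformly.
\<close>

locale coef_evolution =
  fixes a :: "nat \<Rightarrow> real \<Rightarrow> real" and T C :: real
  assumes T: "T > 0"
    and a0: "\<And>t. a 0 t = 0"
    and evol: "\<And>k t. t \<in> {0..T} \<Longrightarrow> (a k has_real_derivative
         - (d_coef k * a (k - 2) t + sym_coef k * a k t - d_coef (k + 2) * a (k + 2) t)) (at t within {0..T})"
    and decay: "\<And>k t. t \<in> {0..T} \<Longrightarrow> \<bar>a k t\<bar> \<le> C / (real (Suc k))^2"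
begin

lemma C_nonneg: "C \<ge> 0"
  using decay[of 0 0] T by simp

text \<open>
  The flow of energy from mode \<open>k\<close> to mode \<open>k - 2\<close> caused by the antisymmetric part; its contributions
  to \<open>(a\<^sub>k)\<^sup>2\<close> and \<open>(a\<^bsub>k-2\<^esub>)\<^sup>2\<close> cancel.
\<close>

definition flux :: "nat \<Rightarrow> real \<Rightarrow> real" where
  "flux k t = d_coef k * a (k - 2) t * a k t"

lemma flux_0:
  assumes "k < 3" shows "flux k t = 0"
proof -
  consider "k = 0" | "k = 1" | "k = 2" using assms by linarith
  then show ?thesis by cases (auto simp: flux_def a0)
qed

lemma decay_sq: assumes "t \<in> {0..T}" shows "(a k t)^2 \<le> C^2 / (real (Suc k))^2"
proof -
  have "(a k t)^2 \<le> (C / (real (Suc k))^2)^2"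
    using power_mono[OF decay[OF assms, of k], of 2] by simp
  also have "\<dots> = C^2 / ((real (Suc k))^2 * (real (Suc k))^2)" by (simp add: power_divide power2_eq_square)
  also have "\<dots> \<le> C^2 / ((real (Suc k))^2 * 1)"
    by (intro divide_left_mono mult_left_mono mult_pos_pos) auto
  finally show ?thesis by simp
qed

text \<open>
  The factor 9 comes from \<open>n - 2 \<ge> n / 3\<close>, which compares the decay of the modes \<open>k - 2\<close> and \<open>k\<close>.
\<close>

lemma flux_bound: assumes t: "t \<in> {0..T}" shows "\<bar>flux k t\<bar> \<le> 9 * C^2 / (real (Suc k))^2"
proof (cases "k < 3")
  case True then show ?thesis using flux_0[OF True, of t] by simp
next
  case False
  define n where "n = real (Suc k)"
  have n: "n \<ge> 4" using False by (simp add: n_def)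
  have e: "real (Suc (k - 2)) = n - 2" using False by (simp add: n_def of_nat_diff)
  have "\<bar>a (k - 2) t\<bar> \<le> C / (n - 2)^2" using decay[OF t, of "k - 2"] unfolding e .
  also have "\<dots> \<le> C / (n / 3)^2"
    using n C_nonneg by (intro divide_left_mono power_mono mult_pos_pos) auto
  also have "\<dots> = 9 * C / n^2" by (simp add: power_divide)
  finally have "\<bar>a (k - 2) t\<bar> \<le> 9 * C / n^2" .
  moreover have "\<bar>a k t\<bar> \<le> C / n^2" using decay[OF t, of k] by (simp add: n_def)
  moreover have "\<bar>d_coef k\<bar> \<le> n" using d_coef_le_Suc[of k] d_coef_nonneg[of k] by (simp add: n_def)
  ultimately have "\<bar>flux k t\<bar> \<le> n * (9 * C / n^2) * (C / n^2)"
    unfolding flux_def abs_mult using n C_nonneg by (intro mult_mono) auto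
  also have "\<dots> = 9 * C^2 / (n^2 * n)" using n by (simp add: power2_eq_square)
  also have "\<dots> \<le> 9 * C^2 / (n^2 * 1)" using n by (intro divide_left_mono mult_left_mono) auto
  finally show ?thesis by (simp add: n_def)
qed

lemma summable_weighted_sq:
  assumes "t \<in> {0..T}" "\<And>k. \<bar>g k\<bar> \<le> B"
  shows "summable (\<lambda>k. g k * (a k t)^2)"
proof (rule summable_comparison_test'[OF summable_inverse_Suc_square[of "B * C^2"], of 0])
  fix k
  have "\<bar>g k\<bar> * (a k t)^2 \<le> B * (C^2 / (real (Suc k))^2)"
    using assms(2)[of k] decay_sq[OF assms(1), of k] by (intro mult_mono) auto
  then show "norm (g k * (a k t)^2) \<le> B * C^2 / (real (Suc k))^2" by (simp add: abs_mult)
qed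

lemma summable_weighted_flux:
  assumes "t \<in> {0..T}" "\<And>k. \<bar>g k\<bar> \<le> B"
  shows "summable (\<lambda>k. g k * flux k t)"
proof (rule summable_comparison_test'[OF summable_inverse_Suc_square[of "B * (9 * C^2)"], of 0])
  fix k
  have "\<bar>g k\<bar> * \<bar>flux k t\<bar> \<le> B * (9 * C^2 / (real (Suc k))^2)"
    using assms(2)[of k] flux_bound[OF assms(1), of k] by (intro mult_mono) auto
  then show "norm (g k * flux k t) \<le> B * (9 * C^2) / (real (Suc k))^2" by (simp add: abs_mult)
qed

text \<open>
  Termwise differentiation of a weighted energy. The index shift by two moves the flux terms onto
  differences of weights, so that for constant weights only the diagonal part contributes.
\<close>

lemma weighted_energy_deriv:
  assumes g: "\<And>k. \<bar>g k\<bar> \<le> B" and t: "t \<in> {0..T}"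
  shows "((\<lambda>t. \<Sum>k. g k * (a k t)^2) has_real_derivative
     - 2 * (\<Sum>k. g k * sym_coef k * (a k t)^2) - 2 * (\<Sum>k. (g k - g (k - 2)) * flux k t)) (at t within {0..T})"
proof -
  have B: "B \<ge> 0" using g[of 0] by linarith
  define f' where "f' k t = - 2 * g k * (sym_coef k * (a k t)^2 + flux k t - flux (k + 2) t)" for k t
  have D: "sym_coef k * (a k t)^2 \<le> (a k t)^2 \<and> - ((a k t)^2) \<le> sym_coef k * (a k t)^2" for k t
  proof (cases "k = 0")
    case False
    then have "\<bar>sym_coef k\<bar> \<le> 1" by (intro abs_sym_coef_le_1) auto
    then have "\<bar>sym_coef k\<bar> * (a k t)^2 \<le> 1 * (a k t)^2" by (intro mult_right_mono) auto
    then have "\<bar>sym_coef k * (a k t)^2\<bar> \<le> (a k t)^2" by (simp add: abs_mult)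
    then show ?thesis by linarith
  qed (simp add: a0)
  have der: "((\<lambda>t. g k * (a k t)^2) has_real_derivative f' k t) (at t within {0..T})" if "t \<in> {0..T}" for k t
    by (rule derivative_eq_intros evol that refl)+ (simp add: f'_def flux_def algebra_simps power2_eq_square)
  have unif: "uniform_limit {0..T} (\<lambda>n t. \<Sum>i<n. f' i t) (\<lambda>t. \<Sum>i. f' i t) sequentially"
  proof (rule Weierstrass_m_test[OF _ summable_inverse_Suc_square[of "38 * B * C^2"]])
    fix k t assume t: "t \<in> {0..T}"
    have "9 * C^2 / (real (Suc (k + 2)))^2 \<le> 9 * C^2 / (real (Suc k))^2"
      by (intro divide_left_mono power_mono mult_pos_pos) auto
    then have "\<bar>sym_coef k * (a k t)^2 + flux k t - flux (k + 2) t\<bar>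
        \<le> C^2 / (real (Suc k))^2 + 9 * C^2 / (real (Suc k))^2 + 9 * C^2 / (real (Suc k))^2"
      using D[of k t] decay_sq[OF t, of k] flux_bound[OF t, of k] flux_bound[OF t, of "k + 2"] by linarith
    also have "\<dots> = 19 * C^2 / (real (Suc k))^2" by (simp add: add_divide_distrib[symmetric])
    finally have "2 * \<bar>g k\<bar> * \<bar>sym_coef k * (a k t)^2 + flux k t - flux (k + 2) t\<bar> \<le> 2 * B * (19 * C^2 / (real (Suc k))^2)"
      using g[of k] B by (intro mult_mono) auto
    then show "norm (f' k t) \<le> 38 * B * C^2 / (real (Suc k))^2" by (simp add: f'_def abs_mult)
  qed
  obtain G where G: "\<And>t. t \<in> {0..T} \<Longrightarrow> (\<lambda>k. g k * (a k t)^2) sums G t"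
    "\<And>t. t \<in> {0..T} \<Longrightarrow> (G has_real_derivative (\<Sum>i. f' i t)) (at t within {0..T})"
  proof -
    have z: "0 \<in> {0..T}" using T by simp
    show ?thesis
      using has_field_derivative_series[OF convex_real_interval(5) der unif z summable_weighted_sq[OF z g]] that
      by blast
  qed
  have "((\<lambda>t. \<Sum>k. g k * (a k t)^2) has_real_derivative (\<Sum>i. f' i t)) (at t within {0..T})"
    by (rule has_field_derivative_transform_within[OF G(2)[OF t] zero_less_one t]) (use G(1) in \<open>simp add: sums_iff\<close>)
  moreover have "(\<Sum>i. f' i t) = - 2 * (\<Sum>k. g k * sym_coef k * (a k t)^2) - 2 * (\<Sum>k. (g k - g (k - 2)) * flux k t)"
  proof -
    have s1: "summable (\<lambda>k. g k * sym_coef k * (a k t)^2)"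
    proof -
      have "\<bar>g k * sym_coef k\<bar> \<le> B * 1" for k
        unfolding abs_mult using g[of k] B abs_sym_coef_le[of k] by (intro mult_mono) auto
      then show ?thesis by (rule summable_weighted_sq[OF t])
    qed
    have s2: "summable (\<lambda>k. g k * flux k t)" by (rule summable_weighted_flux[OF t g])
    have s3: "summable (\<lambda>k. g (k - 2) * flux k t)" by (rule summable_weighted_flux[OF t g])
    then have s4: "summable (\<lambda>k. g k * flux (k + 2) t)"
      using summable_iff_shift[of "\<lambda>k. g (k - 2) * flux k t" 2] by simp
    have e: "(\<Sum>k. g k * flux (k + 2) t) = (\<Sum>k. g (k - 2) * flux k t)"
      using suminf_split_initial_segment[OF s3, of 2] flux_0[of 0 t] flux_0[of 1 t]
      by (simp add: numeral_2_eq_2)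
    have "(\<Sum>i. f' i t) = (\<Sum>k. (- 2) * (g k * sym_coef k * (a k t)^2 + g k * flux k t - g k * flux (k + 2) t))"
      unfolding f'_def by (simp add: algebra_simps)
    also have "\<dots> = (- 2) * (\<Sum>k. g k * sym_coef k * (a k t)^2 + g k * flux k t - g k * flux (k + 2) t)"
      by (intro suminf_mult summable_diff summable_add s1 s2 s4)
    also have "(\<Sum>k. g k * sym_coef k * (a k t)^2 + g k * flux k t - g k * flux (k + 2) t)
        = (\<Sum>k. g k * sym_coef k * (a k t)^2) + (\<Sum>k. g k * flux k t) - (\<Sum>k. g (k - 2) * flux k t)"
      unfolding e[symmetric] by (simp only: suminf_add[OF s1 s2] suminf_diff[OF summable_add[OF s1 s2] s4])
    finally show ?thesis
      using suminf_diff[OF s2 s3] by (simp add: left_diff_distrib)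
  qed
  ultimately show ?thesis by simp
qed

definition energy :: "real \<Rightarrow> real" where "energy t = (\<Sum>k. (a k t)^2)"
definition power_input :: "real \<Rightarrow> real" where "power_input t = - 2 * (\<Sum>k. sym_coef k * (a k t)^2)"
definition Q_form :: "real \<Rightarrow> real" where
  "Q_form t = (\<Sum>k. (sym_coef k)^2 * (a k t)^2) + (\<Sum>k. (sym_coef k - sym_coef (k - 2)) * flux k t)"

lemma energy_deriv:
  assumes "t \<in> {0..T}"
  shows "(energy has_real_derivative power_input t) (at t within {0..T})"
  using weighted_energy_deriv[OF _ assms, of "\<lambda>_. 1" 1] by (simp add: energy_def[abs_def] power_input_def)

text \<open>
  The weights are now the diagonal entries themselves; their differences produce the commutator of
  \<open>D\<close> and \<open>A\<close>.
\<close>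

lemma power_input_deriv:
  assumes "t \<in> {0..T}"
  shows "(power_input has_real_derivative 4 * Q_form t) (at t within {0..T})"
proof -
  have "((\<lambda>t. - 2 * (\<Sum>k. sym_coef k * (a k t)^2)) has_real_derivative
    - 2 * (- 2 * (\<Sum>k. sym_coef k * sym_coef k * (a k t)^2) - 2 * (\<Sum>k. (sym_coef k - sym_coef (k - 2)) * flux k t)))
     (at t within {0..T})"
    by (intro DERIV_cmult weighted_energy_deriv[of sym_coef 1] abs_sym_coef_le assms)
  then show ?thesis by (simp add: power_input_def[abs_def] Q_form_def power2_eq_square algebra_simps)
qed

text \<open>
  Each coupling term is split by \<open>2 \<bar>a\<^bsub>k-2\<^esub> a\<^sub>k\<bar> \<le> (a\<^bsub>k-2\<^esub>)\<^sup>2 + (a\<^sub>k)\<^sup>2\<close> and charged to the two diagonal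
  entries, after which the bounds hold mode by mode.
\<close>

lemma Q_form_bounds:
  assumes t: "t \<in> {0..T}"
  shows "energy t / 20 \<le> Q_form t" "Q_form t \<le> 3 / 4 * energy t"
proof -
  define y where "y k = (a k t)^2" for k
  define X where "X k = (sym_coef k - sym_coef (k - 2)) * flux k t" for k
  have cb: "\<bar>coupling k\<bar> \<le> 1 / 6" "\<bar>coupling (k + 2)\<bar> \<le> 1 / 6" "\<bar>(sym_coef k)^2\<bar> \<le> 1" for k
    using coupling_le[of k] coupling_nonneg[of k] coupling_le[of "k+2"] coupling_nonneg[of "k+2"] abs_sym_coef_le[of k]
    by (auto simp: abs_square_le_1)
  have sy: "summable y" using summable_weighted_sq[OF t, of "\<lambda>_. 1" 1] by (simp add: y_def[abs_def])
  have sD: "summable (\<lambda>k. (sym_coef k)^2 * y k)" unfolding y_def by (rule summable_weighted_sq[OF t cb(3)])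
  have sc: "summable (\<lambda>k. coupling k * y k)" unfolding y_def by (rule summable_weighted_sq[OF t cb(1)])
  have sc2: "summable (\<lambda>k. coupling (k + 2) * y k)" unfolding y_def by (rule summable_weighted_sq[OF t cb(2)])
  have "\<bar>sym_coef k - sym_coef (k - 2)\<bar> \<le> 2" for k
    using abs_sym_coef_le[of k] abs_sym_coef_le[of "k - 2"] by linarith
  then have sX: "summable X" unfolding X_def by (rule summable_weighted_flux[OF t])
  have sc': "summable (\<lambda>k. coupling k * y (k - 2))"
    using sc2 summable_iff_shift[of "\<lambda>k. coupling k * y (k - 2)" 2] by simp
  have shift: "(\<Sum>k. coupling k * y (k - 2)) = (\<Sum>k. coupling (k + 2) * y k)"
    using suminf_split_initial_segment[OF sc', of 2] by (simp add: numeral_2_eq_2 coupling_def)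
  have Xb: "\<bar>X k\<bar> \<le> (coupling k * y k + coupling k * y (k - 2)) / 2" for k
  proof (cases "k < 3")
    case True then show ?thesis by (simp add: X_def flux_0 coupling_def)
  next
    case False
    have "\<bar>X k\<bar> = coupling k * (\<bar>a (k - 2) t\<bar> * \<bar>a k t\<bar>)"
      using False by (simp add: X_def coupling_def flux_def abs_mult d_coef_nonneg mult_ac)
    also have "\<dots> \<le> coupling k * ((y k + y (k - 2)) / 2)"
      using sum_squares_bound[of "\<bar>a (k - 2) t\<bar>" "\<bar>a k t\<bar>"]
      by (intro mult_left_mono coupling_nonneg) (auto simp: y_def)
    finally show ?thesis by (simp add: algebra_simps)
  qed
  have Xle: "X k \<le> (coupling k * y k + coupling k * y (k - 2)) / 2"
    "- X k \<le> (coupling k * y k + coupling k * y (k - 2)) / 2" for k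
    using Xb[of k] by linarith+
  have sum_eq: "(\<Sum>k. (coupling k * y k + coupling k * y (k - 2)) / 2)
      = (\<Sum>k. (coupling k + coupling (k + 2)) / 2 * y k)"
  proof -
    have "(\<Sum>k. (coupling k * y k + coupling k * y (k - 2)) / 2) = ((\<Sum>k. coupling k * y k) + (\<Sum>k. coupling k * y (k - 2))) / 2"
      by (simp only: suminf_add[OF sc sc'] suminf_divide[OF summable_add[OF sc sc']])
    also have "\<dots> = ((\<Sum>k. coupling k * y k) + (\<Sum>k. coupling (k + 2) * y k)) / 2" unfolding shift ..
    also have "\<dots> = (\<Sum>k. (coupling k * y k + coupling (k + 2) * y k) / 2)"
      by (simp only: suminf_add[OF sc sc2] suminf_divide[OF summable_add[OF sc sc2]])
    finally show ?thesis by (simp add: algebra_simps)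
  qed
  have sB: "summable (\<lambda>k. (coupling k * y k + coupling k * y (k - 2)) / 2)"
    by (intro summable_divide summable_add sc sc')
  have sB': "summable (\<lambda>k. (coupling k + coupling (k + 2)) / 2 * y k)"
  proof -
    have "summable (\<lambda>k. (coupling k * y k + coupling (k + 2) * y k) / 2)" by (intro summable_divide summable_add sc sc2)
    then show ?thesis by (simp add: algebra_simps)
  qed
  have up: "(\<Sum>k. X k) \<le> (\<Sum>k. (coupling k + coupling (k + 2)) / 2 * y k)"
    unfolding sum_eq[symmetric] by (intro suminf_le sX sB Xle)
  have "(\<Sum>k. - X k) \<le> (\<Sum>k. (coupling k + coupling (k + 2)) / 2 * y k)"
    unfolding sum_eq[symmetric] by (intro suminf_le summable_minus sX sB Xle)
  then have lo: "- (\<Sum>k. (coupling k + coupling (k + 2)) / 2 * y k) \<le> (\<Sum>k. X k)"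
    by (simp add: suminf_minus[OF sX])
  have Q: "Q_form t = (\<Sum>k. (sym_coef k)^2 * y k) + (\<Sum>k. X k)" by (simp add: Q_form_def y_def X_def)
  have y0: "y 0 = 0" "y k \<ge> 0" for k by (simp_all add: y_def a0)
  have "energy t / 20 = (\<Sum>k. y k / 20)" unfolding energy_def y_def[symmetric] by (rule suminf_divide[OF sy, symmetric])
  also have "\<dots> \<le> (\<Sum>k. (sym_coef k)^2 * y k - (coupling k + coupling (k + 2)) / 2 * y k)"
  proof (rule suminf_le)
    fix k
    show "y k / 20 \<le> (sym_coef k)^2 * y k - (coupling k + coupling (k + 2)) / 2 * y k"
    proof (cases "k = 0")
      case False
      then have "1 / 20 * y k \<le> ((sym_coef k)^2 - (coupling k + coupling (k + 2)) / 2) * y k"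
        by (intro mult_right_mono Q_coef_bounds(1) y0) auto
      then show ?thesis by (simp add: left_diff_distrib)
    qed (simp add: y0)
  qed (intro summable_divide summable_diff sy sD sB')+
  also have "\<dots> = (\<Sum>k. (sym_coef k)^2 * y k) - (\<Sum>k. (coupling k + coupling (k + 2)) / 2 * y k)"
    by (rule suminf_diff[OF sD sB', symmetric])
  finally show "energy t / 20 \<le> Q_form t" unfolding Q using lo by linarith
  have "(\<Sum>k. (sym_coef k)^2 * y k) + (\<Sum>k. (coupling k + coupling (k + 2)) / 2 * y k)
      = (\<Sum>k. (sym_coef k)^2 * y k + (coupling k + coupling (k + 2)) / 2 * y k)"
    by (rule suminf_add[OF sD sB'])
  also have "\<dots> \<le> (\<Sum>k. 3 / 4 * y k)"
  proof (rule suminf_le)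
    fix k
    show "(sym_coef k)^2 * y k + (coupling k + coupling (k + 2)) / 2 * y k \<le> 3 / 4 * y k"
    proof (cases "k = 0")
      case False
      then have "((sym_coef k)^2 + (coupling k + coupling (k + 2)) / 2) * y k \<le> 3 / 4 * y k"
        by (intro mult_right_mono Q_coef_bounds(2) y0) auto
      then show ?thesis by (simp add: distrib_right)
    qed (simp add: y0)
  qed (intro summable_mult summable_add sy sD sB')+
  also have "\<dots> = 3 / 4 * energy t" unfolding energy_def y_def[symmetric] by (rule suminf_mult[OF sy])
  finally show "Q_form t \<le> 3 / 4 * energy t" unfolding Q using up by linarith
qed

lemma energy_nonneg: "t \<in> {0..T} \<Longrightarrow> energy t \<ge> 0"
  unfolding energy_def using summable_weighted_sq[of t "\<lambda>_. 1" 1] by (intro suminf_nonneg) auto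

end

section \<open>Comparison with the exponential bounds\<close>

text \<open>
  The operator \<open>\<partial>\<^sup>2 - \<mu>\<^sup>2\<close> factors as \<open>(\<partial> - \<mu>) (\<partial> + \<mu>)\<close>; each factor is integrated with its exponential.
\<close>

lemma second_order_comparison:
  fixes f g h :: "real \<Rightarrow> real"
  assumes T: "T > 0" and \<mu>: "\<mu> \<ge> 0"
    and f: "\<And>t. t \<in> {0..T} \<Longrightarrow> (f has_real_derivative g t) (at t within {0..T})"
    and g: "\<And>t. t \<in> {0..T} \<Longrightarrow> (g has_real_derivative h t) (at t within {0..T})"
    and f0: "f 0 \<ge> 0" and g0: "g 0 + \<mu> * f 0 \<ge> 0"
    and h: "\<And>t. 0 < t \<Longrightarrow> t < T \<Longrightarrow> \<mu>^2 * f t < h t"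
  shows "f T > 0"
proof -
  have fi: "(f has_real_derivative g t) (at t)" and gi: "(g has_real_derivative h t) (at t)" if "0 < t" "t < T" for t
    using f[of t] g[of t] that by (simp_all add: at_within_Icc_at)
  have fc: "continuous_on {0..T} f" and gc: "continuous_on {0..T} g"
    by (rule DERIV_continuous_on[OF f], assumption) (rule DERIV_continuous_on[OF g], assumption)
  \<comment> \<open>strictly increasing, with derivative \<open>exp (- \<mu> t) (h - \<mu>\<^sup>2 f)\<close>\<close>
  define p where "p t = exp (- \<mu> * t) * (g t + \<mu> * f t)" for t
  have p_pos: "p t > 0" if t: "0 < t" "t \<le> T" for t
  proof -
    have "p 0 < p t"
    proof (rule DERIV_pos_imp_increasing_open[OF t(1)])
      fix x assume x: "0 < x" "x < t"
      have "(p has_real_derivative exp (- \<mu> * x) * (h x - \<mu>^2 * f x)) (at x)"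
        unfolding p_def using x t
        by (auto intro!: derivative_eq_intros fi gi simp: algebra_simps power2_eq_square)
      moreover have "exp (- \<mu> * x) * (h x - \<mu>^2 * f x) > 0" using h[of x] x t by simp
      ultimately show "\<exists>y. (p has_real_derivative y) (at x) \<and> y > 0" by blast
    next
      show "continuous_on {0..t} p" unfolding p_def
        using t by (intro continuous_intros continuous_on_subset[OF fc] continuous_on_subset[OF gc]) auto
    qed
    then show ?thesis using g0 by (simp add: p_def)
  qed
  define q where "q t = exp (\<mu> * t) * f t" for t
  have "q 0 < q T"
  proof (rule DERIV_pos_imp_increasing_open[OF T])
    fix x assume x: "0 < x" "x < T"
    have "(q has_real_derivative exp (\<mu> * x) * (g x + \<mu> * f x)) (at x)"
      unfolding q_def using x by (auto intro!: derivative_eq_intros fi simp: algebra_simps)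
    moreover have "g x + \<mu> * f x > 0" using p_pos[of x] x by (simp add: p_def zero_less_mult_iff)
    ultimately show "\<exists>y. (q has_real_derivative y) (at x) \<and> y > 0" by (metis exp_gt_zero mult_pos_pos)
  next
    show "continuous_on {0..T} q" unfolding q_def by (intro continuous_intros fc)
  qed
  then have "0 < exp (\<mu> * T) * f T" using f0 by (simp add: q_def)
  then show ?thesis by (simp add: zero_less_mult_iff)
qed

lemma dw_coef_uminus: "dw_coef (\<lambda>x. - f x) k = - dw_coef f k"
proof -
  have s: "sin_coef (\<lambda>x. - f x) j = - sin_coef f j" for j
    using set_integral_mult_right[of lebesgue "{-pi..pi}" "-1" "\<lambda>x. f x * sin (real j * x)"]
    by (simp add: sin_coef_def)
  show ?thesis
    by (induction k rule: dw_coef.induct[of "\<lambda>_ k. dw_coef (\<lambda>x. - f x) k = - dw_coef f k" f]) (simp_all add: s)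
qed

definition J_deriv :: "real \<Rightarrow> (real \<Rightarrow> real) \<Rightarrow> real \<Rightarrow> real" where
  "J_deriv lam \<eta>0 t =
     (sqrt lam * inner_rho \<eta>0 \<eta>0 + inner_rho (\<lambda>\<theta>. - L_op \<eta>0 \<theta>) \<eta>0) * exp (2 * sqrt lam * t)
     - (sqrt lam * inner_rho \<eta>0 \<eta>0 - inner_rho (\<lambda>\<theta>. - L_op \<eta>0 \<theta>) \<eta>0) * exp (- 2 * sqrt lam * t)"

lemma J_fun_deriv:
  assumes "lam > 0"
  shows "(J_fun lam \<eta>0 has_real_derivative J_deriv lam \<eta>0 t) (at t within S)"
    and "(J_deriv lam \<eta>0 has_real_derivative 4 * lam * J_fun lam \<eta>0 t) (at t within S)"
proof -
  define s where "s = sqrt lam"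
  have s: "s > 0" "lam = s * s" using assms by (auto simp: s_def)
  show "(J_fun lam \<eta>0 has_real_derivative J_deriv lam \<eta>0 t) (at t within S)"
    unfolding J_fun_def[abs_def] J_deriv_def s_def[symmetric] using s(1)
    by (auto intro!: derivative_eq_intros simp: field_simps)
  show "(J_deriv lam \<eta>0 has_real_derivative 4 * lam * J_fun lam \<eta>0 t) (at t within S)"
    unfolding J_fun_def[abs_def] J_deriv_def[abs_def] s_def[symmetric] unfolding s(2) using s(1)
    by (auto intro!: derivative_eq_intros simp: field_simps)
qed

lemma J_fun_0:
  assumes "lam > 0"
  shows "J_fun lam \<eta>0 0 = inner_rho \<eta>0 \<eta>0" "J_deriv lam \<eta>0 0 = 2 * inner_rho (\<lambda>x. - L_op \<eta>0 x) \<eta>0"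
  using assms by (simp_all add: J_fun_def J_deriv_def field_simps)

lemma J_fun_pos:
  assumes "lam > 0" "inner_rho \<eta>0 \<eta>0 > 0" "inner_rho (\<lambda>y. - L_op \<eta>0 y) \<eta>0 \<ge> 0" "t \<ge> 0"
  shows "J_fun lam \<eta>0 t > 0"
proof -
  define E where "E = inner_rho \<eta>0 \<eta>0"
  define P where "P = 1 / sqrt lam * inner_rho (\<lambda>y. - L_op \<eta>0 y) \<eta>0"
  define x where "x = 2 * sqrt lam * t"
  have "E > 0" "P \<ge> 0" "x \<ge> 0" using assms by (auto simp: E_def P_def x_def)
  have "J_fun lam \<eta>0 t = E * ((exp x + exp (- x)) / 2) + P * ((exp x - exp (- x)) / 2)"
    unfolding J_fun_def E_def[symmetric] P_def[symmetric] x_def by (simp add: field_simps)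
  moreover have "E * ((exp x + exp (- x)) / 2) > 0" using \<open>E > 0\<close> by (intro mult_pos_pos) (auto intro!: add_pos_pos)
  moreover have "P * ((exp x - exp (- x)) / 2) \<ge> 0" using \<open>P \<ge> 0\<close> \<open>x \<ge> 0\<close> by (intro mult_nonneg_nonneg) auto
  ultimately show ?thesis by linarith
qed

context coef_evolution
begin

text \<open>
  The energy is convex because the form \<open>Q\<close> is nonnegative, and its slope at time 0 is nonnegative.
\<close>

lemma energy_mono:
  assumes p: "power_input 0 \<ge> 0" and t: "t \<in> {0..T}"
  shows "energy 0 \<le> energy t"
proof -
  have ei: "(energy has_real_derivative power_input x) (at x)"
    and pi: "(power_input has_real_derivative 4 * Q_form x) (at x)" if "0 < x" "x < T" for x
    using energy_deriv[of x] power_input_deriv[of x] that by (simp_all add: at_within_Icc_at)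
  have c: "continuous_on {0..x} energy" "continuous_on {0..x} power_input" if "x \<le> T" for x
    using that continuous_on_subset[OF DERIV_continuous_on[OF energy_deriv]]
      continuous_on_subset[OF DERIV_continuous_on[OF power_input_deriv]] by auto
  have "power_input x \<ge> 0" if x: "0 < x" "x < T" for x
  proof -
    have "power_input 0 \<le> power_input x"
    proof (rule DERIV_nonneg_imp_increasing_open[of 0 x power_input])
      fix y assume y: "0 < y" "y < x"
      have "Q_form y \<ge> 0" using Q_form_bounds(1)[of y] energy_nonneg[of y] x y by auto
      then show "\<exists>z. (power_input has_real_derivative z) (at y) \<and> z \<ge> 0"
        using pi[of y] x y by (intro exI[of _ "4 * Q_form y"]) auto
    qed (use x c in auto)
    then show ?thesis using p by linarith
  qed
  note pw = this
  show ?thesis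
  proof (rule DERIV_nonneg_imp_increasing_open[of 0 t energy])
    fix x assume "0 < x" "x < t"
    then have "0 < x" "x < T" using t by auto
    then show "\<exists>z. (energy has_real_derivative z) (at x) \<and> z \<ge> 0" using ei pw by blast
  qed (use t c in auto)
qed

text \<open>
  With \<open>E'' = 4 Q\<close>, \<open>E / 20 \<le> Q \<le> 3 E / 4\<close> and \<open>E > 0\<close> one has \<open>4 E / 25 < E'' < 4 E\<close>, while \<open>J\<close> with parameter
  \<open>\<lambda>\<close> solves \<open>J'' = 4 \<lambda> J\<close> with the initial values of \<open>E\<close>.
\<close>

lemma energy_between:
  assumes E0: "energy 0 = inner_rho \<eta>0 \<eta>0" and E0_pos: "energy 0 > 0"
    and P0: "power_input 0 = 2 * inner_rho (\<lambda>x. - L_op \<eta>0 x) \<eta>0" and P0_nonneg: "power_input 0 \<ge> 0"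
  shows "J_fun (1 / 25) \<eta>0 T < energy T" "energy T < J_fun 1 \<eta>0 T"
proof -
  have pos: "energy t > 0" if "t \<in> {0..T}" for t
    using energy_mono[OF P0_nonneg that] E0_pos by linarith
  have "0 < energy T - J_fun (1 / 25) \<eta>0 T"
  proof (rule second_order_comparison[OF T, where \<mu> = "2 / 5" and g = "\<lambda>t. power_input t - J_deriv (1 / 25) \<eta>0 t"
        and h = "\<lambda>t. 4 * Q_form t - 4 * (1 / 25) * J_fun (1 / 25) \<eta>0 t"])
    fix t assume t: "t \<in> {0..T}"
    show "((\<lambda>t. energy t - J_fun (1 / 25) \<eta>0 t) has_real_derivative power_input t - J_deriv (1 / 25) \<eta>0 t) (at t within {0..T})"
      by (intro DERIV_diff energy_deriv t J_fun_deriv) simp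
    show "((\<lambda>t. power_input t - J_deriv (1 / 25) \<eta>0 t) has_real_derivative 4 * Q_form t - 4 * (1 / 25) * J_fun (1 / 25) \<eta>0 t) (at t within {0..T})"
      by (intro DERIV_diff power_input_deriv t J_fun_deriv) simp
  next
    fix t assume t: "0 < t" "t < T"
    show "(2 / 5)^2 * (energy t - J_fun (1 / 25) \<eta>0 t) < 4 * Q_form t - 4 * (1 / 25) * J_fun (1 / 25) \<eta>0 t"
      using Q_form_bounds(1)[of t] pos[of t] t by (simp add: power2_eq_square algebra_simps)
  qed (simp_all add: J_fun_0 E0 P0)
  then show "J_fun (1 / 25) \<eta>0 T < energy T" by simp
  have "0 < J_fun 1 \<eta>0 T - energy T"
  proof (rule second_order_comparison[OF T, where \<mu> = 2 and g = "\<lambda>t. J_deriv 1 \<eta>0 t - power_input t"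
        and h = "\<lambda>t. 4 * 1 * J_fun 1 \<eta>0 t - 4 * Q_form t"])
    fix t assume t: "t \<in> {0..T}"
    show "((\<lambda>t. J_fun 1 \<eta>0 t - energy t) has_real_derivative J_deriv 1 \<eta>0 t - power_input t) (at t within {0..T})"
      by (intro DERIV_diff energy_deriv t J_fun_deriv) simp
    show "((\<lambda>t. J_deriv 1 \<eta>0 t - power_input t) has_real_derivative 4 * 1 * J_fun 1 \<eta>0 t - 4 * Q_form t) (at t within {0..T})"
      by (intro DERIV_diff power_input_deriv t J_fun_deriv) simp
  next
    fix t assume t: "0 < t" "t < T"
    show "2^2 * (J_fun 1 \<eta>0 t - energy t) < 4 * 1 * J_fun 1 \<eta>0 t - 4 * Q_form t"
      using Q_form_bounds(2)[of t] pos[of t] t by (simp add: power2_eq_square algebra_simps)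
  qed (simp_all add: J_fun_0 E0 P0)
  then show "energy T < J_fun 1 \<eta>0 T" by simp
qed

end

text \<open>
  The antisymmetric part of \<open>L\<close> drops out. For \<open>k = 3\<close> the two modes are coupled and their mixed terms
  cancel against each other.
\<close>

lemma two_modes_power:
  assumes k: "k \<ge> 2" and \<eta>0: "\<eta>0 = (\<lambda>y. a1 * e_odd 1 y + ak * e_odd k y)"
    and p: "torus_periodic \<eta>0" and d: "\<And>x. (\<eta>0 has_real_derivative \<eta>0' x) (at x)"
    and c: "continuous_on UNIV \<eta>0'" and v: "is_velocity \<eta>0 v"
  shows "inner_rho (\<lambda>y. - L_op \<eta>0 y) \<eta>0 = - (sym_coef 1 * a1^2 + sym_coef k * ak^2)"
proof -
  \<comment> \<open>for \<open>k = 3\<close> two contributions share the frequency 3\<close>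
  define J where "J = {1, 3, k, k + 2}"
  define c where "c j = (if j = 1 then - a1 else 0) + (if j = 3 then a1 / 3 else 0)
     + (if j = k then - ak / real k else 0) + (if j = k + 2 then ak / real (k + 2) else 0)" for j
  have J: "finite J" "0 \<notin> J" using k by (auto simp: J_def)
  have "\<eta>0 = (\<lambda>x. \<Sum>j\<in>J. c j * sin (real j * x))"
  proof
    fix x
    have "(\<Sum>j\<in>J. c j * sin (real j * x)) = (\<Sum>j\<in>J. (if j = 1 then - a1 * sin (real j * x) else 0))
       + (\<Sum>j\<in>J. (if j = 3 then a1 / 3 * sin (real j * x) else 0))
       + (\<Sum>j\<in>J. (if j = k then - ak / real k * sin (real j * x) else 0))
       + (\<Sum>j\<in>J. (if j = k + 2 then ak / real (k + 2) * sin (real j * x) else 0))"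
      unfolding sum.distrib[symmetric] c_def by (intro sum.cong refl) (auto simp: algebra_simps)
    also have "\<dots> = - a1 * sin (real 1 * x) + a1 / 3 * sin (real 3 * x)
       + - ak / real k * sin (real k * x) + ak / real (k + 2) * sin (real (k + 2) * x)"
      using J(1) by (subst (1 2 3 4) sum.delta) (auto simp: J_def)
    also have "\<dots> = \<eta>0 x" by (simp add: \<eta>0 e_odd_def algebra_simps)
    finally show "\<eta>0 x = (\<Sum>j\<in>J. c j * sin (real j * x))" ..
  qed
  from L_op_sine_sum_weak_deriv[OF J this] obtain g where g: "has_weak_deriv (\<lambda>y. - L_op \<eta>0 y) g" ..
  have A: "dw_coef \<eta>0 j = (if j = 1 then a1 else 0) + (if j = k then ak else 0)" for j
    unfolding \<eta>0 using k by (intro dw_coef_two_modes) auto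
  have "inner_rho (\<lambda>y. - L_op \<eta>0 y) \<eta>0 = a1 * dw_coef (\<lambda>y. - L_op \<eta>0 y) 1 + ak * dw_coef (\<lambda>y. - L_op \<eta>0 y) k"
    using inner_rho_two_modes[OF g, of k a1 ak] k unfolding \<eta>0[symmetric] by simp
  also have "\<dots> = - (a1 * (d_coef 1 * dw_coef \<eta>0 (1 - 2) + sym_coef 1 * dw_coef \<eta>0 1 - d_coef (1 + 2) * dw_coef \<eta>0 (1 + 2))
     + ak * (d_coef k * dw_coef \<eta>0 (k - 2) + sym_coef k * dw_coef \<eta>0 k - d_coef (k + 2) * dw_coef \<eta>0 (k + 2)))"
    unfolding dw_coef_uminus dw_coef_L_op[OF p d \<open>continuous_on UNIV \<eta>0'\<close> v] by (simp add: algebra_simps)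
  also have "\<dots> = - (sym_coef 1 * a1^2 + sym_coef k * ak^2)"
  proof -
    have z: "dw_coef \<eta>0 (1 - 2) = 0" "dw_coef \<eta>0 1 = a1" "dw_coef \<eta>0 k = ak" "dw_coef \<eta>0 (k + 2) = 0"
      "dw_coef \<eta>0 (1 + 2) = (if k = 3 then ak else 0)" "dw_coef \<eta>0 (k - 2) = (if k = 3 then a1 else 0)"
      unfolding A using k by auto
    show ?thesis unfolding z by (auto simp: power2_eq_square algebra_simps numeral_3_eq_3)
  qed
  finally show ?thesis .
qed

text \<open>
  Data with a single mode are included as \<open>k = 2\<close>, \<open>ak = 0\<close>. The hypothesis on \<open>ak\<close> says that the energy does
  not decrease at time 0.
\<close>

lemma two_modes_bounds:
  assumes m: "m > 3" and k: "k \<ge> 2" and \<eta>0: "\<eta>0 = (\<lambda>y. a1 * e_odd 1 y + ak * e_odd k y)"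
    and a1: "a1 \<noteq> 0" and ak: "sym_coef k * ak^2 \<le> 11 / 18 * a1^2"
    and sol: "classical_odd_solution \<eta>0 \<eta> v" and reg: "solution_regularity m \<eta>" and T: "T > 0"
  shows "0 < J_fun (1 / 25) \<eta>0 T \<and> J_fun (1 / 25) \<eta>0 T < inner_rho (\<eta> T) (\<eta> T)
    \<and> inner_rho (\<eta> T) (\<eta> T) < J_fun 1 \<eta>0 T"
proof -
  have i0: "\<eta> 0 = \<eta>0" using sol by (simp add: classical_odd_solution_def)
  have p: "torus_periodic (\<eta> s)" and o: "odd_fun (\<eta> s)" and v: "is_velocity (\<eta> s) (v s)" if "s \<ge> 0" for s
    using sol that by (auto simp: classical_odd_solution_def)
  have d: "(\<eta> s has_real_derivative deriv (\<eta> s) x) (at x)" if "s \<ge> 0" for s x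
    using sol that by (auto simp: classical_odd_solution_def DERIV_deriv_iff_field_differentiable)
  have c: "continuous_on UNIV (deriv (\<eta> s))" if "s \<ge> 0" for s
    using sol by (intro continuous_on_section[OF _ that]) (auto simp: classical_odd_solution_def)
  obtain \<eta>t where \<eta>t: "continuous_on ({0..} \<times> UNIV) (\<lambda>(t, y). \<eta>t t y)"
    "\<And>t y. t \<ge> 0 \<Longrightarrow> ((\<lambda>s. \<eta> s y) has_real_derivative \<eta>t t y) (at t within {0..})"
    "\<And>t y. t \<ge> 0 \<Longrightarrow> \<eta>t t y + L_op (\<eta> t) y = 0"
    using sol unfolding classical_odd_solution_def by blast
  have \<eta>t_eq: "\<eta>t t = (\<lambda>y. - L_op (\<eta> t) y)" if "t \<ge> 0" for t
    using \<eta>t(3)[OF that] by (simp add: fun_eq_iff eq_neg_iff_add_eq_0)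
  have cs: "continuous_on UNIV (\<eta> s)" if "s \<ge> 0" for s
    by (rule DERIV_continuous_on) (rule d[OF that, THEN DERIV_subset], simp)
  define a where "a j s = dw_coef (\<eta> s) j" for j s
  have evol: "(a j has_real_derivative
      - (d_coef j * a (j - 2) s + sym_coef j * a j s - d_coef (j + 2) * a (j + 2) s)) (at s within {0..T})"
    if s: "s \<in> {0..T}" for j s
  proof -
    have s0: "s \<ge> 0" using s by simp
    have "((\<lambda>s. dw_coef (\<eta> s) j) has_real_derivative dw_coef (\<eta>t s) j) (at s within {0..})"
      by (rule dw_coef_has_derivative[OF sin_coef_has_derivative[OF \<eta>t(1,2) cs s0]])
    then have "((\<lambda>s. dw_coef (\<eta> s) j) has_real_derivative dw_coef (\<eta>t s) j) (at s within {0..T})"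
      by (rule DERIV_subset) auto
    then show ?thesis
      unfolding \<eta>t_eq[OF s0] dw_coef_uminus dw_coef_L_op[OF p[OF s0] d[OF s0] c[OF s0] v[OF s0]]
      by (simp add: a_def[abs_def])
  qed
  define w where "w s y = rho_half y * weak_deriv (\<eta> s) y" for s y
  have path: "cont_path (sobolev m) (sobolev_norm m) T w"
    using reg T unfolding solution_regularity_def w_def[abs_def] by auto
  obtain C where C: "\<And>s j. s \<in> {0..T} \<Longrightarrow>
      (real (Suc j))^2 * \<bar>torus_int (\<lambda>y. w s y * sin (real (Suc j) * y))\<bar> \<le> C"
  proof -
    have "m \<ge> 2" "T \<ge> 0" using m T by auto
    from cont_path_sin_coef_decay[OF path this] that show ?thesis by blast
  qed
  define C' where "C' = C / sqrt pi"
  have decay: "\<bar>a j s\<bar> \<le> C' / (real (Suc j))^2" if s: "s \<in> {0..T}" for j s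
  proof -
    have s0: "s \<ge> 0" using s by simp
    note g = has_weak_deriv_weak_deriv[OF has_weak_deriv_C1[OF p[OF s0] d[OF s0] c[OF s0]]]
    have "torus_int (\<lambda>y. w s y * sin (real (Suc j) * y)) = - sqrt pi * a j s"
      unfolding w_def a_def by (rule weighted_sin_coef[OF g])
    then have "(real (Suc j))^2 * (sqrt pi * \<bar>a j s\<bar>) \<le> C"
      using C[OF s, of j] by (simp add: abs_mult)
    then show ?thesis unfolding C'_def by (simp add: field_simps del: of_nat_Suc)
  qed
  interpret coef_evolution a T C'
    by unfold_locales (use T evol decay in \<open>auto simp: a_def\<close>)
  have E: "energy s = inner_rho (\<eta> s) (\<eta> s)" if s: "s \<in> {0..T}" for s
  proof -
    have s0: "s \<ge> 0" using s by simp
    have "w s \<in> sobolev m" using path s unfolding cont_path_def by auto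
    then have "torus_integrable (w s)" by (intro L2_torus_integrable sobolev_subset_L2)
    then have wi: "torus_integrable (\<lambda>y. rho_half y * weak_deriv (\<eta> s) y)" by (simp add: w_def[abs_def])
    have "(\<lambda>j. (dw_coef (\<eta> s) j)^2) sums inner_rho (\<eta> s) (\<eta> s)"
      by (rule inner_rho_sums[OF p[OF s0] o[OF s0] d[OF s0] c[OF s0] wi summable_inverse_Suc_square[of C']])
         (use decay[OF s] in \<open>simp add: a_def\<close>)
    then show ?thesis by (simp add: energy_def a_def sums_iff)
  qed
  have A: "a j 0 = (if j = 1 then a1 else 0) + (if j = k then ak else 0)" for j
    unfolding a_def i0 \<eta>0 using k by (intro dw_coef_two_modes) auto
  have fin: "(\<Sum>j. g j * (a j 0)^2) = g 1 * a1^2 + g k * ak^2" for g :: "nat \<Rightarrow> real"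
  proof -
    have "(\<Sum>j. g j * (a j 0)^2) = (\<Sum>j\<in>{1, k}. g j * (a j 0)^2)"
      by (rule suminf_finite) (auto simp: A)
    then show ?thesis using k by (auto simp: A)
  qed
  have E0: "energy 0 = inner_rho \<eta>0 \<eta>0" using E[of 0] T by (simp add: i0)
  have E0v: "energy 0 = a1^2 + ak^2" unfolding energy_def using fin[of "\<lambda>_. 1"] by simp
  have E0_pos: "energy 0 > 0" unfolding E0v using a1 by (intro add_pos_nonneg) auto
  have Pv: "inner_rho (\<lambda>y. - L_op \<eta>0 y) \<eta>0 = - (sym_coef 1 * a1^2 + sym_coef k * ak^2)"
    by (rule two_modes_power[OF k \<eta>0, where v = "v 0" and \<eta>0' = "deriv \<eta>0"])
       (use p[of 0] d[of 0] c[of 0] v[of 0] in \<open>simp_all add: i0\<close>)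
  have P0: "power_input 0 = 2 * inner_rho (\<lambda>y. - L_op \<eta>0 y) \<eta>0"
    unfolding power_input_def fin Pv by simp
  have P0_nonneg: "power_input 0 \<ge> 0"
    unfolding P0 Pv sym_coef_small(1) using ak by simp
  have "0 < J_fun (1 / 25) \<eta>0 T"
    using E0_pos P0_nonneg T by (intro J_fun_pos) (auto simp: E0 P0)
  then show ?thesis using energy_between[OF E0 E0_pos P0 P0_nonneg] E[of T] T by simp
qed

theorem corollary1p1:
  shows "\<exists>lam1 lam2 :: real. 0 < lam1 \<and> lam1 < lam2 \<and>
    (\<forall>(m :: nat) (\<eta>0 :: real \<Rightarrow> real) (\<eta> :: real \<Rightarrow> real \<Rightarrow> real) (v :: real \<Rightarrow> real \<Rightarrow> real).
       m > 3 \<longrightarrow>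
       ((\<exists>a1 :: real. a1 \<noteq> 0 \<and> \<eta>0 = (\<lambda>\<theta>. a1 * e_odd 1 \<theta>)) \<or>
        (\<exists>(k :: nat) (a1 :: real) (ak :: real). k \<ge> 2 \<and>
            \<eta>0 = (\<lambda>\<theta>. a1 * e_odd 1 \<theta> + ak * e_odd k \<theta>) \<and>
            0 < ak\<^sup>2 \<and> ak\<^sup>2 \<le> 11 / (18 * (d_coef (k + 2) - d_coef k)) * a1\<^sup>2)) \<longrightarrow>
       classical_odd_solution \<eta>0 \<eta> v \<longrightarrow>
       solution_regularity m \<eta> \<longrightarrow>
       (\<forall>t>0. 0 < sqrt (J_fun lam1 \<eta>0 t) \<and>
               sqrt (J_fun lam1 \<eta>0 t) < norm_DW (\<eta> t) \<and>
               norm_DW (\<eta> t) < sqrt (J_fun lam2 \<eta>0 t)))"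
proof (rule exI[of _ "1 / 25"], rule exI[of _ 1], intro conjI allI impI)
  fix m :: nat and \<eta>0 :: "real \<Rightarrow> real" and \<eta> v :: "real \<Rightarrow> real \<Rightarrow> real" and t :: real
  assume m: "m > 3"
    and data: "(\<exists>a1 :: real. a1 \<noteq> 0 \<and> \<eta>0 = (\<lambda>\<theta>. a1 * e_odd 1 \<theta>)) \<or>
        (\<exists>(k :: nat) (a1 :: real) (ak :: real). k \<ge> 2 \<and>
            \<eta>0 = (\<lambda>\<theta>. a1 * e_odd 1 \<theta> + ak * e_odd k \<theta>) \<and>
            0 < ak^2 \<and> ak^2 \<le> 11 / (18 * (d_coef (k + 2) - d_coef k)) * a1^2)"
    and sol: "classical_odd_solution \<eta>0 \<eta> v" and reg: "solution_regularity m \<eta>" and t: "t > 0"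
  obtain k a1 ak where k: "k \<ge> 2" and \<eta>0: "\<eta>0 = (\<lambda>\<theta>. a1 * e_odd 1 \<theta> + ak * e_odd k \<theta>)"
    and a1: "a1 \<noteq> 0" and ak: "sym_coef k * ak^2 \<le> 11 / 18 * a1^2"
    using data
  proof (elim disjE exE conjE)
    \<comment> \<open>a second mode of amplitude zero\<close>
    fix a1 :: real assume "a1 \<noteq> 0" "\<eta>0 = (\<lambda>\<theta>. a1 * e_odd 1 \<theta>)"
    then show thesis by (intro that[of 2 a1 0]) auto
  next
    fix k :: nat and a1 ak :: real
    assume k: "k \<ge> 2" and \<eta>0: "\<eta>0 = (\<lambda>\<theta>. a1 * e_odd 1 \<theta> + ak * e_odd k \<theta>)"
      and ak: "0 < ak^2" "ak^2 \<le> 11 / (18 * (d_coef (k + 2) - d_coef k)) * a1^2"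
    have D: "sym_coef k > 0" using k by (rule sym_coef_pos)
    have "sym_coef k * ak^2 \<le> sym_coef k * (11 / (18 * sym_coef k) * a1^2)"
      using ak(2) D unfolding sym_coef_def[symmetric] by (intro mult_left_mono) auto
    also have "\<dots> = 11 / 18 * a1^2" using D by simp
    finally have "sym_coef k * ak^2 \<le> 11 / 18 * a1^2" .
    moreover have "a1 \<noteq> 0" using ak by auto
    ultimately show thesis using k \<eta>0 by (intro that) auto
  qed
  note b = two_modes_bounds[OF m k \<eta>0 a1 ak sol reg t]
  show "0 < sqrt (J_fun (1 / 25) \<eta>0 t)" "sqrt (J_fun (1 / 25) \<eta>0 t) < norm_DW (\<eta> t)"
    "norm_DW (\<eta> t) < sqrt (J_fun 1 \<eta>0 t)"
    using b by (simp_all add: norm_DW_def)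
qed simp_all

end
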